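(* Let $X$ be a non-trivial separable Fréchet space over $\mathbb{K}\in\{\mathbb{R},\mathbb{C}\}$, let $N\in\mathbb{N}$, $N\geq 2$, $\mathbb{N}_N=\{1,\dots,N\}$. For each $j\in\mathbb{N}_N$ let $\alpha_j\geq 0$, $t_j>0$, let $C_j\in L(X)$ be injective and suppose $A_j$ is a subgenerator of a global $\alpha_j$-times integrated $C_j$-semigroup $(S_{\alpha_j}(t))_{t\geq0}$ on $X$. Let $n_j:=\lceil\alpha_j\rceil$, let $C\in L(X)$ be injective, and suppose that $[R(C)]$ is continuously embedded in $[C_j(D(A_j^{n_j}))]$ for all $j\in\mathbb{N}_N$. Suppose further: (i) there exists a dense subset $X_0'$ of $[R(C)]$ such that $\lim_{t\to\infty}G_j(\delta_t)x=0$ for all $x\in X_0'$ and $j\in\mathbb{N}_N$; (ii) there exist $x\in R(C)$ and $m\in\mathbb{N}$ such that $\lim_{t\to\infty}p_m(G_j(\delta_t)x)=\infty$ for all $j\in\mathbb{N}_N$ (resp. $\lim_{t\to\infty}\|G_j(\delta_t)x\|=\infty$ for all $j$, if $X$ is a Banach space). Then the tuple $((S_{\alpha_j}(t))_{t\geq0})_{1\leq j\leq N}$ is disjoint distributionally chaotic and the operators $G_1(\delta_{t_1}),G_2(\delta_{t_2}),\dots,G_N(\delta_{t_N})$ are disjoint distributionally chaotic; if $R(C)$ is dense in $X$, then both are densely disjoint distributionally chaotic.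
   Context: $X$ has topology induced by an increasing fundamental system of seminorms $(p_n)_{n\in\mathbb{N}}$ and metric $d(x,y)=\sum_{n\ge1}2^{-n}\frac{p_n(x-y)}{1+p_n(x-y)}$ (if $X$ is Banach, $d(x,y)=\|x-y\|$). $g_\zeta(t)=t^{\zeta-1}/\Gamma(\zeta)$ for $t>0,\zeta>0$. Upper density of $D\subseteq[0,\infty)$: $\overline{dens}(D)=\limsup_{t\to\infty}m(D\cap[0,t])/t$ ($m$ Lebesgue measure). Integrated $C$-semigroups: for $\alpha\ge0$, injective $C\in L(X)$ and a closed linear operator $A$, a strongly continuous family $(S_\alpha(t))_{t\ge0}\subseteq L(X)$ is a global $\alpha$-times integrated $C$-semigroup with subgenerator $A$ if $S_\alpha(t)A\subseteq AS_\alpha(t)$, $S_\alpha(t)C=CS_\alpha(t)$ for $t\ge0$, and for all $x\in X$, $t\ge0$: $\int_0^tS_\alpha(s)x\,ds\in D(A)$ and $A\int_0^tS_\alpha(s)x\,ds=S_\alpha(t)x-g_{\alpha+1}(t)Cx$. Its integral generator is $\hat A=\{(x,y):S_\alpha(t)x-g_{\alpha+1}(t)Cx=\int_0^tS_\alpha(s)y\,ds,\ t\ge0\}$. For $\beta>\alpha$ set $S_\beta=g_{\beta-\alpha}*S_\alpha$ (with $S_\alpha$ itself if $\beta=\alpha$). For the $j$-th semigroup, $Z_1(A_j)$ is the set of $x\in X$ such that $t\mapsto C_j^{-1}S_{n_j}(t)x$ is well defined (i.e. $S_{n_j}(t)x\in R(C_j)$) and $n_j$-times continuously differentiable on $[0,\infty)$;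 for such $x$, $G_j(\delta_t)x:=\frac{d^{n_j}}{dt^{n_j}}C_j^{-1}S_{n_j}(t)x$, which is the unique mild solution of $u'=A_ju$, $u(0)=x$. $G_j(\delta_t)$ is a linear operator with domain $Z_1(A_j)$ mapping $Z_1(A_j)$ into itself. Spaces: $[R(C)]$ is $R(C)$ with the seminorms $p_n^C(x)=p_n(C^{-1}x)$. For $n\ge0$, $[C_j(D(A_j^{n}))]$ is $C_j(D(A_j^n))$ with seminorms $p_{m,n}(C_jx)=p_m(x)+p_m(A_jx)+\dots+p_m(A_j^nx)$, $m\in\mathbb{N}$, $x\in D(A_j^n)$ (norm $\|C_jx\|_n=\sum_{i=0}^n\|A_j^ix\|$ if $X$ is Banach). Disjoint distributional chaos of the tuple of integrated semigroups: there exist an uncountable set $S\subseteq\bigcap_{j=1}^NZ_1(A_j)$ and $\sigma>0$ such that for every $\epsilon>0$ and distinct $x,y\in S$: $\overline{dens}(\bigcap_{j}\{t\ge0:d(G_j(\delta_t)x,G_j(\delta_t)y)\ge\sigma\})=1$ and $\overline{dens}(\bigcap_j\{t\ge0:d(G_j(\delta_t)x,G_j(\delta_t)y)<\epsilon\})=1$; densely so if $S$ can be chosen dense in $X$. Disjoint distributional chaos of operators $B_1,\dots,B_N$ (here $B_j=G_j(\delta_{t_j})$): there exist an uncountable $S\subseteq\bigcap_{j}\bigcap_{k\ge1}D(B_j^k)$ and $\sigma>0$ such that for every $\epsilon>0$ and distinct $x,y\in S$, $\overline{dens}(\bigcap_j\{k\in\mathbb{N}:d(B_j^kx,B_j^ky)\ge\sigma\})=1$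 and $\overline{dens}(\bigcap_j\{k\in\mathbb{N}:d(B_j^kx,B_j^ky)<\epsilon\})=1$, where for $D\subseteq\mathbb{N}$, $\overline{dens}(D)=\limsup_{n\to\infty}|D\cap[1,n]|/n$; densely so if $S$ can be chosen dense in $X$. *)

theory Defs
  imports "HOL-Analysis.Analysis"
begin

definition seminorm_on :: "('a::real_vector \<Rightarrow> real) \<Rightarrow> bool" where
  "seminorm_on q \<longleftrightarrow> (\<forall>x y. q (x + y) \<le> q x + q y) \<and> (\<forall>c x. q (c *\<^sub>R x) = \<bar>c\<bar> * q x)"

text \<open>The metric d(x,y) = sum 2^(-n) p_n(x-y)/(1+p_n(x-y)); seminorm p_n is indexed from 0 here.\<close>
definition fdist :: "(nat \<Rightarrow> 'a::real_vector \<Rightarrow> real) \<Rightarrow> 'a \<Rightarrow> 'a \<Rightarrow> real" where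
  "fdist p x y = (\<Sum>n. (1/2) ^ Suc n * (p n (x - y) / (1 + p n (x - y))))"

definition ftendsto :: "(nat \<Rightarrow> 'a::real_vector \<Rightarrow> real) \<Rightarrow> ('b \<Rightarrow> 'a) \<Rightarrow> 'a \<Rightarrow> 'b filter \<Rightarrow> bool" where
  "ftendsto p f l F \<longleftrightarrow> ((\<lambda>x. fdist p (f x) l) \<longlongrightarrow> 0) F"

definition frechet :: "(nat \<Rightarrow> 'a::real_vector \<Rightarrow> real) \<Rightarrow> bool" where
  "frechet p \<longleftrightarrow> (\<forall>n. seminorm_on (p n)) \<and> (\<forall>n x. p n x \<le> p (Suc n) x)
     \<and> (\<forall>x. (\<forall>n. p n x = 0) \<longrightarrow> x = 0)
     \<and> (\<forall>f::nat \<Rightarrow> 'a. (\<forall>e>0. \<exists>M. \<forall>m\<ge>M. \<forall>k\<ge>M. fdist p (f m) (f k) < e)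
            \<longrightarrow> (\<exists>l. ftendsto p f l sequentially))"

definition fdense :: "(nat \<Rightarrow> 'a::real_vector \<Rightarrow> real) \<Rightarrow> 'a set \<Rightarrow> 'a set \<Rightarrow> bool" where
  "fdense p D Y \<longleftrightarrow> D \<subseteq> Y \<and> (\<forall>y\<in>Y. \<forall>e>0. \<exists>z\<in>D. fdist p y z < e)"

definition fseparable :: "(nat \<Rightarrow> 'a::real_vector \<Rightarrow> real) \<Rightarrow> bool" where
  "fseparable p \<longleftrightarrow> (\<exists>D. countable D \<and> fdense p D UNIV)"

definition fbounded_op :: "(nat \<Rightarrow> 'a::real_vector \<Rightarrow> real) \<Rightarrow> ('a \<Rightarrow> 'a) \<Rightarrow> bool" where
  "fbounded_op p T \<longleftrightarrow> linear T \<and>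
     (\<forall>x. \<forall>e>0. \<exists>d>0. \<forall>y. fdist p x y < d \<longrightarrow> fdist p (T x) (T y) < e)"

definition closed_lin_op :: "(nat \<Rightarrow> 'a::real_vector \<Rightarrow> real) \<Rightarrow> 'a set \<Rightarrow> ('a \<Rightarrow> 'a) \<Rightarrow> bool" where
  "closed_lin_op p DA A \<longleftrightarrow> 0 \<in> DA
     \<and> (\<forall>x\<in>DA. \<forall>y\<in>DA. x + y \<in> DA \<and> A (x + y) = A x + A y)
     \<and> (\<forall>x\<in>DA. \<forall>c. c *\<^sub>R x \<in> DA \<and> A (c *\<^sub>R x) = c *\<^sub>R A x)
     \<and> (\<forall>xs x y. (\<forall>k. xs k \<in> DA) \<and> ftendsto p xs x sequentially \<and> ftendsto p (\<lambda>k. A (xs k)) y sequentially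
          \<longrightarrow> x \<in> DA \<and> A x = y)"

definition dom_pow :: "'a set \<Rightarrow> ('a \<Rightarrow> 'a) \<Rightarrow> nat \<Rightarrow> 'a set" where
  "dom_pow DA A n = {x. \<forall>i<n. (A ^^ i) x \<in> DA}"

definition rlim :: "(nat \<Rightarrow> 'a::real_vector \<Rightarrow> real) \<Rightarrow> (real \<Rightarrow> 'a) \<Rightarrow> real \<Rightarrow> real \<Rightarrow> 'a \<Rightarrow> bool" where
  "rlim p f a c J \<longleftrightarrow> ftendsto p
     (\<lambda>n. ((c - a) / real (Suc n)) *\<^sub>R (\<Sum>k\<le>n. f (a + real k * (c - a) / real (Suc n)))) J sequentially"

text \<open>integral over [a,b] = lim_{c -> b-} integral over [a,c] (covers integrable singularities at b).\<close>
definition has_fint :: "(nat \<Rightarrow> 'a::real_vector \<Rightarrow> real) \<Rightarrow> (real \<Rightarrow> 'a) \<Rightarrow> real \<Rightarrow> real \<Rightarrow> 'a \<Rightarrow> bool" where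
  "has_fint p f a b I \<longleftrightarrow> a \<le> b \<and> (a = b \<longrightarrow> I = 0) \<and>
     (a < b \<longrightarrow> (\<exists>J. (\<forall>c\<in>{a<..<b}. rlim p f a c (J c)) \<and> ftendsto p J I (at_left b)))"

text \<open>g_zeta(t) = t^(zeta-1)/Gamma(zeta) for t > 0; at t = 0 extended by its limit (only used for zeta >= 1).\<close>
definition gfun :: "real \<Rightarrow> real \<Rightarrow> real" where
  "gfun z t = (if t > 0 then t powr (z - 1) / Gamma z else if z = 1 then 1 else 0)"

definition int_C_semigroup ::
  "(nat \<Rightarrow> 'a::real_vector \<Rightarrow> real) \<Rightarrow> real \<Rightarrow> ('a \<Rightarrow> 'a) \<Rightarrow> 'a set \<Rightarrow> ('a \<Rightarrow> 'a) \<Rightarrow> (real \<Rightarrow> 'a \<Rightarrow> 'a) \<Rightarrow> bool" where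
  "int_C_semigroup p \<alpha> C DA A S \<longleftrightarrow>
     (\<forall>t\<ge>0. fbounded_op p (S t))
   \<and> (\<forall>x. \<forall>t\<ge>0. ftendsto p (\<lambda>s. S s x) (S t x) (at t within {0..}))
   \<and> (\<forall>t\<ge>0. \<forall>x\<in>DA. S t x \<in> DA \<and> S t (A x) = A (S t x))
   \<and> (\<forall>t\<ge>0. \<forall>x. S t (C x) = C (S t x))
   \<and> (\<forall>t\<ge>0. \<forall>x. \<exists>I. has_fint p (\<lambda>s. S s x) 0 t I \<and> I \<in> DA
                      \<and> A I = S t x - gfun (\<alpha> + 1) t *\<^sub>R C x)"

definition sbeta :: "(nat \<Rightarrow> 'a::real_vector \<Rightarrow> real) \<Rightarrow> (real \<Rightarrow> 'a \<Rightarrow> 'a) \<Rightarrow> real \<Rightarrow> real \<Rightarrow> real \<Rightarrow> 'a \<Rightarrow> 'a \<Rightarrow> bool" where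
  "sbeta p S \<alpha> \<beta> t x y \<longleftrightarrow>
     (if \<beta> = \<alpha> then y = S t x else has_fint p (\<lambda>s. gfun (\<beta> - \<alpha>) (t - s) *\<^sub>R S s x) 0 t y)"

definition fCk :: "(nat \<Rightarrow> 'a::real_vector \<Rightarrow> real) \<Rightarrow> nat \<Rightarrow> (nat \<Rightarrow> real \<Rightarrow> 'a) \<Rightarrow> bool" where
  "fCk p n D \<longleftrightarrow> (\<forall>k\<le>n. \<forall>t\<ge>0. ftendsto p (D k) (D k t) (at t within {0..}))
     \<and> (\<forall>k<n. \<forall>t\<ge>0. ftendsto p (\<lambda>h. (1 / h) *\<^sub>R (D k (t + h) - D k t)) (D (Suc k) t) (at 0 within {-t..}))"

definition mild_data :: "(nat \<Rightarrow> 'a::real_vector \<Rightarrow> real) \<Rightarrow> ('a \<Rightarrow> 'a) \<Rightarrow> (real \<Rightarrow> 'a \<Rightarrow> 'a) \<Rightarrow> real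
    \<Rightarrow> 'a \<Rightarrow> (nat \<Rightarrow> real \<Rightarrow> 'a) \<Rightarrow> bool" where
  "mild_data p C S \<alpha> x D \<longleftrightarrow>
     (\<forall>t\<ge>0. sbeta p S \<alpha> (real (nat \<lceil>\<alpha>\<rceil>)) t x (C (D 0 t))) \<and> fCk p (nat \<lceil>\<alpha>\<rceil>) D"

definition Z1 :: "(nat \<Rightarrow> 'a::real_vector \<Rightarrow> real) \<Rightarrow> ('a \<Rightarrow> 'a) \<Rightarrow> (real \<Rightarrow> 'a \<Rightarrow> 'a) \<Rightarrow> real \<Rightarrow> 'a set" where
  "Z1 p C S \<alpha> = {x. \<exists>D. mild_data p C S \<alpha> x D}"

text \<open>G(delta_t) x = d^n/dt^n C^{-1} S_n(t) x, for x in Z_1(A) and t >= 0.\<close>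
definition Gop :: "(nat \<Rightarrow> 'a::real_vector \<Rightarrow> real) \<Rightarrow> ('a \<Rightarrow> 'a) \<Rightarrow> (real \<Rightarrow> 'a \<Rightarrow> 'a) \<Rightarrow> real \<Rightarrow> real \<Rightarrow> 'a \<Rightarrow> 'a" where
  "Gop p C S \<alpha> t x = (THE y. \<exists>D. mild_data p C S \<alpha> x D \<and> y = D (nat \<lceil>\<alpha>\<rceil>) t)"

definition updens_real :: "real set \<Rightarrow> ereal" where
  "updens_real D = Limsup at_top (\<lambda>t. ereal (measure lebesgue (D \<inter> {0..t}) / t))"

definition updens_nat :: "nat set \<Rightarrow> ereal" where
  "updens_nat D = limsup (\<lambda>n. ereal (real (card (D \<inter> {1..n})) / real n))"

definition dd_chaotic_sg :: "(nat \<Rightarrow> 'a::real_vector \<Rightarrow> real) \<Rightarrow> nat \<Rightarrow> (nat \<Rightarrow> 'a \<Rightarrow> 'a)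
    \<Rightarrow> (nat \<Rightarrow> real \<Rightarrow> 'a \<Rightarrow> 'a) \<Rightarrow> (nat \<Rightarrow> real) \<Rightarrow> bool \<Rightarrow> bool" where
  "dd_chaotic_sg p N C S \<alpha> dens \<longleftrightarrow> (\<exists>SS \<sigma>. uncountable SS \<and> (dens \<longrightarrow> fdense p SS UNIV)
     \<and> (\<forall>j\<in>{1..N}. SS \<subseteq> Z1 p (C j) (S j) (\<alpha> j)) \<and> \<sigma> > 0
     \<and> (\<forall>e>0. \<forall>x\<in>SS. \<forall>y\<in>SS. x \<noteq> y \<longrightarrow>
          updens_real {t. t \<ge> 0 \<and> (\<forall>j\<in>{1..N}.
              fdist p (Gop p (C j) (S j) (\<alpha> j) t x) (Gop p (C j) (S j) (\<alpha> j) t y) \<ge> \<sigma>)} = 1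
        \<and> updens_real {t. t \<ge> 0 \<and> (\<forall>j\<in>{1..N}.
              fdist p (Gop p (C j) (S j) (\<alpha> j) t x) (Gop p (C j) (S j) (\<alpha> j) t y) < e)} = 1))"

definition dd_chaotic_ops :: "(nat \<Rightarrow> 'a::real_vector \<Rightarrow> real) \<Rightarrow> nat \<Rightarrow> (nat \<Rightarrow> 'a set)
    \<Rightarrow> (nat \<Rightarrow> 'a \<Rightarrow> 'a) \<Rightarrow> bool \<Rightarrow> bool" where
  "dd_chaotic_ops p N Dom B dens \<longleftrightarrow> (\<exists>SS \<sigma>. uncountable SS \<and> (dens \<longrightarrow> fdense p SS UNIV)
     \<and> (\<forall>j\<in>{1..N}. \<forall>x\<in>SS. \<forall>k. ((B j) ^^ k) x \<in> Dom j) \<and> \<sigma> > 0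
     \<and> (\<forall>e>0. \<forall>x\<in>SS. \<forall>y\<in>SS. x \<noteq> y \<longrightarrow>
          updens_nat {k. k \<ge> 1 \<and> (\<forall>j\<in>{1..N}. fdist p (((B j) ^^ k) x) (((B j) ^^ k) y) \<ge> \<sigma>)} = 1
        \<and> updens_nat {k. k \<ge> 1 \<and> (\<forall>j\<in>{1..N}. fdist p (((B j) ^^ k) x) (((B j) ^^ k) y) < e)} = 1))"

definition semRC :: "(nat \<Rightarrow> 'a::real_vector \<Rightarrow> real) \<Rightarrow> ('a \<Rightarrow> 'a) \<Rightarrow> nat \<Rightarrow> 'a \<Rightarrow> real" where
  "semRC p C m y = p m (THE x. C x = y)"

definition semCD :: "(nat \<Rightarrow> 'a::real_vector \<Rightarrow> real) \<Rightarrow> ('a \<Rightarrow> 'a) \<Rightarrow> 'a set \<Rightarrow> ('a \<Rightarrow> 'a) \<Rightarrow> nat \<Rightarrow> nat \<Rightarrow> 'a \<Rightarrow> real" where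
  "semCD p Cj DA A n m y = (\<Sum>i\<le>n. p m ((A ^^ i) (THE x. x \<in> dom_pow DA A n \<and> Cj x = y)))"

definition cont_embedded :: "(nat \<Rightarrow> 'a::real_vector \<Rightarrow> real) \<Rightarrow> 'a set \<Rightarrow> (nat \<Rightarrow> 'a \<Rightarrow> real) \<Rightarrow> 'a set \<Rightarrow> bool" where
  "cont_embedded q Y r Z \<longleftrightarrow> Y \<subseteq> Z \<and>
     (\<forall>x\<in>Y. \<forall>e>0. \<exists>d>0. \<forall>y\<in>Y. fdist q x y < d \<longrightarrow> fdist r x y < e)"

end

theory Submission
  imports Defs
begin

text \<open>
  If C w = C_j y with y in the domain of A_j^n, then the orbit of C w under G_j is
  S_n(t) A_j^n y plus the sum over i < n of t^i/i! C_j A_j^i y. It is the unique mild solution starting at C w,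
  which makes the orbits linear in w, locally equicontinuous, and compatible with translation in time, so that
  the powers of G_j(delta_s) sample the orbit at the multiples of s. Identities between vector-valued
  integrals are reduced to scalar ones by means of the Hahn--Banach theorem.

  Hypothesis (ii) gives one vector whose orbits tend to infinity, and (i) a dense set of vectors whose
  orbits tend to 0. Approximating small multiples of the former by the latter yields vectors x_i and
  time blocks [a_i, (i+1) a_i] such that the orbits of x_i are large throughout the i-th block, while all
  other x_l together are negligible there. A series of the x_i with coefficients -1, 0, 1 is
  then large on the blocks where the coefficient is nonzero and small on the others, and each single
  block almost exhausts the time interval ending with it, also after sampling. Hence subsets of the
  index set differing at infinitely many indices and agreeing at infinitely many indices give pairs as required.
\<close>

section \<open>Metrics from increasing families of seminorms\<close>

text \<open>The type carries no topology of its own: convergence, density and completeness are read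
  off \<open>fdist p\<close>, with a constant passage between \<open>fdist\<close> and single
  seminorms. By Hahn--Banach, p k is the supremum of |phi| over the functionals phi dominated by p
  k, so a scalar estimate uniform in these phi is an estimate of p k. This makes vector-valued
  Riemann sums Cauchy and carries Fubini and the fundamental theorem of calculus over to X. Two
  obstacles shape the rest. As \<alpha> need not be an integer, S_n may arise from S_\<alpha>
  through a kernel that is singular at the end point; identities are integrated further until their
  orders match, and integrations are then cancelled by injectivity. And G_j is defined on Z_1 only,
  where no topology is at hand. The maps T j t w = G_j(delta_t) C w are defined on all of X, the
  embedding makes them locally equicontinuous, and since C is an isometry of X onto [R(C)], density
  in [R(C)] becomes density in X. Chaos is therefore established for the parameters w and moved to
  R(C) by C at the end.\<close>

lemma summable_fdist:
  assumes "\<And>n. 0 \<le> q n"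
  shows "summable (\<lambda>n. (1/2::real) ^ Suc n * (q n / (1 + q n)))"
proof (rule summable_comparison_test')
  show "summable (\<lambda>n. (1/2::real) ^ Suc n)"
    by (simp add: summable_geometric)
  fix n :: nat
  have "q n / (1 + q n) \<le> 1" "0 \<le> q n / (1 + q n)"
    using assms[of n] by (auto simp: divide_simps)
  then have "(1/2::real) ^ Suc n * (q n / (1 + q n)) \<le> (1/2) ^ Suc n * 1"
    "0 \<le> (1/2::real) ^ Suc n * (q n / (1 + q n))"
    by (intro mult_left_mono mult_nonneg_nonneg; simp)+
  then show "norm ((1/2::real) ^ Suc n * (q n / (1 + q n))) \<le> (1/2) ^ Suc n"
    by (simp only: real_norm_def abs_of_nonneg mult_1_right)
qed

lemma fdist_nonneg:
  assumes "\<And>n. 0 \<le> p n (x - y)"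
  shows "0 \<le> fdist p x y"
  unfolding fdist_def using assms by (intro suminf_nonneg summable_fdist) auto

lemma fdist_ge_term:
  assumes "\<And>n. 0 \<le> p n (x - y)"
  shows "(1/2) ^ Suc k * (p k (x - y) / (1 + p k (x - y))) \<le> fdist p x y"
  unfolding fdist_def
  using assms sum_le_suminf[OF summable_fdist[of "\<lambda>n. p n (x - y)"], of "{k}"] by simp

lemma divide_one_plus_mono:
  assumes "0 \<le> a" "a \<le> (b::real)"
  shows "a / (1 + a) \<le> b / (1 + b)"
  using assms by (simp add: divide_simps) (simp add: algebra_simps)

lemma fdist_ge_frac:
  assumes "\<And>n. 0 \<le> p n (x - y)" "0 \<le> \<delta>" "\<delta> \<le> p k (x - y)"
  shows "(1/2) ^ Suc k * (\<delta> / (1 + \<delta>)) \<le> fdist p x y"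
proof -
  have "(1/2) ^ Suc k * (\<delta> / (1 + \<delta>)) \<le> (1/2) ^ Suc k * (p k (x - y) / (1 + p k (x - y)))"
    using assms by (intro mult_left_mono divide_one_plus_mono) auto
  then show ?thesis
    using fdist_ge_term[of p x y k, OF assms(1)] by linarith
qed

text \<open>The k-th summand alone bounds the metric from below, and r/(1+r) is increasing, so the
  value of that summand at r = \<delta> serves as e, uniformly in x and y.\<close>

lemma seminorm_small_of_fdist:
  assumes nn: "\<And>n z. 0 \<le> p n z" and d: "\<delta> > 0"
  shows "\<exists>e>0. \<forall>x y. fdist p x y < e \<longrightarrow> p k (x - y) < \<delta>"
proof (intro exI conjI allI impI)
  show "(1/2::real) ^ Suc k * (\<delta> / (1 + \<delta>)) > 0" using d by simp
  fix x y
  assume *: "fdist p x y < (1/2::real) ^ Suc k * (\<delta> / (1 + \<delta>))"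
  show "p k (x - y) < \<delta>"
  proof (rule ccontr)
    assume "\<not> p k (x - y) < \<delta>"
    then show False
      using fdist_ge_frac[of p x y \<delta> k, OF nn] d * by simp
  qed
qed

text \<open>Cut the series at n: the first n summands have total weight at most 1 and are controlled
  by p n through monotonicity; the others contribute at most the geometric tail.\<close>

lemma fdist_le:
  assumes nn: "\<And>n. 0 \<le> p n (x - y)" and mono: "\<And>n. p n (x - y) \<le> p (Suc n) (x - y)"
  shows "fdist p x y \<le> p n (x - y) + (1/2) ^ n"
proof -
  define q where "q n = p n (x - y)" for n
  define c where "c i = (1/2::real) ^ Suc i * (q i / (1 + q i))" for i
  have q0: "0 \<le> q i" for i using nn by (simp add: q_def)
  have qm: "q i \<le> q j" if "i \<le> j" for i j
    using that mono lift_Suc_mono_le[of q] by (simp add: q_def)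
  have sc: "summable c" unfolding c_def by (rule summable_fdist[OF q0])
  have c1: "c i \<le> (1/2) ^ Suc i * q n" if "i < n" for i
  proof -
    have "q i / (1 + q i) \<le> q i / 1" using q0[of i] by (intro divide_left_mono) auto
    also have "\<dots> \<le> q n" using qm[of i n] that by simp
    finally show ?thesis unfolding c_def by (intro mult_left_mono) auto
  qed
  have c2: "c i \<le> (1/2) ^ Suc i" for i
  proof -
    have "q i / (1 + q i) \<le> 1" using q0[of i] by (simp add: divide_simps)
    then have "c i \<le> (1/2) ^ Suc i * 1" unfolding c_def by (intro mult_left_mono) auto
    then show ?thesis by simp
  qed
  have geo: "(\<Sum>i<n. (1/2::real) ^ Suc i) \<le> 1" for n
  proof -
    have "(\<Sum>i<n. (1/2::real) ^ Suc i) = 1 - (1/2)^n" by (induction n) auto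
    then show ?thesis by simp
  qed
  have "(\<Sum>i. c i) = (\<Sum>i. c (i + n)) + (\<Sum>i<n. c i)"
    by (rule suminf_split_initial_segment[OF sc])
  also have "(\<Sum>i<n. c i) \<le> (\<Sum>i<n. (1/2) ^ Suc i * q n)"
    using c1 by (intro sum_mono) auto
  also have "\<dots> = (\<Sum>i<n. (1/2) ^ Suc i) * q n" by (simp add: sum_distrib_right)
  also have "\<dots> \<le> q n" using geo[of n] q0[of n] by (intro mult_left_le_one_le) (auto intro!: sum_nonneg)
  also have "(\<Sum>i. c (i + n)) \<le> (\<Sum>i. (1/2) ^ n * (1/2) ^ Suc i)"
  proof (rule suminf_le)
    show "summable (\<lambda>i. c (i + n))" using sc by (simp add: summable_iff_shift)
    show "summable (\<lambda>i. (1/2::real) ^ n * (1/2) ^ Suc i)"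
      by (intro summable_mult) (simp add: summable_geometric)
    show "c (i + n) \<le> (1/2) ^ n * (1/2) ^ Suc i" for i
      using c2[of "i + n"] by (simp add: power_add mult.commute)
  qed
  also have "(\<Sum>i. (1/2::real) ^ n * (1/2) ^ Suc i) = (1/2) ^ n"
    using sums_unique[OF sums_mult[OF power_half_series, of "(1/2) ^ n"]] by (simp only: mult_1_right)
  finally show ?thesis by (simp add: fdist_def c_def q_def)
qed

lemma fdist_small_of_seminorm:
  assumes nn: "\<And>n z. 0 \<le> p n z" and mono: "\<And>n z. p n z \<le> p (Suc n) z" and e: "e > 0"
  shows "\<exists>k. \<exists>\<delta>>0. \<forall>x y. p k (x - y) < \<delta> \<longrightarrow> fdist p x y < e"
proof -
  obtain k where k: "(1/2::real) ^ k < e / 2"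
    using real_arch_pow_inv[of "e/2" "1/2"] e by auto
  have "fdist p x y < e" if "p k (x - y) < e / 2" for x y
    using fdist_le[of p x y k, OF nn mono] k that by linarith
  then show ?thesis using e by (intro exI[of _ k] exI[of _ "e/2"]) auto
qed

text \<open>Homogeneity turns a neighbourhood condition into a linear bound: scaling x to r-size
  \<delta>/2 gives the factor 2/\<delta>. If r x = 0, every multiple of x lies in the neighbourhood,
  which forces q x = 0. Continuity is converted into constants in this way throughout.\<close>

lemma seminorm_bound_of_small:
  fixes q r :: "'a::real_vector \<Rightarrow> real"
  assumes q: "\<And>c x. q (c *\<^sub>R x) = \<bar>c\<bar> * q x" "\<And>x. 0 \<le> q x"
    and r: "\<And>c x. r (c *\<^sub>R x) = \<bar>c\<bar> * r x" "\<And>x. 0 \<le> r x"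
    and \<delta>: "\<delta> > 0" "\<And>x. r x < \<delta> \<Longrightarrow> q x < 1"
  shows "q x \<le> 2 / \<delta> * r x"
proof (cases "r x = 0")
  case True
  have "q x = 0"
  proof (rule ccontr)
    assume "q x \<noteq> 0"
    then have "q x > 0" using q(2)[of x] by simp
    have "q ((1 / q x) *\<^sub>R x) < 1" using True \<delta> r by simp
    then show False using \<open>q x > 0\<close> q(1) by simp
  qed
  then show ?thesis using True by simp
next
  case False
  then have pos: "r x > 0" using r(2)[of x] by simp
  have "r ((\<delta> / (2 * r x)) *\<^sub>R x) < \<delta>" using pos \<delta> by (simp add: r(1))
  then have "q ((\<delta> / (2 * r x)) *\<^sub>R x) < 1" by (rule \<delta>)
  then have "\<delta> / (2 * r x) * q x < 1" using pos \<delta> by (simp add: q(1))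
  then show ?thesis using pos \<delta> by (simp add: divide_simps) (simp add: algebra_simps)
qed

section \<open>The Hahn--Banach theorem for a seminorm\<close>

text \<open>In the extension step below, v is a pair of a new vector and its value, and the set is
  the graph extended by that vector.\<close>

lemma subspace_add_line:
  assumes "subspace M"
  shows "subspace {m + c *\<^sub>R v | m c. m \<in> M}"
proof (rule subspaceI)
  show "0 \<in> {m + c *\<^sub>R v | m c. m \<in> M}"
    using subspace_0[OF assms] by (intro CollectI exI[of _ 0] exI[of _ "0::real"]) simp
next
  fix x y assume "x \<in> {m + c *\<^sub>R v | m c. m \<in> M}" "y \<in> {m + c *\<^sub>R v | m c. m \<in> M}"
  then obtain m c m' c' where "x = m + c *\<^sub>R v" "m \<in> M" "y = m' + c' *\<^sub>R v" "m' \<in> M" by blast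
  then have "x + y = (m + m') + (c + c') *\<^sub>R v" "m + m' \<in> M"
    using assms subspace_add by (auto simp: algebra_simps)
  then show "x + y \<in> {m + c *\<^sub>R v | m c. m \<in> M}" by blast
next
  fix a x assume "x \<in> {m + c *\<^sub>R v | m c. m \<in> M}"
  then obtain m c where "x = m + c *\<^sub>R v" "m \<in> M" by blast
  then have "a *\<^sub>R x = a *\<^sub>R m + (a * c) *\<^sub>R v" "a *\<^sub>R m \<in> M"
    using assms subspace_scale by (auto simp: algebra_simps)
  then show "a *\<^sub>R x \<in> {m + c *\<^sub>R v | m c. m \<in> M}" by blast
qed

text \<open>Functionals are encoded by their graphs, which are subspaces of the product space; a graph lying
  below a seminorm is automatically single-valued.\<close>

theorem Hahn_Banach_seminorm:
  fixes q :: "'a::real_vector \<Rightarrow> real"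
  assumes q: "seminorm_on q"
  shows "\<exists>\<phi>. linear \<phi> \<and> (\<forall>x. \<bar>\<phi> x\<bar> \<le> q x) \<and> \<phi> x0 = q x0"
proof -
  have tri: "q (x + y) \<le> q x + q y" and hom: "q (c *\<^sub>R x) = \<bar>c\<bar> * q x" for x y c
    using q by (auto simp: seminorm_on_def)
  define \<G> where "\<G> = {G::('a \<times> real) set. subspace G \<and> (\<forall>(x, r)\<in>G. r \<le> q x)}"
  \<comment> \<open>Starting from the graph on the line through x0 forces the extension to attain q
    at x0.\<close>
  define G0 where "G0 = {c *\<^sub>R (x0, q x0) | c. True}"
  have G0: "G0 \<in> \<G>"
  proof -
    have "subspace G0"
    proof (rule subspaceI)
      show "0 \<in> G0" unfolding G0_def using scaleR_zero_left[of "(x0, q x0)"] by (metis (mono_tags) mem_Collect_eq)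
      show "x + y \<in> G0" if "x \<in> G0" "y \<in> G0" for x y
        using that unfolding G0_def by (auto simp flip: scaleR_add_left distrib_right)
      show "c *\<^sub>R x \<in> G0" if "x \<in> G0" for x c
        using that unfolding G0_def by (auto simp: mult.assoc[symmetric])
    qed
    moreover have "c * q x0 \<le> q (c *\<^sub>R x0)" for c
    proof -
      have "0 \<le> q x0" using tri[of x0 "-1 *\<^sub>R x0"] hom[of "-1" x0] hom[of 0 0] by simp
      then show ?thesis by (simp add: hom mult_right_mono)
    qed
    ultimately show ?thesis by (auto simp: \<G>_def G0_def)
  qed
  have "\<exists>M\<in>{G \<in> \<G>. G0 \<subseteq> G}. \<forall>X\<in>{G \<in> \<G>. G0 \<subseteq> G}. M \<subseteq> X \<longrightarrow> X = M"
  proof (rule subset_Zorn_nonempty)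
    show "{G \<in> \<G>. G0 \<subseteq> G} \<noteq> {}" using G0 by blast
    fix \<C> assume ne: "\<C> \<noteq> {}" and ch: "subset.chain {G \<in> \<G>. G0 \<subseteq> G} \<C>"
    have sub: "\<C> \<subseteq> {G \<in> \<G>. G0 \<subseteq> G}" and tot: "\<And>A B. A \<in> \<C> \<Longrightarrow> B \<in> \<C> \<Longrightarrow> A \<subseteq> B \<or> B \<subseteq> A"
      using ch by (auto simp: subset_chain_def)
    have "subspace (\<Union>\<C>)"
    proof (rule subspaceI)
      obtain D where "D \<in> \<C>" using ne by blast
      moreover have "subspace D" using \<open>D \<in> \<C>\<close> sub by (auto simp: \<G>_def)
      ultimately show "0 \<in> \<Union>\<C>" using subspace_0 by blast
    next
      fix x y assume "x \<in> \<Union>\<C>" "y \<in> \<Union>\<C>"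
      then obtain A B where AB: "A \<in> \<C>" "B \<in> \<C>" "x \<in> A" "y \<in> B" by blast
      then obtain D where "D \<in> \<C>" "x \<in> D" "y \<in> D" using tot[of A B] by blast
      moreover have "subspace D" using \<open>D \<in> \<C>\<close> sub by (auto simp: \<G>_def)
      ultimately show "x + y \<in> \<Union>\<C>" using subspace_add by blast
    next
      fix c x assume "x \<in> \<Union>\<C>"
      then obtain D where "D \<in> \<C>" "x \<in> D" by blast
      moreover have "subspace D" using \<open>D \<in> \<C>\<close> sub by (auto simp: \<G>_def)
      ultimately show "c *\<^sub>R x \<in> \<Union>\<C>" using subspace_scale by blast
    qed
    moreover have "G0 \<subseteq> \<Union>\<C>" using ne sub by blast
    moreover have "r \<le> q x" if "(x, r) \<in> \<Union>\<C>" for x r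
      using that sub unfolding \<G>_def by blast
    ultimately show "\<Union>\<C> \<in> {G \<in> \<G>. G0 \<subseteq> G}" by (auto simp: \<G>_def)
  qed
  then obtain M where M0: "M \<in> {G \<in> \<G>. G0 \<subseteq> G}"
    and max0: "\<forall>X\<in>{G \<in> \<G>. G0 \<subseteq> G}. M \<subseteq> X \<longrightarrow> X = M"
    by (rule bexE)
  have M: "M \<in> \<G>" "G0 \<subseteq> M" using M0 by simp_all
  have max: "X = M" if "X \<in> \<G>" "M \<subseteq> X" for X
    using max0 that order_trans[OF M(2) that(2)] by simp
  have sM: "subspace M" and le: "\<And>x r. (x, r) \<in> M \<Longrightarrow> r \<le> q x"
    using M by (auto simp: \<G>_def)
  have total: "\<exists>r. (v, r) \<in> M" for v
  proof -
    \<comment> \<open>Every lower bound for the value at v lies below every upper bound: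
      subadditivity at x + x' = (x - v) + (x' + v).\<close>
    have cross: "r - q (x - v) \<le> q (x' + v) - r'" if "(x, r) \<in> M" "(x', r') \<in> M" for x r x' r'
    proof -
      have "(x + x', r + r') \<in> M" using subspace_add[OF sM that] by simp
      then have "r + r' \<le> q ((x - v) + (x' + v))" using le by (simp add: algebra_simps)
      then show ?thesis using tri[of "x - v" "x' + v"] by linarith
    qed
    have "(0, 0) \<in> M" using subspace_0[OF sM] by (metis zero_prod_def)
    \<comment> \<open>The least value at v that the lower bounds admit.\<close>
    define a where "a = (SUP (x, r)\<in>M. r - q (x - v))"
    have bdd: "bdd_above ((\<lambda>(x, r). r - q (x - v)) ` M)"
      using cross[OF _ \<open>(0, 0) \<in> M\<close>] by (intro bdd_aboveI2[of _ _ "q (0 + v) - 0"]) (simp add: case_prod_unfold)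
    have a1: "r - q (x - v) \<le> a" if "(x, r) \<in> M" for x r
      unfolding a_def using cSUP_upper[OF that bdd] by simp
    have a2: "a \<le> q (x + v) - r" if "(x, r) \<in> M" for x r
      unfolding a_def using \<open>(0, 0) \<in> M\<close> cross[OF _ that] by (intro cSUP_least) (auto simp: case_prod_unfold)
    define M' where "M' = {m + c *\<^sub>R (v, a) | m c. m \<in> M}"
    have "M' \<in> \<G>"
    proof -
      have "r + c * a \<le> q (x + c *\<^sub>R v)" if "(x, r) \<in> M" for x r c
      proof -
        consider "c = 0" | "c > 0" | "c < 0" by linarith
        then show ?thesis
        proof cases
          case 1 then show ?thesis using le[OF that] by simp
        next
          case 2
          have "((1/c) *\<^sub>R x, (1/c) * r) \<in> M" using subspace_scale[OF sM that, of "1/c"] by simp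
          from a2[OF this] have "c * a \<le> c * q ((1/c) *\<^sub>R x + v) - r"
            using 2 by (simp add: field_simps)
          also have "c * q ((1/c) *\<^sub>R x + v) = q (c *\<^sub>R ((1/c) *\<^sub>R x + v))" using 2 by (simp add: hom)
          also have "c *\<^sub>R ((1/c) *\<^sub>R x + v) = x + c *\<^sub>R v" using 2 by (simp add: scaleR_add_right)
          finally show ?thesis by simp
        next
          case 3
          have "((-1/c) *\<^sub>R x, (-1/c) * r) \<in> M" using subspace_scale[OF sM that, of "-1/c"] by simp
          from a1[OF this] have "r - (-c) * q ((-1/c) *\<^sub>R x - v) \<le> - c * a"
            using 3 by (simp add: field_simps)
          also have "(-c) * q ((-1/c) *\<^sub>R x - v) = q ((-c) *\<^sub>R ((-1/c) *\<^sub>R x - v))" using 3 by (simp only: hom)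
          also have "(-c) *\<^sub>R ((-1/c) *\<^sub>R x - v) = x + c *\<^sub>R v" using 3 by (simp add: scaleR_diff_right)
          finally show ?thesis by simp
        qed
      qed
      then show ?thesis
        unfolding \<G>_def M'_def using subspace_add_line[OF sM] by auto
    qed
    moreover have "M \<subseteq> M'"
    proof
      fix m assume "m \<in> M"
      then have "m = m + 0 *\<^sub>R (v, a)" "m \<in> M" by (simp_all del: scaleR_Pair)
      then show "m \<in> M'" unfolding M'_def by blast
    qed
    ultimately have "M' = M" using max by blast
    moreover have "(v, a) \<in> M'"
      unfolding M'_def using subspace_0[OF sM] by (intro CollectI exI[of _ 0] exI[of _ "1::real"]) simp
    ultimately show ?thesis by blast
  qed
  \<comment> \<open>A vertical vector (0, d) in M satisfies d \<le> q 0 = 0, and so does its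
    negative.\<close>
  have uniq: "r = r'" if "(x, r) \<in> M" "(x, r') \<in> M" for x r r'
  proof -
    have "(0, r - r') \<in> M" "(0, r' - r) \<in> M"
      using subspace_diff[OF sM that] subspace_diff[OF sM that(2,1)] by auto
    then have "r - r' \<le> q 0" "r' - r \<le> q 0" using le by blast+
    moreover have "q 0 = 0" using hom[of 0 0] by simp
    ultimately show ?thesis by simp
  qed
  define \<phi> where "\<phi> x = (THE r. (x, r) \<in> M)" for x
  have \<phi>: "(x, \<phi> x) \<in> M" for x
    unfolding \<phi>_def using total[of x] uniq by (metis (mono_tags, lifting) theI)
  have \<phi>I: "\<phi> x = r" if "(x, r) \<in> M" for x r using uniq[OF \<phi> that] .
  have "linear \<phi>"
  proof (rule linearI)
    show "\<phi> (x + y) = \<phi> x + \<phi> y" for x y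
      using subspace_add[OF sM \<phi>[of x] \<phi>[of y]] by (intro \<phi>I) simp
    show "\<phi> (c *\<^sub>R x) = c *\<^sub>R \<phi> x" for x c
      using subspace_scale[OF sM \<phi>[of x]] by (intro \<phi>I) simp
  qed
  moreover have "\<bar>\<phi> x\<bar> \<le> q x" for x
  proof -
    have "- \<phi> x = \<phi> (- x)" using linear_neg[OF \<open>linear \<phi>\<close>] by simp
    moreover have "q (- x) = q x" using hom[of "-1" x] by simp
    ultimately show ?thesis using le[OF \<phi>[of x]] le[OF \<phi>[of "- x"]] by linarith
  qed
  moreover have "\<phi> x0 = q x0"
    using M(2) by (intro \<phi>I) (auto simp: G0_def intro!: exI[of _ "1::real"])
  ultimately show ?thesis by blast
qed

section \<open>Fractional integrals of real functions\<close>

text \<open>A version of gfun vanishing on the nonpositive half-line, whereas gfun 1 is constantly 1; it makes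
  fractional integration a convolution over the whole line.\<close>

definition rlker :: "real \<Rightarrow> real \<Rightarrow> real" where
  "rlker a x = (if x > 0 then x powr (a - 1) / Gamma a else 0)"

text \<open>The Riemann--Liouville integral of order a. For a < 1 the kernel is singular at s =
  t.\<close>

definition conv :: "real \<Rightarrow> (real \<Rightarrow> real) \<Rightarrow> real \<Rightarrow> real" where
  "conv a h t = integral {0..t} (\<lambda>s. gfun a (t - s) * h s)"

lemma rlker_measurable [measurable]: "rlker a \<in> borel_measurable borel"
  unfolding rlker_def by measurable

lemma rlker_nonneg: "a > 0 \<Longrightarrow> 0 \<le> rlker a x"
  by (simp add: rlker_def Gamma_real_nonneg)

lemma rlker_eq_gfun: "x \<noteq> 0 \<Longrightarrow> a \<noteq> 1 \<or> x > 0 \<Longrightarrow> rlker a x = gfun a x"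
  by (auto simp: rlker_def gfun_def)

lemma gfun_nonneg: "a > 0 \<Longrightarrow> 0 \<le> gfun a x"
  by (simp add: gfun_def Gamma_real_nonneg)

lemma gfun_1 [simp]: "gfun 1 x = 1"
  by (simp add: gfun_def)

lemma gfun_0: "a > 0 \<Longrightarrow> gfun (a + 1) 0 = 0"
  by (simp add: gfun_def)

lemma gfun_nat:
  assumes "t \<ge> 0"
  shows "gfun (real i + 1) t = t ^ i / fact i"
  using assms by (auto simp: gfun_def powr_realpow Gamma_fact add.commute)

text \<open>The convolution law g_a * g_b = g_(a+b): the substitution s = r + (t - r) x produces a
  Beta integrand, and the normalising Gamma factors turn its integral into that of order a +
  b.\<close>

lemma rlker_Beta:
  assumes a: "a > 0" and b: "b > 0" and r: "r < t"
  shows "has_bochner_integral lborel (\<lambda>s. rlker a (t - s) * rlker b (s - r)) (rlker (a + b) (t - r))"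
proof -
  define L where "L = t - r"
  have L: "L > 0" using r by (simp add: L_def)
  define F where "F x = (x powr (b - 1) * (1 - x) powr (a - 1) :: real)" for x
  define F1 where "F1 x = (if 0 < x \<and> x < 1 then F x else 0)" for x :: real
  have [measurable]: "F \<in> borel_measurable borel" unfolding F_def by measurable
  have [measurable]: "F1 \<in> borel_measurable borel" unfolding F1_def by measurable
  have "(F has_integral Beta b a) {0..1}"
    unfolding F_def using has_integral_Beta_real[OF b a] .
  then have "(F has_integral Beta b a) {0<..<1}" by (simp add: has_integral_Icc_iff_Ioo)
  then have "((\<lambda>x. if x \<in> {0<..<1} then F x else 0) has_integral Beta b a) UNIV"
    by (simp only: has_integral_restrict_UNIV)
  also have "(\<lambda>x. if x \<in> {0<..<1} then F x else 0) = F1" by (auto simp: F1_def)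
  finally have nn: "(\<integral>\<^sup>+x. ennreal (F1 x) \<partial>lborel) = ennreal (Beta b a)"
    by (intro nn_integral_has_integral_lborel) (auto simp: F_def F1_def)
  have Bpos: "0 \<le> Beta b a" using a b by (simp add: Beta_def Gamma_real_nonneg)
  have hb: "has_bochner_integral lborel F1 (Beta b a)"
    using nn Bpos by (intro has_bochner_integral_nn_integral) (auto simp: F1_def F_def)
  \<comment> \<open>The exponent collects (a - 1) + (b - 1) from the two kernels; one more factor L
    comes from the change of variables.\<close>
  define K where "K = L powr (a + b - 2) / (Gamma a * Gamma b)"
  have eq: "rlker a (t - (r + L * x)) * rlker b ((r + L * x) - r) = K * F1 x" for x
  proof (cases "0 < x \<and> x < 1")
    case True
    have e1: "t - (r + L * x) = L * (1 - x)" by (simp add: L_def algebra_simps)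
    have "L * (1 - x) > 0" "L * x > 0" using True L by auto
    then have "rlker a (t - (r + L * x)) * rlker b ((r + L * x) - r)
       = (L powr (a-1) * (1-x) powr (a-1) / Gamma a) * (L powr (b-1) * x powr (b-1) / Gamma b)"
      using True L unfolding e1 by (simp add: rlker_def powr_mult)
    also have "\<dots> = (L powr (a-1) * L powr (b-1)) / (Gamma a * Gamma b) * (x powr (b-1) * (1-x) powr (a-1))"
      by simp
    also have "L powr (a-1) * L powr (b-1) = L powr (a + b - 2)"
      by (simp flip: powr_add)
    finally show ?thesis using True by (simp add: K_def F1_def F_def)
  next
    case False
    have "\<not> (t - (r + L * x) > 0 \<and> L * x > 0)"
    proof
      assume *: "t - (r + L * x) > 0 \<and> L * x > 0"
      then have "x > 0" using L by (simp add: zero_less_mult_iff)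
      moreover have "L * (1 - x) > 0" using * by (simp add: L_def algebra_simps)
      then have "x < 1" using L by (simp add: zero_less_mult_iff)
      ultimately show False using False by simp
    qed
    then show ?thesis using False by (auto simp: rlker_def F1_def)
  qed
  have "has_bochner_integral lborel (\<lambda>x. K * F1 x) (K * Beta b a)"
    using hb by (intro has_bochner_integral_mult_right)
  also have "K * Beta b a = (L * (K * Beta b a)) /\<^sub>R \<bar>L\<bar>" using L by simp
  finally have "has_bochner_integral lborel (\<lambda>x. rlker a (t - (r + L * x)) * rlker b ((r + L * x) - r))
     ((L * (K * Beta b a)) /\<^sub>R \<bar>L\<bar>)"
    by (simp only: eq)
  then have "has_bochner_integral lborel (\<lambda>s. rlker a (t - s) * rlker b (s - r)) (L * (K * Beta b a))"
    using L by (subst lborel_has_bochner_integral_real_affine_iff[where c = L and t = r]) auto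
  also have "L * (K * Beta b a) = rlker (a + b) (t - r)"
  proof -
    have "L * L powr (a + b - 2) = L powr (a + b - 1)"
      using L powr_add[of L 1 "a + b - 2"] by (simp add: algebra_simps)
    moreover have "Gamma a > 0" "Gamma b > 0" using a b by (auto intro: Gamma_real_pos)
    ultimately show ?thesis
      using L by (simp add: K_def Beta_def rlker_def L_def[symmetric] add.commute)
  qed
  finally show ?thesis .
qed

lemma rlker_integral:
  assumes "a > 0" "t > 0"
  shows "has_bochner_integral lborel (\<lambda>s. rlker a (t - s) * rlker 1 s) (rlker (a + 1) t)"
  using rlker_Beta[of a 1 0 t] assms by simp

text \<open>Passes from the gauge integral over {0..t} to a Lebesgue integral over the line, where
  Fubini's theorem applies. Integrability holds by domination: h is bounded on {0..t} and the kernel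
  is integrable there.\<close>

lemma conv_lborel:
  assumes a: "a > 0" and t: "t \<ge> 0" and h: "continuous_on {0..t} h"
  shows conv_integrable_lborel: "integrable lborel (\<lambda>s. rlker a (t - s) * (if s \<in> {0..t} then h s else 0))"
    and conv_eq_lborel: "conv a h t = (LINT s|lborel. rlker a (t - s) * (if s \<in> {0..t} then h s else 0))"
    and conv_has_integral: "((\<lambda>s. gfun a (t - s) * h s) has_integral conv a h t) {0..t}"
proof -
  define f where "f s = rlker a (t - s) * (if s \<in> {0..t} then h s else 0)" for s
  have Hm [measurable]: "(\<lambda>s. if s \<in> {0..t} then h s else 0) \<in> borel_measurable borel"
    using borel_measurable_continuous_on_indicator[OF _ h]
    by (rule measurable_cong[THEN iffD1, rotated]) (auto simp: indicator_def)
  obtain M where M: "\<And>s. s \<in> {0..t} \<Longrightarrow> \<bar>h s\<bar> \<le> M"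
    using compact_imp_bounded[OF compact_continuous_image[OF h]] by (fastforce simp: bounded_iff)
  have M0: "M \<ge> 0" using M[of 0] t by force
  have int: "integrable lborel f"
  proof (cases "t = 0")
    case True
    then have "f = (\<lambda>s. 0)" by (auto simp: f_def rlker_def)
    then show ?thesis by simp
  next
    case False
    show ?thesis
    proof (rule Bochner_Integration.integrable_bound)
      show "integrable lborel (\<lambda>s. M * (rlker a (t - s) * rlker 1 s))"
        using rlker_integral[OF a, of t] False t by (intro integrable_mult_right) (auto simp: has_bochner_integral_iff)
      show "f \<in> borel_measurable lborel" unfolding f_def by measurable
      \<comment> \<open>The point s = 0 is left out because \<open>rlker 1\<close> vanishes
        there.\<close>
      have "norm (f s) \<le> norm (M * (rlker a (t - s) * rlker 1 s))" if "s \<noteq> 0" for s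
        using M[of s] that M0 rlker_nonneg[OF a, of "t - s"]
        by (cases "0 < s \<and> s < t") (auto simp: f_def abs_mult rlker_def intro!: mult_right_mono divide_right_mono)
      then show "AE s in lborel. norm (f s) \<le> norm (M * (rlker a (t - s) * rlker 1 s))"
        using AE_lborel_singleton[of 0] by (auto elim!: eventually_mono)
    qed
  qed
  then have "(f has_integral (LINT s|lborel. f s)) UNIV"
    by (rule has_integral_integral_lborel)
  \<comment> \<open>On {0..t} the two kernels can differ only at s = t, where \<open>gfun 1\<close>
    has the value 1 and \<open>rlker 1\<close> the value 0.\<close>
  then have "((\<lambda>s. if s \<in> {0..t} then gfun a (t - s) * h s else 0) has_integral (LINT s|lborel. f s)) UNIV"
    by (rule has_integral_spike_finite[rotated 2, where S = "{t}"])
       (auto simp: f_def rlker_eq_gfun)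
  then have hi: "((\<lambda>s. gfun a (t - s) * h s) has_integral (LINT s|lborel. f s)) {0..t}"
    by (simp only: has_integral_restrict_UNIV)
  then have eq: "conv a h t = (LINT s|lborel. f s)" unfolding conv_def by (rule integral_unique)
  show "integrable lborel (\<lambda>s. rlker a (t - s) * (if s \<in> {0..t} then h s else 0))"
    using int unfolding f_def .
  show "conv a h t = (LINT s|lborel. rlker a (t - s) * (if s \<in> {0..t} then h s else 0))"
    using eq unfolding f_def .
  show "((\<lambda>s. gfun a (t - s) * h s) has_integral conv a h t) {0..t}"
    using hi eq by simp
qed

lemma conv_cong:
  assumes "\<And>s. 0 \<le> s \<Longrightarrow> s \<le> t \<Longrightarrow> h s = k s"
  shows "conv a h t = conv a k t"
  unfolding conv_def using assms by (intro integral_cong) auto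

lemma conv_const:
  assumes "a > 0" "t \<ge> 0"
  shows "conv a (\<lambda>_. 1) t = gfun (a + 1) t"
proof (cases "t = 0")
  case True then show ?thesis using gfun_0[OF assms(1)] by (simp add: conv_def)
next
  case False
  have "conv a (\<lambda>_. 1) t = (LINT s|lborel. rlker a (t - s) * (if s \<in> {0..t} then 1 else 0))"
    using assms by (intro conv_eq_lborel) auto
  also have "\<dots> = (LINT s|lborel. rlker a (t - s) * rlker 1 s)"
  proof (rule integral_cong_AE)
    show "AE s in lborel. rlker a (t - s) * (if s \<in> {0..t} then 1 else 0) = rlker a (t - s) * rlker 1 s"
      using AE_lborel_singleton[of 0] by eventually_elim (auto simp: rlker_def)
  qed auto
  also have "\<dots> = rlker (a + 1) t"
    using rlker_integral[OF assms(1), of t] False assms by (simp add: has_bochner_integral_iff)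
  finally show ?thesis using False assms by (simp add: rlker_eq_gfun)
qed

lemma conv_one: "conv 1 h t = integral {0..t} h"
  by (simp add: conv_def)

lemma conv_diff:
  assumes "a > 0" "t \<ge> 0" "continuous_on {0..t} h" "continuous_on {0..t} k"
  shows "conv a (\<lambda>s. h s - k s) t = conv a h t - conv a k t"
proof -
  have "((\<lambda>s. gfun a (t - s) * h s - gfun a (t - s) * k s) has_integral (conv a h t - conv a k t)) {0..t}"
    using assms by (intro has_integral_diff conv_has_integral)
  then show ?thesis unfolding conv_def[of a "\<lambda>s. h s - k s"] by (simp add: integral_unique algebra_simps)
qed

lemma conv_cmult: "conv a (\<lambda>s. c * h s) t = c * conv a h t"
  unfolding conv_def by (simp add: mult.left_commute)

lemma conv_bound:
  assumes a: "a > 0" and t: "t \<ge> 0" and h: "continuous_on {0..t} h"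
    and M: "\<And>s. s \<in> {0..t} \<Longrightarrow> \<bar>h s\<bar> \<le> M"
  shows "\<bar>conv a h t\<bar> \<le> M * gfun (a + 1) t"
proof -
  have 1: "((\<lambda>s. M * (gfun a (t - s) * 1)) has_integral (M * conv a (\<lambda>_. 1) t)) {0..t}"
    using a t by (intro has_integral_mult_right conv_has_integral) auto
  have 2: "((\<lambda>s. gfun a (t - s) * h s) has_integral conv a h t) {0..t}"
    by (rule conv_has_integral[OF a t h])
  have "norm (integral {0..t} (\<lambda>s. gfun a (t - s) * h s)) \<le> integral {0..t} (\<lambda>s. M * (gfun a (t - s) * 1))"
  proof (rule integral_norm_bound_integral)
    show "(\<lambda>s. gfun a (t - s) * h s) integrable_on {0..t}" "(\<lambda>s. M * (gfun a (t - s) * 1)) integrable_on {0..t}"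
      using 1 2 by blast+
    fix s assume "s \<in> {0..t}"
    then show "norm (gfun a (t - s) * h s) \<le> M * (gfun a (t - s) * 1)"
      using M[of s] gfun_nonneg[OF a, of "t - s"] by (simp add: abs_mult mult.commute mult_right_mono)
  qed
  then show ?thesis
    using integral_unique[OF 1] conv_const[OF a t] by (simp add: conv_def)
qed

text \<open>The substitution s = t - r moves t from the possibly singular kernel into the continuous
  factor, the form in which the dependence on t can be estimated.\<close>

lemma conv_reflect:
  assumes a: "a > 0" and t: "t \<ge> 0" and h: "continuous_on {0..t} h"
  shows "((\<lambda>r. gfun a r * h (t - r)) has_integral conv a h t) {0..t}"
proof -
  have "((\<lambda>s. gfun a (t - (-1 * s + t)) * h (-1 * s + t)) has_integral (conv a h t / \<bar>-1\<bar> ^ DIM(real)))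
      ((\<lambda>x. (1 / (-1)) *\<^sub>R x + - ((1 / (-1)) *\<^sub>R t)) ` cbox 0 t)"
    using has_integral_affinity[of "\<lambda>s. gfun a (t - s) * h s" "conv a h t" 0 t "-1" t] conv_has_integral[OF a t h]
    by simp
  moreover have "((\<lambda>x. (1 / (-1)) *\<^sub>R x + - ((1 / (-1)) *\<^sub>R t)) ` cbox 0 t) = {0..t}"
    using image_diff_atLeastAtMost[of t 0 t] by simp
  ultimately show ?thesis by simp
qed

text \<open>In reflected form the difference consists of the kernel against an increment of h over
  {0..t'} and of a part over {t'..t}, which is at most M times the kernel mass there.\<close>

lemma conv_modulus:
  assumes a: "a > 0" and t: "0 \<le> t'" "t' \<le> t" and h: "continuous_on {0..t} h"
    and M: "\<And>s. s \<in> {0..t} \<Longrightarrow> \<bar>h s\<bar> \<le> M"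
    and e: "\<And>s. 0 \<le> s \<Longrightarrow> s \<le> t' \<Longrightarrow> \<bar>h (s + (t - t')) - h s\<bar> \<le> e"
  shows "\<bar>conv a h t - conv a h t'\<bar> \<le> e * gfun (a + 1) t' + M * (gfun (a + 1) t - gfun (a + 1) t')"
proof -
  have h': "continuous_on {0..t'} h" using h t by (rule_tac continuous_on_subset) auto
  define G where "G r = gfun a r * h (t - r)" for r
  have G: "(G has_integral conv a h t) {0..t}"
    unfolding G_def using conv_reflect[OF a _ h] t by simp
  have g: "(gfun a has_integral gfun (a + 1) s) {0..s}" if "s \<ge> 0" for s
    using conv_reflect[OF a that, of "\<lambda>_. 1"] conv_const[OF a that] by simp
  have Gi: "G integrable_on {0..t'}" "G integrable_on {t'..t}"
    using G t by (auto intro: integrable_subinterval_real[OF has_integral_integrable[OF G]])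
  have gi: "gfun a integrable_on {0..t'}" "gfun a integrable_on {t'..t}"
    using t by (auto intro: integrable_subinterval_real[OF has_integral_integrable[OF g[of t]]])
  have split: "conv a h t = integral {0..t'} G + integral {t'..t} G"
    using Henstock_Kurzweil_Integration.integral_combine[OF t has_integral_integrable[OF G]] integral_unique[OF G] by simp
  have gsplit: "gfun (a + 1) t = gfun (a + 1) t' + integral {t'..t} (gfun a)"
    using Henstock_Kurzweil_Integration.integral_combine[OF t has_integral_integrable[OF g[of t]]]
      integral_unique[OF g] t by simp
  have h2: "((\<lambda>r. gfun a r * h (t' - r)) has_integral conv a h t') {0..t'}"
    by (rule conv_reflect[OF a t(1) h'])
  have "integral {0..t'} G - conv a h t' = integral {0..t'} (\<lambda>r. G r - gfun a r * h (t' - r))"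
    using Henstock_Kurzweil_Integration.integral_diff[OF Gi(1) has_integral_integrable[OF h2]] integral_unique[OF h2] by simp
  also have "norm \<dots> \<le> integral {0..t'} (\<lambda>r. e * gfun a r)"
  proof (rule integral_norm_bound_integral)
    show "(\<lambda>r. G r - gfun a r * h (t' - r)) integrable_on {0..t'}"
      by (intro integrable_diff Gi has_integral_integrable[OF h2])
    show "(\<lambda>r. e * gfun a r) integrable_on {0..t'}"
      using gi by (intro integrable_on_mult_right)
    fix r assume r: "r \<in> {0..t'}"
    have "G r - gfun a r * h (t' - r) = gfun a r * (h (t' - r + (t - t')) - h (t' - r))"
      by (simp add: G_def algebra_simps)
    also have "norm \<dots> \<le> gfun a r * e"
      using e[of "t' - r"] r gfun_nonneg[OF a, of r] by (simp add: abs_mult mult_left_mono)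
    finally show "norm (G r - gfun a r * h (t' - r)) \<le> e * gfun a r" by (simp add: mult.commute)
  qed
  also have "\<dots> = e * gfun (a + 1) t'" using integral_unique[OF g[OF t(1)]] by simp
  finally have 1: "\<bar>integral {0..t'} G - conv a h t'\<bar> \<le> e * gfun (a + 1) t'" by simp
  have "norm (integral {t'..t} G) \<le> integral {t'..t} (\<lambda>r. M * gfun a r)"
  proof (rule integral_norm_bound_integral)
    show "G integrable_on {t'..t}" by (rule Gi)
    show "(\<lambda>r. M * gfun a r) integrable_on {t'..t}"
      using gi by (intro integrable_on_mult_right)
    fix r assume r: "r \<in> {t'..t}"
    then show "norm (G r) \<le> M * gfun a r"
      using mult_right_mono[OF M[of "t - r"] gfun_nonneg[OF a, of r]] t gfun_nonneg[OF a, of r]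
      by (simp add: G_def abs_mult mult.commute)
  qed
  then have 2: "\<bar>integral {t'..t} G\<bar> \<le> M * (gfun (a + 1) t - gfun (a + 1) t')" using gsplit by simp
  show ?thesis using split 1 2 by linarith
qed

lemma continuous_on_gfun:
  assumes "a > 0"
  shows "continuous_on {0..} (gfun (a + 1))"
proof -
  have "gfun (a + 1) t = t powr a / Gamma (a + 1)" if "t \<ge> 0" for t
    using that assms by (auto simp: gfun_def)
  moreover have "continuous_on {0..} (\<lambda>t. t powr a / Gamma (a + 1))"
    using assms less_imp_neq[OF Gamma_real_pos[of "a + 1"]]
    by (intro continuous_on_divide continuous_on_powr' continuous_intros ballI) auto
  ultimately show ?thesis by (subst continuous_on_cong[OF refl]) auto
qed

text \<open>The order of the quantifiers is the point: d and e' depend on a, e, T and M but not on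
  h, so that one choice serves all functions phi o f with phi dominated by a fixed seminorm.\<close>

lemma conv_equicontinuous:
  assumes a: "a > 0" and e: "e > 0"
  shows "\<exists>d>0. \<exists>e'>0. \<forall>h d0. continuous_on {0..T} h \<longrightarrow> (\<forall>s\<in>{0..T}. \<bar>h s\<bar> \<le> M)
    \<longrightarrow> d0 \<le> d \<longrightarrow> (\<forall>s\<in>{0..T}. \<forall>t\<in>{0..T}. \<bar>s - t\<bar> \<le> d0 \<longrightarrow> \<bar>h s - h t\<bar> \<le> e')
    \<longrightarrow> (\<forall>s\<in>{0..T}. \<forall>t\<in>{0..T}. \<bar>s - t\<bar> \<le> d0 \<longrightarrow> \<bar>conv a h s - conv a h t\<bar> \<le> e)"
proof -
  have cg: "continuous_on {0..T} (gfun (a + 1))"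
    by (rule continuous_on_subset[OF continuous_on_gfun[OF a]]) auto
  then have "uniformly_continuous_on {0..T} (gfun (a + 1))"
    by (intro compact_uniformly_continuous) auto
  moreover have "e / (2 * (\<bar>M\<bar> + 1)) > 0" using e by (intro divide_pos_pos) auto
  ultimately obtain d where d: "d > 0" and
    ud: "\<And>s t. s \<in> {0..T} \<Longrightarrow> t \<in> {0..T} \<Longrightarrow> \<bar>s - t\<bar> < d \<Longrightarrow> \<bar>gfun (a+1) s - gfun (a+1) t\<bar> < e / (2 * (\<bar>M\<bar> + 1))"
    unfolding uniformly_continuous_on_def dist_real_def by metis
  obtain G where G: "\<And>s. s \<in> {0..T} \<Longrightarrow> \<bar>gfun (a+1) s\<bar> \<le> G"
    using compact_imp_bounded[OF compact_continuous_image[OF cg]]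
    by (fastforce simp: bounded_iff)
  \<comment> \<open>Half of e is reserved for the oscillation of h, weighted by the kernel mass,
    which G bounds on {0..T}; the other half is for the increment of that mass.\<close>
  define e' where "e' = e / (2 * (\<bar>G\<bar> + 1))"
  have e': "e' > 0" using e by (simp add: e'_def)
  have e'G: "e' * gfun (a+1) s \<le> e / 2" if "s \<in> {0..T}" for s
  proof -
    have "e' * gfun (a+1) s \<le> e' * (\<bar>G\<bar> + 1)" using G[OF that] e' by (intro mult_left_mono) auto
    also have "\<dots> = e / 2" by (simp add: e'_def divide_simps)
    finally show ?thesis .
  qed
  have main: "\<bar>conv a h t - conv a h s\<bar> \<le> e" if h: "continuous_on {0..T} h" and M: "\<forall>s\<in>{0..T}. \<bar>h s\<bar> \<le> M"
    and eq: "\<forall>s\<in>{0..T}. \<forall>t\<in>{0..T}. \<bar>s - t\<bar> \<le> d0 \<longrightarrow> \<bar>h s - h t\<bar> \<le> e'" and d0: "d0 \<le> d / 2"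
    and st: "0 \<le> s" "s \<le> t" "t \<le> T" "t - s \<le> d0" for h s t d0
  proof -
    have "\<bar>conv a h t - conv a h s\<bar> \<le> e' * gfun (a + 1) s + M * (gfun (a + 1) t - gfun (a + 1) s)"
      using st M eq by (intro conv_modulus a continuous_on_subset[OF h]) auto
    also have "M * (gfun (a + 1) t - gfun (a + 1) s) \<le> (\<bar>M\<bar> + 1) * (e / (2 * (\<bar>M\<bar> + 1)))"
    proof -
      have "M * (gfun (a + 1) t - gfun (a + 1) s) \<le> \<bar>M\<bar> * \<bar>gfun (a + 1) t - gfun (a + 1) s\<bar>"
        by (metis abs_ge_self abs_mult)
      also have "\<dots> \<le> (\<bar>M\<bar> + 1) * (e / (2 * (\<bar>M\<bar> + 1)))"
        using ud[of t s] st d d0 by (intro mult_mono) auto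
      finally show ?thesis .
    qed
    also have "\<dots> = e / 2"
    proof -
      have *: "K * (e / (2 * K)) = e / 2" if "K > 0" for K :: real using that by simp
      show ?thesis by (rule *) simp
    qed
    finally show ?thesis using e'G[of s] st by simp
  qed
  show ?thesis
  proof (rule exI[of _ "d/2"], rule conjI[rotated], rule exI[of _ e'], intro conjI allI impI ballI)
    fix h d0 s t
    assume "continuous_on {0..T} h" "\<forall>s\<in>{0..T}. \<bar>h s\<bar> \<le> M" "d0 \<le> d / 2"
      "\<forall>s\<in>{0..T}. \<forall>t\<in>{0..T}. \<bar>s - t\<bar> \<le> d0 \<longrightarrow> \<bar>h s - h t\<bar> \<le> e'"
      "s \<in> {0..T}" "t \<in> {0..T}" "\<bar>s - t\<bar> \<le> d0"
    then show "\<bar>conv a h s - conv a h t\<bar> \<le> e"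
      using main[of h d0 s t] main[of h d0 t s] by (cases "s \<le> t") auto
  qed (use d e' in auto)
qed

lemma continuous_on_conv:
  assumes a: "a > 0" and h: "continuous_on {0..T} h"
  shows "continuous_on {0..T} (conv a h)"
proof -
  obtain M where M: "\<And>s. s \<in> {0..T} \<Longrightarrow> \<bar>h s\<bar> \<le> M"
    using compact_imp_bounded[OF compact_continuous_image[OF h]] by (fastforce simp: bounded_iff)
  have uh: "uniformly_continuous_on {0..T} h"
    using h by (intro compact_uniformly_continuous) auto
  show ?thesis
  proof (rule uniformly_continuous_imp_continuous, unfold uniformly_continuous_on_def, intro allI impI)
    fix e :: real assume e: "e > 0"
    then have "e / 2 > 0" by simp
    from conv_equicontinuous[OF a this, of T M] obtain d e' where d: "d > 0" and e': "e' > 0"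
      and *: "\<forall>h d0. continuous_on {0..T} h \<longrightarrow> (\<forall>s\<in>{0..T}. \<bar>h s\<bar> \<le> M)
    \<longrightarrow> d0 \<le> d \<longrightarrow> (\<forall>s\<in>{0..T}. \<forall>t\<in>{0..T}. \<bar>s - t\<bar> \<le> d0 \<longrightarrow> \<bar>h s - h t\<bar> \<le> e')
    \<longrightarrow> (\<forall>s\<in>{0..T}. \<forall>t\<in>{0..T}. \<bar>s - t\<bar> \<le> d0 \<longrightarrow> \<bar>conv a h s - conv a h t\<bar> \<le> e/2)"
      by (elim exE conjE) (rule that)
    obtain d1 where d1: "d1 > 0" "\<And>s t. s \<in> {0..T} \<Longrightarrow> t \<in> {0..T} \<Longrightarrow> \<bar>s - t\<bar> < d1 \<Longrightarrow> \<bar>h s - h t\<bar> < e'"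
      using uh e' unfolding uniformly_continuous_on_def dist_real_def by metis
    have **: "\<bar>conv a h s - conv a h t\<bar> \<le> e/2"
      if "s \<in> {0..T}" "t \<in> {0..T}" "\<bar>s - t\<bar> \<le> min d (d1/2)" for s t
    proof (rule *[rule_format, of h "min d (d1/2)"])
      show "\<bar>h s - h t\<bar> \<le> e'" if "s \<in> {0..T}" "t \<in> {0..T}" "\<bar>s - t\<bar> \<le> min d (d1/2)" for s t
        using d1(2)[OF that(1,2)] that(3) d1(1) by simp
    qed (use h M that in auto)
    show "\<exists>d>0. \<forall>x\<in>{0..T}. \<forall>x'\<in>{0..T}. dist x' x < d \<longrightarrow> dist (conv a h x') (conv a h x) < e"
    proof (intro exI[of _ "min d (d1/2)"] conjI ballI impI)
      fix x x' assume "x \<in> {0..T}" "x' \<in> {0..T}" "dist x' x < min d (d1 / 2)"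
      then show "dist (conv a h x') (conv a h x) < e"
        using **[of x' x] e by (simp add: dist_real_def)
    qed (use d d1 in auto)
  qed
qed

text \<open>Fubini's theorem on the plane: the inner integral over s is the Beta relation. As the
  kernels are nonnegative, the same relation with |H| in place of H yields absolute
  integrability.\<close>

theorem conv_conv:
  assumes a: "a > 0" and b: "b > 0" and t: "t \<ge> 0" and h: "continuous_on {0..t} h"
  shows "conv a (conv b h) t = conv (a + b) h t"
proof -
  define H where "H s = (if s \<in> {0..t} then h s else 0)" for s
  have Hm [measurable]: "H \<in> borel_measurable borel"
    using borel_measurable_continuous_on_indicator[OF _ h]
    by (rule measurable_cong[THEN iffD1, rotated]) (auto simp: indicator_def H_def)
  \<comment> \<open>The kernels vanish unless r < s < t, so the triangle of integration is encoded
    in the integrand.\<close>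
  define f where "f r s = rlker a (t - s) * rlker b (s - r) * H r" for r s
  have fm [measurable]: "case_prod f \<in> borel_measurable (lborel \<Otimes>\<^sub>M lborel)"
    unfolding f_def by measurable
  have hb: "has_bochner_integral lborel (\<lambda>s. rlker a (t - s) * rlker b (s - r)) (rlker (a + b) (t - r))"
    if "r \<noteq> t" for r
  proof (cases "r < t")
    case True then show ?thesis by (rule rlker_Beta[OF a b])
  next
    case False
    then have "(\<lambda>s. rlker a (t - s) * rlker b (s - r)) = (\<lambda>s. 0)" by (auto simp: rlker_def)
    moreover have "rlker (a + b) (t - r) = 0" using False by (simp add: rlker_def)
    ultimately show ?thesis using has_bochner_integral_zero by metis
  qed
  have hb0: "integrable lborel (f r)" "(LINT s|lborel. f r s) = rlker (a + b) (t - r) * H r"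
    "(LINT s|lborel. norm (f r s)) = norm (rlker (a + b) (t - r) * H r)" if "r \<noteq> t" for r
  proof -
    have 1: "has_bochner_integral lborel (f r) (rlker (a + b) (t - r) * H r)"
      unfolding f_def using hb[OF that] by (intro has_bochner_integral_mult_left)
    show "integrable lborel (f r)" "(LINT s|lborel. f r s) = rlker (a + b) (t - r) * H r"
      using 1 by (auto simp: has_bochner_integral_iff)
    have "has_bochner_integral lborel (\<lambda>s. rlker a (t - s) * rlker b (s - r) * \<bar>H r\<bar>) (rlker (a + b) (t - r) * \<bar>H r\<bar>)"
      using hb[OF that] by (intro has_bochner_integral_mult_left)
    moreover have "(\<lambda>s. norm (f r s)) = (\<lambda>s. rlker a (t - s) * rlker b (s - r) * \<bar>H r\<bar>)"
      using a b by (auto simp: f_def abs_mult rlker_nonneg)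
    moreover have "norm (rlker (a + b) (t - r) * H r) = rlker (a + b) (t - r) * \<bar>H r\<bar>"
      using a b by (auto simp: abs_mult rlker_nonneg)
    ultimately show "(LINT s|lborel. norm (f r s)) = norm (rlker (a + b) (t - r) * H r)"
      by (simp add: has_bochner_integral_iff)
  qed
  have ae: "AE r in lborel. r \<noteq> t" by (rule AE_lborel_singleton)
  have c: "conv (a + b) h t = (LINT r|lborel. rlker (a + b) (t - r) * H r)"
    "integrable lborel (\<lambda>r. rlker (a + b) (t - r) * H r)"
    using conv_eq_lborel[of "a + b" t h] conv_integrable_lborel[of "a + b" t h] a b t h by (auto simp: H_def)
  have int: "integrable (lborel \<Otimes>\<^sub>M lborel) (case_prod f)"
  proof (rule lborel_pair.Fubini_integrable)
    show "case_prod f \<in> borel_measurable (lborel \<Otimes>\<^sub>M lborel)" by (rule fm)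
    show "AE x in lborel. integrable lborel (\<lambda>y. case (x, y) of (x, y) \<Rightarrow> f x y)"
      using ae by eventually_elim (use hb0 in auto)
    have "integrable lborel (\<lambda>x. LINT y|lborel. norm (f x y)) \<longleftrightarrow>
        integrable lborel (\<lambda>r. norm (rlker (a + b) (t - r) * H r))"
    proof (rule integrable_cong_AE)
      show "AE x in lborel. (LINT y|lborel. norm (f x y)) = norm (rlker (a + b) (t - x) * H x)"
        using ae by eventually_elim (use hb0 in auto)
    qed measurable
    then show "integrable lborel (\<lambda>x. LINT y|lborel. norm (case (x, y) of (x, y) \<Rightarrow> f x y))"
      using integrable_norm[OF c(2)] by simp
  qed
  have inner: "rlker a (t - s) * (if s \<in> {0..t} then conv b h s else 0) = (LINT r|lborel. f r s)" for s
  proof (cases "s \<in> {0..t}")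
    case True
    have "conv b h s = (LINT r|lborel. rlker b (s - r) * (if r \<in> {0..s} then h r else 0))"
      using True b by (intro conv_eq_lborel continuous_on_subset[OF h]) auto
    also have "\<dots> = (LINT r|lborel. rlker b (s - r) * H r)"
      by (intro Bochner_Integration.integral_cong) (use True in \<open>auto simp: H_def rlker_def\<close>)
    finally show ?thesis using True by (simp add: f_def mult.assoc)
  next
    case False
    then have "f r s = 0" for r by (auto simp: f_def H_def rlker_def)
    then have "(LINT r|lborel. f r s) = 0" by simp
    then show ?thesis by (simp only: if_not_P[OF False] mult_zero_right)
  qed
  have "conv a (conv b h) t = (LINT s|lborel. rlker a (t - s) * (if s \<in> {0..t} then conv b h s else 0))"
    by (intro conv_eq_lborel a t continuous_on_conv b h)
  also have "\<dots> = (LINT s|lborel. LINT r|lborel. f r s)" by (simp only: inner)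
  also have "\<dots> = (LINT r|lborel. LINT s|lborel. f r s)"
    by (rule lborel_pair.Fubini_integral[OF int])
  also have "\<dots> = (LINT r|lborel. rlker (a + b) (t - r) * H r)"
  proof (rule integral_cong_AE)
    show "AE x in lborel. (LINT s|lborel. f x s) = rlker (a + b) (t - x) * H x"
      using ae by eventually_elim (use hb0 in auto)
  qed measurable
  finally show ?thesis using c by simp
qed

text \<open>Both primitives are differentiated at t within {0..t + 1}, which covers t = 0 by a
  one-sided derivative.\<close>

lemma conv_1_inject:
  assumes h: "continuous_on {0..} h" and k: "continuous_on {0..} k"
    and eq: "\<And>t. t \<ge> 0 \<Longrightarrow> conv 1 h t = conv 1 k t" and t: "t \<ge> 0"
  shows "h t = k t"
proof -
  have d: "((\<lambda>u. integral {0..u} f) has_real_derivative f t) (at t within {0..t + 1})"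
    if "continuous_on {0..} f" for f :: "real \<Rightarrow> real"
    using t that
    by (intro integral_has_real_derivative continuous_on_subset[OF that]) auto
  have "((\<lambda>u. integral {0..u} h) has_real_derivative k t) (at t within {0..t + 1})"
    using d[OF k] eq t
    by (subst has_field_derivative_cong_eventually[where g = "\<lambda>u. integral {0..u} k"])
       (auto simp: conv_one eventually_at_filter intro!: always_eventually)
  moreover have "at t within {0..t + 1} \<noteq> bot"
    using t by (simp add: trivial_limit_within)
  ultimately show ?thesis
    using d[OF h] has_field_derivative_unique by blast
qed

section \<open>Frechet spaces\<close>

locale frechet_space =
  fixes p :: "nat \<Rightarrow> 'a::real_vector \<Rightarrow> real"
  assumes frechet: "frechet p"
begin

lemma p_triangle: "p k (x + y) \<le> p k x + p k y"
  and p_scaleR: "p k (c *\<^sub>R x) = \<bar>c\<bar> * p k x"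
  and p_Suc: "p k x \<le> p (Suc k) x"
  using frechet by (auto simp: frechet_def seminorm_on_def)

lemma p_zero [simp]: "p k 0 = 0"
  using p_scaleR[of k 0 0] by simp

lemma p_minus [simp]: "p k (- x) = p k x"
  using p_scaleR[of k "-1" x] by simp

lemma p_nonneg [simp]: "0 \<le> p k x"
  using p_triangle[of k x "- x"] by simp

lemma p_commute: "p k (x - y) = p k (y - x)"
  using p_minus[of k "x - y"] by simp

lemma p_diff: "p k (x - y) \<le> p k x + p k y"
  using p_triangle[of k x "- y"] by simp

lemma p_triangle3: "p k (x - z) \<le> p k (x - y) + p k (y - z)"
  using p_triangle[of k "x - y" "y - z"] by simp

lemma p_abs_diff: "\<bar>p k x - p k y\<bar> \<le> p k (x - y)"
  using p_triangle[of k "x - y" y] p_triangle[of k "y - x" x] p_commute[of k x y] by simp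

lemma p_mono: "i \<le> j \<Longrightarrow> p i x \<le> p j x"
  using lift_Suc_mono_le[of "\<lambda>i. p i x"] p_Suc by blast

lemma p_sum: "p k (\<Sum>i\<in>I. f i) \<le> (\<Sum>i\<in>I. p k (f i))"
proof (induction I rule: infinite_finite_induct)
  case (insert x F)
  then show ?case using p_triangle[of k "f x" "\<Sum>i\<in>F. f i"] by simp
qed auto

lemma p_eq_0: "(\<And>k. p k x = 0) \<Longrightarrow> x = 0"
  using frechet by (auto simp: frechet_def)

lemma seminorm_on_p: "seminorm_on (p k)"
  using frechet by (auto simp: frechet_def)

lemma p_small_of_fdist: "\<delta> > 0 \<Longrightarrow> \<exists>e>0. \<forall>x y. fdist p x y < e \<longrightarrow> p k (x - y) < \<delta>"
  by (rule seminorm_small_of_fdist) (rule p_nonneg)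

lemma fdist_small_of_p: "e > 0 \<Longrightarrow> \<exists>k. \<exists>\<delta>>0. \<forall>x y. p k (x - y) < \<delta> \<longrightarrow> fdist p x y < e"
  by (rule fdist_small_of_seminorm) (rule p_nonneg p_Suc)+

lemma fdist_p_nonneg: "0 \<le> fdist p x y"
  by (rule fdist_nonneg) simp

text \<open>Holds summand by summand, since r/(1+r) is increasing and subadditive for r \<ge>
  0.\<close>

lemma fdist_triangle: "fdist p x z \<le> fdist p x y + fdist p y z"
proof -
  have sm: "summable (\<lambda>n. (1/2::real) ^ Suc n * (p n (x - y) / (1 + p n (x - y))))" for x y
    by (rule summable_fdist) simp
  have frac: "p n (x - z) / (1 + p n (x - z)) \<le> p n (x - y) / (1 + p n (x - y)) + p n (y - z) / (1 + p n (y - z))" for n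
  proof -
    define a b where "a = p n (x - y)" and "b = p n (y - z)"
    have ab: "0 \<le> a" "0 \<le> b" by (auto simp: a_def b_def)
    have "p n (x - z) / (1 + p n (x - z)) \<le> (a + b) / (1 + (a + b))"
      using p_triangle3[of n x z y] by (intro divide_one_plus_mono) (auto simp: a_def b_def)
    also have "\<dots> = a / (1 + (a + b)) + b / (1 + (a + b))" by (simp add: add_divide_distrib)
    also have "\<dots> \<le> a / (1 + a) + b / (1 + b)"
      using ab by (intro add_mono divide_left_mono) auto
    finally show ?thesis by (simp add: a_def b_def)
  qed
  have "fdist p x z \<le> (\<Sum>n. (1/2) ^ Suc n * (p n (x - y) / (1 + p n (x - y))) + (1/2) ^ Suc n * (p n (y - z) / (1 + p n (y - z))))"
    unfolding fdist_def
  proof (rule suminf_le)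
    show "(1/2) ^ Suc n * (p n (x - z) / (1 + p n (x - z)))
      \<le> (1/2) ^ Suc n * (p n (x - y) / (1 + p n (x - y))) + (1/2) ^ Suc n * (p n (y - z) / (1 + p n (y - z)))" for n
      using mult_left_mono[OF frac[of n], of "(1/2) ^ Suc n"] by (simp add: distrib_left)
  qed (intro sm summable_add)+
  also have "\<dots> = fdist p x y + fdist p y z"
    unfolding fdist_def by (rule suminf_add[symmetric]) (rule sm)+
  finally show ?thesis .
qed

lemma fdist_commute: "fdist p x y = fdist p y x"
  unfolding fdist_def using p_commute[of _ x y] by simp

lemma fdist_eq_0: "fdist p x y = 0 \<longleftrightarrow> x = y"
proof
  assume 0: "fdist p x y = 0"
  have "p k (x - y) = 0" for k
  proof (rule ccontr)
    assume "p k (x - y) \<noteq> 0"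
    then have "p k (x - y) > 0" using p_nonneg[of k "x - y"] by linarith
    from p_small_of_fdist[OF this, of k] 0 show False by force
  qed
  then show "x = y" using p_eq_0[of "x - y"] by simp
qed (simp add: fdist_def)

text \<open>Attaching the metric to the carrier by a locale instance opens the way to Baire's
  theorem on a type without metric structure.\<close>

sublocale metric: Metric_space UNIV "fdist p"
  using fdist_p_nonneg fdist_commute fdist_eq_0 fdist_triangle by unfold_locales blast+

lemma ftendsto_iff: "ftendsto p f l F \<longleftrightarrow> (\<forall>k. ((\<lambda>x. p k (f x - l)) \<longlongrightarrow> 0) F)"
proof
  assume *: "ftendsto p f l F"
  show "\<forall>k. ((\<lambda>x. p k (f x - l)) \<longlongrightarrow> 0) F"
  proof (intro allI tendstoI)
    fix k and e :: real assume "e > 0"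
    from p_small_of_fdist[OF this, of k] obtain d where d: "d > 0" "\<And>x y. fdist p x y < d \<Longrightarrow> p k (x - y) < e" by blast
    have "\<forall>\<^sub>F x in F. fdist p (f x) l < d"
      using * d(1) unfolding ftendsto_def by (rule order_tendstoD(2))
    then show "\<forall>\<^sub>F x in F. dist (p k (f x - l)) 0 < e"
      by eventually_elim (use d in \<open>simp add: dist_real_def\<close>)
  qed
next
  assume *: "\<forall>k. ((\<lambda>x. p k (f x - l)) \<longlongrightarrow> 0) F"
  show "ftendsto p f l F" unfolding ftendsto_def
  proof (rule tendstoI)
    fix e :: real assume "e > 0"
    from fdist_small_of_p[OF this] obtain k d where d: "d > 0" "\<And>x y. p k (x - y) < d \<Longrightarrow> fdist p x y < e" by blast
    have "\<forall>\<^sub>F x in F. p k (f x - l) < d"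
      using * d(1) order_tendstoD(2) by blast
    then show "\<forall>\<^sub>F x in F. dist (fdist p (f x) l) 0 < e"
      by eventually_elim (use d fdist_p_nonneg in \<open>simp add: dist_real_def\<close>)
  qed
qed

lemma ftendstoD: "ftendsto p f l F \<Longrightarrow> ((\<lambda>x. p k (f x - l)) \<longlongrightarrow> 0) F"
  by (simp add: ftendsto_iff)

lemma ftendsto_sandwich:
  assumes "\<And>k. \<forall>\<^sub>F x in F. p k (f x - l) \<le> g k x" "\<And>k. (g k \<longlongrightarrow> 0) F"
  shows "ftendsto p f l F"
  unfolding ftendsto_iff
proof
  fix k
  show "((\<lambda>x. p k (f x - l)) \<longlongrightarrow> 0) F"
    by (rule tendsto_sandwich[of "\<lambda>_. 0" _ _ "g k"]) (use assms in auto)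
qed

lemma ftendsto_const [simp]: "ftendsto p (\<lambda>_. l) l F"
  by (simp add: ftendsto_iff)

lemma ftendsto_add:
  assumes "ftendsto p f l F" "ftendsto p g m F"
  shows "ftendsto p (\<lambda>x. f x + g x) (l + m) F"
proof (rule ftendsto_sandwich)
  fix k
  show "((\<lambda>x. p k (f x - l) + p k (g x - m)) \<longlongrightarrow> 0) F"
    using tendsto_add[OF ftendstoD[OF assms(1)] ftendstoD[OF assms(2)]] by simp
  show "\<forall>\<^sub>F x in F. p k (f x + g x - (l + m)) \<le> p k (f x - l) + p k (g x - m)"
    using p_triangle[of k "f _ - l" "g _ - m"] by (simp add: algebra_simps)
qed

lemma ftendsto_scaleR:
  assumes c: "(c \<longlongrightarrow> d) F" and f: "ftendsto p f l F"
  shows "ftendsto p (\<lambda>x. c x *\<^sub>R f x) (d *\<^sub>R l) F"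
proof (rule ftendsto_sandwich)
  fix k
  have "((\<lambda>x. \<bar>c x\<bar> * p k (f x - l) + \<bar>c x - d\<bar> * p k l) \<longlongrightarrow> \<bar>d\<bar> * 0 + \<bar>d - d\<bar> * p k l) F"
    by (intro tendsto_intros c ftendstoD[OF f])
  then show "((\<lambda>x. \<bar>c x\<bar> * p k (f x - l) + \<bar>c x - d\<bar> * p k l) \<longlongrightarrow> 0) F" by simp
  have "p k (c x *\<^sub>R f x - d *\<^sub>R l) \<le> \<bar>c x\<bar> * p k (f x - l) + \<bar>c x - d\<bar> * p k l" for x
  proof -
    have "c x *\<^sub>R f x - d *\<^sub>R l = c x *\<^sub>R (f x - l) + (c x - d) *\<^sub>R l" by (simp add: algebra_simps)
    then show ?thesis using p_triangle[of k "c x *\<^sub>R (f x - l)" "(c x - d) *\<^sub>R l"] by (simp only: p_scaleR)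
  qed
  then show "\<forall>\<^sub>F x in F. p k (c x *\<^sub>R f x - d *\<^sub>R l) \<le> \<bar>c x\<bar> * p k (f x - l) + \<bar>c x - d\<bar> * p k l" by simp
qed

lemma ftendsto_scaleR_const: "ftendsto p f l F \<Longrightarrow> ftendsto p (\<lambda>x. c *\<^sub>R f x) (c *\<^sub>R l) F"
  by (rule ftendsto_scaleR) auto

lemma ftendsto_diff:
  assumes "ftendsto p f l F" "ftendsto p g m F"
  shows "ftendsto p (\<lambda>x. f x - g x) (l - m) F"
  using ftendsto_add[OF assms(1) ftendsto_scaleR_const[OF assms(2), of "-1"]] by simp

lemma ftendsto_unique:
  assumes "ftendsto p f l F" "ftendsto p f m F" "F \<noteq> bot"
  shows "l = m"
proof -
  have "ftendsto p (\<lambda>x. 0) (l - m) F" using ftendsto_diff[OF assms(1,2)] by simp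
  then have "((\<lambda>x. p k (0 - (l - m))) \<longlongrightarrow> 0) F" for k by (rule ftendstoD)
  then have "p k (0 - (l - m)) = 0" for k
    using tendsto_unique[OF assms(3) tendsto_const] by blast
  then have "0 - (l - m) = 0" by (rule p_eq_0)
  then show ?thesis by simp
qed

lemma ftendsto_compose: "ftendsto p f l G \<Longrightarrow> filterlim g G F \<Longrightarrow> ftendsto p (\<lambda>x. f (g x)) l F"
  unfolding ftendsto_def by (rule filterlim_compose)

lemma ftendsto_cong_eventually:
  "ftendsto p f l F \<Longrightarrow> \<forall>\<^sub>F x in F. f x = g x \<Longrightarrow> ftendsto p g l F"
  unfolding ftendsto_def by (erule Lim_transform_eventually) (auto elim: eventually_mono)

lemma Cauchy_convergent:
  fixes f :: "nat \<Rightarrow> 'a"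
  assumes "\<And>k e. e > 0 \<Longrightarrow> \<exists>M. \<forall>m\<ge>M. \<forall>n\<ge>M. p k (f m - f n) < e"
  shows "\<exists>l. ftendsto p f l sequentially"
proof -
  have "\<exists>M. \<forall>m\<ge>M. \<forall>n\<ge>M. fdist p (f m) (f n) < e" if "e > 0" for e
  proof -
    from fdist_small_of_p[OF that] obtain k d where d: "d > 0" "\<And>x y. p k (x - y) < d \<Longrightarrow> fdist p x y < e" by blast
    from assms[OF d(1), of k] show ?thesis using d(2) by meson
  qed
  then show ?thesis using frechet unfolding frechet_def by blast
qed

lemma mcomplete: "metric.mcomplete"
  unfolding metric.mcomplete_def
proof (intro allI impI)
  fix \<sigma> :: "nat \<Rightarrow> 'a" assume "metric.MCauchy \<sigma>"
  then have C: "\<And>e. e > 0 \<Longrightarrow> \<exists>M. \<forall>m n. M \<le> m \<longrightarrow> M \<le> n \<longrightarrow> fdist p (\<sigma> m) (\<sigma> n) < e"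
    unfolding metric.MCauchy_def by (elim conjE) (drule spec, erule mp)
  obtain l where l: "ftendsto p \<sigma> l sequentially"
  proof -
    have "\<exists>M. \<forall>m\<ge>M. \<forall>n\<ge>M. p k (\<sigma> m - \<sigma> n) < e" if "e > 0" for k e
    proof -
      obtain d where d: "d > 0" "\<And>x y. fdist p x y < d \<Longrightarrow> p k (x - y) < e"
        using p_small_of_fdist[OF \<open>e > 0\<close>] by blast
      from C[OF d(1)] obtain M where "\<forall>m n. M \<le> m \<longrightarrow> M \<le> n \<longrightarrow> fdist p (\<sigma> m) (\<sigma> n) < d" ..
      then show ?thesis using d(2) by (intro exI[of _ M]) blast
    qed
    then have "\<exists>l. ftendsto p \<sigma> l sequentially" by (rule Cauchy_convergent)
    then show ?thesis using that by (elim exE)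
  qed
  have "limitin metric.mtopology \<sigma> l sequentially"
    unfolding metric.limit_metric_sequentially
  proof (intro conjI allI impI)
    fix e :: real assume "e > 0"
    then have "\<forall>\<^sub>F n in sequentially. fdist p (\<sigma> n) l < e"
      using l unfolding ftendsto_def by (intro order_tendstoD(2))
    then show "\<exists>N. \<forall>n\<ge>N. \<sigma> n \<in> UNIV \<and> fdist p (\<sigma> n) l < e"
      by (simp add: eventually_sequentially)
  qed simp
  then show "\<exists>x. limitin metric.mtopology \<sigma> x sequentially" by (rule exI)
qed

text \<open>Only continuity at 0 enters: the neighbourhood contains a seminorm ball, and homogeneity
  makes a constant of its radius.\<close>

lemma fbounded_op_bound:
  assumes T: "fbounded_op p T"
  shows "\<exists>m c. c \<ge> 0 \<and> (\<forall>x. p k (T x) \<le> c * p m x)"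
proof -
  have lin: "linear T" using T by (simp add: fbounded_op_def)
  obtain e where e: "e > 0" "\<And>x y. fdist p x y < e \<Longrightarrow> p k (x - y) < 1"
    using p_small_of_fdist[of 1 k] by auto
  obtain d where d: "d > 0" "\<And>y. fdist p 0 y < d \<Longrightarrow> fdist p (T 0) (T y) < e"
    using T e(1) unfolding fbounded_op_def by metis
  obtain m \<delta> where m: "\<delta> > 0" "\<And>x y. p m (x - y) < \<delta> \<Longrightarrow> fdist p x y < d"
    using fdist_small_of_p[OF d(1)] by auto
  have "p k (T x) \<le> 2 / \<delta> * p m x" for x
  proof (rule seminorm_bound_of_small[where q = "\<lambda>x. p k (T x)" and r = "p m"])
    fix x assume "p m x < \<delta>"
    then have "fdist p 0 x < d" using m(2)[of 0 x] by simp
    then have "p k (T 0 - T x) < 1" using d e by blast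
    then show "p k (T x) < 1" using linear_0[OF lin] by simp
  qed (use m linear_cmul[OF lin] p_scaleR in auto)
  then show ?thesis using m(1) by (intro exI[of _ m] exI[of _ "2 / \<delta>"]) auto
qed

lemma fbounded_op_linear: "fbounded_op p T \<Longrightarrow> linear T"
  by (simp add: fbounded_op_def)

lemma fbounded_op_ftendsto:
  assumes T: "fbounded_op p T" and f: "ftendsto p f l F"
  shows "ftendsto p (\<lambda>x. T (f x)) (T l) F"
proof -
  have "\<exists>m c. \<forall>x. p k (T x) \<le> c * p m x" for k using fbounded_op_bound[OF T] by blast
  then obtain m c where c: "\<And>k x. p k (T x) \<le> c k * p (m k) x" by metis
  show ?thesis
  proof (rule ftendsto_sandwich)
    fix k
    have "T (f x) - T l = T (f x - l)" for x using linear_diff[OF fbounded_op_linear[OF T]] by simp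
    then show "\<forall>\<^sub>F x in F. p k (T (f x) - T l) \<le> c k * p (m k) (f x - l)" using c by simp
    have "((\<lambda>x. c k * p (m k) (f x - l)) \<longlongrightarrow> c k * 0) F" by (intro tendsto_intros ftendstoD[OF f])
    then show "((\<lambda>x. c k * p (m k) (f x - l)) \<longlongrightarrow> 0) F" by simp
  qed
qed

text \<open>Baire's theorem applied to the sets of points at which the family is bounded by n.\<close>

theorem uniform_boundedness:
  fixes T :: "'i \<Rightarrow> 'a \<Rightarrow> 'a"
  assumes T: "\<And>i. i \<in> I \<Longrightarrow> fbounded_op p (T i)"
    and bdd: "\<And>x. \<exists>M. \<forall>i\<in>I. p k (T i x) \<le> M"
  shows "\<exists>m c. c \<ge> 0 \<and> (\<forall>i\<in>I. \<forall>x. p k (T i x) \<le> c * p m x)"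
proof -
  have lin: "linear (T i)" if "i \<in> I" for i using T[OF that] by (simp add: fbounded_op_def)
  define E where "E n = {x. \<forall>i\<in>I. p k (T i x) \<le> real n}" for n :: nat
  have closed: "closedin metric.mtopology (E n)" for n
    unfolding metric.closedin_metric
  proof (intro conjI allI impI)
    fix x assume "x \<in> UNIV - E n"
    then obtain i where i: "i \<in> I" "p k (T i x) > real n" by (auto simp: E_def not_le)
    define e where "e = p k (T i x) - real n"
    have "e > 0" using i by (simp add: e_def)
    obtain e' where e': "e' > 0" "\<And>x y. fdist p x y < e' \<Longrightarrow> p k (x - y) < e"
      using p_small_of_fdist[OF \<open>e > 0\<close>] by blast
    obtain d where d: "d > 0" "\<And>y. fdist p x y < d \<Longrightarrow> fdist p (T i x) (T i y) < e'"
      using T[OF i(1)] e'(1) unfolding fbounded_op_def by metis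
    have "y \<notin> E n" if "y \<in> metric.mball x d" for y
    proof -
      have "p k (T i x - T i y) < e" using that d e' by simp
      then have "p k (T i y) > real n"
        using p_abs_diff[of k "T i x" "T i y"] by (simp add: e_def)
      then show ?thesis using i(1) by (force simp: E_def not_le)
    qed
    then show "\<exists>r>0. disjnt (E n) (metric.mball x r)"
      using d(1) by (auto simp: disjnt_iff)
  qed auto
  have cover: "\<Union>(range E) = UNIV"
  proof -
    have "\<exists>n. x \<in> E n" for x
    proof -
      obtain M where M: "\<forall>i\<in>I. p k (T i x) \<le> M" using bdd by blast
      obtain n where "M \<le> real n" using real_arch_simple by blast
      then have "x \<in> E n" using M unfolding E_def by (blast intro: order_trans)
      then show ?thesis ..
    qed
    then show ?thesis by blast
  qed
  have "\<exists>n. metric.mtopology interior_of (E n) \<noteq> {}"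
  proof (rule ccontr)
    assume "\<not> ?thesis"
    then have "metric.mtopology interior_of \<Union>(range E) = {}"
      using closed by (intro metric.metric_Baire_category_alt mcomplete) auto
    then have "metric.mtopology interior_of UNIV = {}" using cover by simp
    then show False using interior_of_topspace[of metric.mtopology] by simp
  qed
  then obtain n x0 r where r: "r > 0" "metric.mball x0 r \<subseteq> E n"
    by (auto simp: metric.metric_interior_of)
  obtain m \<delta> where m: "\<delta> > 0" "\<And>x y. p m (x - y) < \<delta> \<Longrightarrow> fdist p x y < r"
    using fdist_small_of_p[OF r(1)] by auto
  \<comment> \<open>A point x of the seminorm ball is the difference of x0 + x and x0, both of which
    lie in E n.\<close>
  have ball: "p k (T i x) \<le> 2 * real n" if "i \<in> I" "p m x < \<delta>" for i x
  proof -
    have "x0 + x \<in> E n" "x0 \<in> E n"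
      using m(2)[of x0 "x0 + x"] that r by (auto simp: subset_iff)
    then have "p k (T i (x0 + x)) \<le> real n" "p k (T i x0) \<le> real n" using that by (auto simp: E_def)
    moreover have "T i x = T i (x0 + x) - T i x0" using linear_add[OF lin[OF that(1)]] by simp
    ultimately show ?thesis using p_diff[of k "T i (x0 + x)" "T i x0"] by simp
  qed
  \<comment> \<open>One more than the bound 2 n, so that dividing by N gives a value below 1 and is
    legitimate even for n = 0.\<close>
  define N where "N = 2 * real n + 1"
  have N: "N > 0" by (simp add: N_def)
  have "p k (T i x) \<le> 2 * N / \<delta> * p m x" if i: "i \<in> I" for i x
  proof -
    have "p k (T i x) / N \<le> 2 / \<delta> * p m x"
    proof (rule seminorm_bound_of_small[where q = "\<lambda>x. p k (T i x) / N" and r = "p m"])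
      fix x assume "p m x < \<delta>"
      then show "p k (T i x) / N < 1" using ball[OF i, of x] N by (simp add: N_def)
    qed (use m N linear_cmul[OF lin[OF i]] p_scaleR in auto)
    then show ?thesis using N by (simp add: field_simps)
  qed
  then show ?thesis using m(1) N by (intro exI[of _ m] exI[of _ "2 * N / \<delta>"]) auto
qed

end

section \<open>Functionals and vector-valued integrals\<close>

context frechet_space
begin

definition fdual :: "('a \<Rightarrow> real) set" where
  "fdual = {\<phi>. linear \<phi> \<and> (\<exists>k c. \<forall>x. \<bar>\<phi> x\<bar> \<le> c * p k x)}"

text \<open>The polar of the unit ball of p k. Constants in scalar estimates have to be uniform over
  this set in order to yield estimates in p k.\<close>

definition fball :: "nat \<Rightarrow> ('a \<Rightarrow> real) set" where
  "fball k = {\<phi>. linear \<phi> \<and> (\<forall>x. \<bar>\<phi> x\<bar> \<le> p k x)}"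

lemma fball_fdual: "\<phi> \<in> fball k \<Longrightarrow> \<phi> \<in> fdual"
  unfolding fball_def fdual_def by (intro CollectI conjI exI[of _ k] exI[of _ "1::real"]) auto

lemma fdual_linear: "\<phi> \<in> fdual \<Longrightarrow> linear \<phi>"
  by (simp add: fdual_def)

lemma fball_le: "\<phi> \<in> fball k \<Longrightarrow> \<bar>\<phi> x\<bar> \<le> p k x"
  by (simp add: fball_def)

lemma fdual_simps:
  assumes "\<phi> \<in> fdual"
  shows "\<phi> (x + y) = \<phi> x + \<phi> y" "\<phi> (x - y) = \<phi> x - \<phi> y" "\<phi> (c *\<^sub>R x) = c * \<phi> x" "\<phi> 0 = 0"
    "\<phi> (sum f I) = (\<Sum>i\<in>I. \<phi> (f i))"
  using fdual_linear[OF assms] by (simp_all add: linear_add linear_diff linear_cmul linear_0 linear_sum)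

text \<open>Hahn--Banach supplies a functional in the polar whose value at x is p k x.\<close>

lemma p_le_fball:
  assumes "\<And>\<phi>. \<phi> \<in> fball k \<Longrightarrow> \<bar>\<phi> x\<bar> \<le> M"
  shows "p k x \<le> M"
proof -
  obtain \<phi> where "linear \<phi>" "\<forall>x. \<bar>\<phi> x\<bar> \<le> p k x" "\<phi> x = p k x"
    using Hahn_Banach_seminorm[OF seminorm_on_p[of k], of x] by blast
  then show ?thesis using assms[of \<phi>] by (simp add: fball_def)
qed

lemma fdual_eqI:
  assumes "\<And>\<phi>. \<phi> \<in> fdual \<Longrightarrow> \<phi> x = \<phi> y"
  shows "x = y"
proof -
  have "p k (x - y) \<le> 0" for k
  proof (rule p_le_fball)
    fix \<phi> assume "\<phi> \<in> fball k"
    then have "\<phi> \<in> fdual" by (rule fball_fdual)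
    then show "\<bar>\<phi> (x - y)\<bar> \<le> 0" using assms[of \<phi>] by (simp add: fdual_simps)
  qed
  then have "p k (x - y) = 0" for k using p_nonneg[of k "x - y"] by (simp add: order_antisym)
  then have "x - y = 0" by (rule p_eq_0)
  then show ?thesis by simp
qed

text \<open>The transpose of T preserves the dual; with T = C it allows C to be pulled into scalar
  integrals.\<close>

lemma fdual_compose:
  assumes T: "fbounded_op p T" and \<phi>: "\<phi> \<in> fdual"
  shows "(\<lambda>x. \<phi> (T x)) \<in> fdual"
proof -
  obtain k c where c: "\<And>x. \<bar>\<phi> x\<bar> \<le> c * p k x" using \<phi> by (auto simp: fdual_def)
  obtain m d where d: "d \<ge> 0" "\<And>x. p k (T x) \<le> d * p m x" using fbounded_op_bound[OF T] by blast
  have "\<bar>\<phi> (T x)\<bar> \<le> (\<bar>c\<bar> * d) * p m x" for x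
  proof -
    have "\<bar>\<phi> (T x)\<bar> \<le> c * p k (T x)" by (rule c)
    also have "\<dots> \<le> \<bar>c\<bar> * p k (T x)" by (intro mult_right_mono) auto
    also have "\<dots> \<le> \<bar>c\<bar> * (d * p m x)" by (intro mult_left_mono d) auto
    finally show ?thesis by simp
  qed
  moreover have "linear (\<lambda>x. \<phi> (T x))"
    using linear_compose[OF fbounded_op_linear[OF T] fdual_linear[OF \<phi>]] by (simp add: o_def)
  ultimately show ?thesis unfolding fdual_def by blast
qed

lemma fdual_tendsto:
  assumes f: "ftendsto p f l F" and \<phi>: "\<phi> \<in> fdual"
  shows "((\<lambda>x. \<phi> (f x)) \<longlongrightarrow> \<phi> l) F"
proof -
  obtain k c where c: "\<And>x. \<bar>\<phi> x\<bar> \<le> c * p k x" using \<phi> by (auto simp: fdual_def)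
  have "((\<lambda>x. c * p k (f x - l)) \<longlongrightarrow> c * 0) F" by (intro tendsto_intros ftendstoD[OF f])
  then have "((\<lambda>x. c * p k (f x - l)) \<longlongrightarrow> 0) F" by simp
  moreover have "\<forall>\<^sub>F x in F. norm (\<phi> (f x - l)) \<le> c * p k (f x - l)" using c by simp
  ultimately have "((\<lambda>x. \<phi> (f x - l)) \<longlongrightarrow> 0) F" by (rule Lim_null_comparison[rotated])
  then have "((\<lambda>x. \<phi> (f x) - \<phi> l) \<longlongrightarrow> 0) F" by (simp add: fdual_simps[OF \<phi>])
  then show ?thesis by (simp add: LIM_zero_iff)
qed

section \<open>Continuous curves in a Frechet space\<close>

definition fcont_on :: "real set \<Rightarrow> (real \<Rightarrow> 'a) \<Rightarrow> bool" where
  "fcont_on S f \<longleftrightarrow> (\<forall>t\<in>S. ftendsto p f (f t) (at t within S))"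

lemma fcont_onD: "fcont_on S f \<Longrightarrow> t \<in> S \<Longrightarrow> ftendsto p f (f t) (at t within S)"
  unfolding fcont_on_def by (erule bspec)

lemma fcont_onI: "(\<And>t. t \<in> S \<Longrightarrow> ftendsto p f (f t) (at t within S)) \<Longrightarrow> fcont_on S f"
  unfolding fcont_on_def by (rule ballI)

lemma fcont_on_subset: "fcont_on S f \<Longrightarrow> T \<subseteq> S \<Longrightarrow> fcont_on T f"
  unfolding fcont_on_def ftendsto_def by (blast intro: tendsto_within_subset)

lemma fcont_on_cong: "fcont_on S f \<Longrightarrow> (\<And>t. t \<in> S \<Longrightarrow> f t = g t) \<Longrightarrow> fcont_on S g"
  unfolding fcont_on_def
proof
  fix t assume *: "\<forall>t\<in>S. ftendsto p f (f t) (at t within S)" "\<And>t. t \<in> S \<Longrightarrow> f t = g t" "t \<in> S"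
  then have "ftendsto p f (g t) (at t within S)" by metis
  moreover have "\<forall>\<^sub>F x in at t within S. f x = g x" using *(2) by (simp add: eventually_at_filter)
  ultimately show "ftendsto p g (g t) (at t within S)" by (rule ftendsto_cong_eventually)
qed

lemma fcont_on_const: "fcont_on S (\<lambda>_. x)"
  by (simp add: fcont_on_def)

lemma fcont_on_add:
  assumes "fcont_on S f" "fcont_on S g"
  shows "fcont_on S (\<lambda>t. f t + g t)"
  by (rule fcont_onI, rule ftendsto_add[OF fcont_onD[OF assms(1)] fcont_onD[OF assms(2)]])

lemma fcont_on_diff:
  assumes "fcont_on S f" "fcont_on S g"
  shows "fcont_on S (\<lambda>t. f t - g t)"
  by (rule fcont_onI, rule ftendsto_diff[OF fcont_onD[OF assms(1)] fcont_onD[OF assms(2)]])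

lemma fcont_on_scaleR:
  assumes "continuous_on S c" "fcont_on S f"
  shows "fcont_on S (\<lambda>t. c t *\<^sub>R f t)"
  by (rule fcont_onI,
      rule ftendsto_scaleR[OF bspec[OF assms(1)[unfolded continuous_on_def]] fcont_onD[OF assms(2)]])

lemma fcont_on_sum:
  assumes "\<And>i. i \<in> I \<Longrightarrow> fcont_on S (f i)"
  shows "fcont_on S (\<lambda>t. \<Sum>i\<in>I. f i t)"
  using assms
proof (induction I rule: infinite_finite_induct)
  case (insert x F)
  then have "fcont_on S (\<lambda>t. f x t + (\<Sum>i\<in>F. f i t))" by (intro fcont_on_add) simp_all
  then show ?case using insert by simp
qed (simp_all add: fcont_on_const)

lemma fcont_on_op:
  assumes "fbounded_op p T" "fcont_on S f"
  shows "fcont_on S (\<lambda>t. T (f t))"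
  by (rule fcont_onI, rule fbounded_op_ftendsto[OF assms(1) fcont_onD[OF assms(2)]])

lemma fcont_on_fdual:
  assumes "fcont_on S f" "\<phi> \<in> fdual"
  shows "continuous_on S (\<lambda>t. \<phi> (f t))"
  unfolding continuous_on_def by (rule ballI, rule fdual_tendsto[OF fcont_onD[OF assms(1)] assms(2)])

lemma fcont_on_shift:
  assumes f: "fcont_on {0..} f" and s: "s \<ge> 0"
  shows "fcont_on {0..} (\<lambda>t. f (t + s))"
proof (rule fcont_onI)
  fix t :: real assume t: "t \<in> {0..}"
  have "filterlim (\<lambda>t. t + s) (at (t + s) within {0..}) (at t within {0..})"
    unfolding filterlim_at
  proof
    show "((\<lambda>t. t + s) \<longlongrightarrow> t + s) (at t within {0..})" by (intro tendsto_intros)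
    show "\<forall>\<^sub>F x in at t within {0..}. x + s \<in> {0..} \<and> x + s \<noteq> t + s"
      using s by (simp add: eventually_at_filter)
  qed
  moreover have "ftendsto p f (f (t + s)) (at (t + s) within {0..})"
    using t s by (intro fcont_onD[OF f]) simp
  ultimately show "ftendsto p (\<lambda>t. f (t + s)) (f (t + s)) (at t within {0..})"
    by (rule ftendsto_compose[rotated])
qed

lemma continuous_on_p: 
  assumes f: "fcont_on S f"
  shows "continuous_on S (\<lambda>t. p k (f t))"
  unfolding continuous_on_def
proof
  fix t assume "t \<in> S"
  then have "((\<lambda>x. p k (f x - f t)) \<longlongrightarrow> 0) (at t within S)"
    by (rule ftendstoD[OF fcont_onD[OF f]])
  then have "((\<lambda>x. p k (f x) - p k (f t)) \<longlongrightarrow> 0) (at t within S)"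
    by (rule Lim_null_comparison[rotated]) (simp add: p_abs_diff)
  then show "((\<lambda>t. p k (f t)) \<longlongrightarrow> p k (f t)) (at t within S)" by (simp add: LIM_zero_iff)
qed

lemma p_bounded:
  assumes "fcont_on {a..b} f"
  shows "\<exists>M\<ge>0. \<forall>t\<in>{a..b}. p k (f t) \<le> M"
proof -
  have "bounded ((\<lambda>t. p k (f t)) ` {a..b})"
    by (rule compact_imp_bounded[OF compact_continuous_image[OF continuous_on_p[OF assms] compact_Icc]])
  then obtain M where "\<forall>x\<in>(\<lambda>t. p k (f t)) ` {a..b}. norm x \<le> M" unfolding bounded_iff ..
  then have M: "\<And>t. t \<in> {a..b} \<Longrightarrow> \<bar>p k (f t)\<bar> \<le> M" by (simp only: ball_simps real_norm_def)
  then have "\<forall>t\<in>{a..b}. p k (f t) \<le> max M 0" by force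
  then show ?thesis by (intro exI[of _ "max M 0"]) auto
qed

text \<open>The function (s, t) to p k (f s - f t) is real-valued, continuous on the compact square and zero on the
  diagonal.\<close>

lemma fcont_uniform:
  assumes f: "fcont_on {a..b} f" and e: "e > 0"
  shows "\<exists>d>0. \<forall>s\<in>{a..b}. \<forall>t\<in>{a..b}. \<bar>s - t\<bar> < d \<longrightarrow> p k (f s - f t) < e"
proof -
  have tend: "((\<lambda>x. p k (f x - f t)) \<longlongrightarrow> 0) (at t within {a..b})" if "t \<in> {a..b}" for t
    by (rule ftendstoD[OF fcont_onD[OF f that]])
  have cont: "continuous_on ({a..b} \<times> {a..b}) (\<lambda>(s, t). p k (f s - f t))"
    unfolding continuous_on_def
  proof
    fix z assume z: "z \<in> {a..b} \<times> {a..b}"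
    obtain s t where st: "z = (s, t)" "s \<in> {a..b}" "t \<in> {a..b}" using z by auto
    have l1: "((\<lambda>w. p k (f (fst w) - f s)) \<longlongrightarrow> 0) (at z within {a..b} \<times> {a..b})"
    proof -
      have "continuous_on {a..b} (\<lambda>x. p k (f x - f s))"
        by (rule continuous_on_p[OF fcont_on_diff[OF f fcont_on_const]])
      then have "continuous_on ({a..b} \<times> {a..b}) (\<lambda>w. p k (f (fst w) - f s))"
        by (rule continuous_on_compose2) (auto intro: continuous_intros)
      then show ?thesis using z st unfolding continuous_on_def by force
    qed
    have l2: "((\<lambda>w. p k (f (snd w) - f t)) \<longlongrightarrow> 0) (at z within {a..b} \<times> {a..b})"
    proof -
      have "continuous_on {a..b} (\<lambda>x. p k (f x - f t))"
        by (rule continuous_on_p[OF fcont_on_diff[OF f fcont_on_const]])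
      then have "continuous_on ({a..b} \<times> {a..b}) (\<lambda>w. p k (f (snd w) - f t))"
        by (rule continuous_on_compose2) (auto intro: continuous_intros)
      then show ?thesis using z st unfolding continuous_on_def by force
    qed
    have bd: "norm ((case w of (s, t) \<Rightarrow> p k (f s - f t)) - (case z of (s, t) \<Rightarrow> p k (f s - f t)))
        \<le> p k (f (fst w) - f s) + p k (f (snd w) - f t)" for w
    proof -
      have "f (fst w) - f (snd w) - (f s - f t) = (f (fst w) - f s) - (f (snd w) - f t)" by simp
      then have "p k (f (fst w) - f (snd w) - (f s - f t)) \<le> p k (f (fst w) - f s) + p k (f (snd w) - f t)"
        using p_diff by metis
      then show ?thesis using p_abs_diff[of k "f (fst w) - f (snd w)" "f s - f t"]
        by (simp add: st case_prod_unfold)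
    qed
    have "((\<lambda>w. (case w of (s, t) \<Rightarrow> p k (f s - f t)) - (case z of (s, t) \<Rightarrow> p k (f s - f t))) \<longlongrightarrow> 0)
        (at z within {a..b} \<times> {a..b})"
      by (rule Lim_null_comparison[OF _ tendsto_add_zero[OF l1 l2]]) (rule always_eventually, rule allI, rule bd)
    then show "((\<lambda>(s, t). p k (f s - f t)) \<longlongrightarrow> (case z of (s, t) \<Rightarrow> p k (f s - f t))) (at z within {a..b} \<times> {a..b})"
      by (simp add: LIM_zero_iff)
  qed
  have "uniformly_continuous_on ({a..b} \<times> {a..b}) (\<lambda>(s, t). p k (f s - f t))"
    by (intro compact_uniformly_continuous cont compact_Times compact_Icc)
  then obtain d where d: "d > 0" and
    dd: "\<And>z w. z \<in> {a..b} \<times> {a..b} \<Longrightarrow> w \<in> {a..b} \<times> {a..b} \<Longrightarrow> dist w z < d \<Longrightarrow>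
      dist (case w of (s, t) \<Rightarrow> p k (f s - f t)) (case z of (s, t) \<Rightarrow> p k (f s - f t)) < e"
    using e unfolding uniformly_continuous_on_def by meson
  have "p k (f s - f t) < e" if "s \<in> {a..b}" "t \<in> {a..b}" "\<bar>s - t\<bar> < d" for s t
  proof -
    have "dist (s, t) (s, s) < d" using that by (simp add: dist_Pair_Pair dist_real_def abs_minus_commute)
    then have "dist (p k (f s - f t)) (p k (f s - f s)) < e" using dd[of "(s, s)" "(s, t)"] that by simp
    then show ?thesis by (simp add: dist_real_def)
  qed
  then show ?thesis using d by blast
qed

end

text \<open>The sums in \<open>rlim\<close> use n + 1 intervals and their left end points. On each
  interval the error is at most e times its length; induction over the intervals adds these
  up.\<close>

lemma riemann_sum_error:
  fixes h :: "real \<Rightarrow> real"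
  assumes h: "continuous_on {a..c} h" and ac: "a < c"
    and e: "\<And>x y. x \<in> {a..c} \<Longrightarrow> y \<in> {a..c} \<Longrightarrow> \<bar>x - y\<bar> \<le> (c - a) / real (Suc n) \<Longrightarrow> \<bar>h x - h y\<bar> \<le> e"
  shows "\<bar>(c - a) / real (Suc n) * (\<Sum>k\<le>n. h (a + real k * (c - a) / real (Suc n))) - integral {a..c} h\<bar> \<le> e * (c - a)"
proof -
  define \<delta> where "\<delta> = (c - a) / real (Suc n)"
  have \<delta>: "\<delta> > 0" using ac by (simp add: \<delta>_def)
  define u where "u k = a + real k * \<delta>" for k :: nat
  have "real (Suc n) * \<delta> = c - a" by (simp add: \<delta>_def del: of_nat_Suc)
  then have u: "u 0 = a" "u (Suc n) = c" "\<And>k. u (Suc k) = u k + \<delta>"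
    by (simp_all add: u_def algebra_simps)
  have mono: "u i \<le> u j" if "i \<le> j" for i j using that \<delta> by (simp add: u_def mult_right_mono)
  have main: "\<bar>\<delta> * (\<Sum>k<m. h (u k)) - integral {a..u m} h\<bar> \<le> e * (u m - a)" if "m \<le> Suc n" for m
    using that
  proof (induction m)
    case 0 then show ?case by (simp add: u)
  next
    case (Suc m)
    have IH: "\<bar>\<delta> * (\<Sum>k<m. h (u k)) - integral {a..u m} h\<bar> \<le> e * (u m - a)" using Suc by simp
    have um: "a \<le> u m" "u m \<le> u (Suc m)" "u (Suc m) \<le> c"
      using mono[of 0 m] mono[of m "Suc m"] mono[of "Suc m" "Suc n"] Suc u(1,2) by auto
    have hi: "h integrable_on {a..u (Suc m)}" "h integrable_on {u m..u (Suc m)}"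
      using um by (auto intro!: integrable_continuous_interval continuous_on_subset[OF h])
    have split: "integral {a..u (Suc m)} h = integral {a..u m} h + integral {u m..u (Suc m)} h"
      using Henstock_Kurzweil_Integration.integral_combine[OF um(1,2) hi(1)] by simp
    have "integral {u m..u (Suc m)} (\<lambda>x. h (u m) - h x) = \<delta> * h (u m) - integral {u m..u (Suc m)} h"
      using hi(2) um by (subst Henstock_Kurzweil_Integration.integral_diff) (auto simp: u(3))
    moreover have "norm (integral {u m..u (Suc m)} (\<lambda>x. h (u m) - h x)) \<le> e * (u (Suc m) - u m)"
    proof (rule integral_bound)
      show "continuous_on {u m..u (Suc m)} (\<lambda>x. h (u m) - h x)"
        using um by (intro continuous_intros continuous_on_subset[OF h]) auto
      fix x assume "x \<in> {u m..u (Suc m)}"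
      then show "norm (h (u m) - h x) \<le> e"
        using e[of "u m" x] um u(3)[of m] by (simp add: \<delta>_def)
    qed (use um in auto)
    ultimately have "\<bar>\<delta> * h (u m) - integral {u m..u (Suc m)} h\<bar> \<le> e * (u (Suc m) - u m)" by simp
    moreover have "\<delta> * (\<Sum>k<Suc m. h (u k)) = \<delta> * (\<Sum>k<m. h (u k)) + \<delta> * h (u m)"
      by (simp add: distrib_left)
    ultimately have "\<bar>\<delta> * (\<Sum>k<Suc m. h (u k)) - integral {a..u (Suc m)} h\<bar>
        \<le> e * (u m - a) + e * (u (Suc m) - u m)" using IH split by linarith
    also have "\<dots> = e * (u (Suc m) - a)" by (simp add: algebra_simps)
    finally show ?case .
  qed
  have "{..n} = {..<Suc n}" by auto
  then show ?thesis using main[of "Suc n"] u(2) by (simp add: u_def \<delta>_def mult.commute del: sum.lessThan_Suc)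
qed

context frechet_space
begin

text \<open>The mesh given by uniform continuity of f in p k makes the scalar errors small uniformly
  over \<open>fball k\<close>. Comparing two sums through the same scalar integrals shows that the
  vector sums are Cauchy in p k, and completeness yields the limit.\<close>

lemma rlim_exists:
  assumes f: "fcont_on {a..c} f" and ac: "a < c"
  shows "\<exists>J. rlim p f a c J \<and> (\<forall>\<phi>\<in>fdual. \<phi> J = integral {a..c} (\<lambda>s. \<phi> (f s)))"
proof -
  define R where "R n = ((c - a) / real (Suc n)) *\<^sub>R (\<Sum>k\<le>n. f (a + real k * (c - a) / real (Suc n)))" for n
  have R: "\<phi> (R n) = (c - a) / real (Suc n) * (\<Sum>k\<le>n. \<phi> (f (a + real k * (c - a) / real (Suc n))))"
    if "\<phi> \<in> fdual" for \<phi> n by (simp only: R_def fdual_simps[OF that])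
  have err: "\<exists>M. \<forall>n\<ge>M. \<forall>\<phi>\<in>fball k. \<bar>\<phi> (R n) - integral {a..c} (\<lambda>s. \<phi> (f s))\<bar> \<le> e" if "e > 0" for k e
  proof -
    have "e / (c - a) > 0" using ac that by simp
    from fcont_uniform[OF f this, of k] obtain d where d: "d > 0" and
      dd: "\<And>s t. s \<in> {a..c} \<Longrightarrow> t \<in> {a..c} \<Longrightarrow> \<bar>s - t\<bar> < d \<Longrightarrow> p k (f s - f t) < e / (c - a)" by blast
    obtain M :: nat where M: "(c - a) / d < real M" using reals_Archimedean2 by blast
    show ?thesis
    proof (intro exI[of _ M] allI impI ballI)
      fix n \<phi> assume n: "n \<ge> M" and \<phi>: "\<phi> \<in> fball k"
      note \<phi>' = fball_fdual[OF \<phi>]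
      have "(c - a) / d < real (Suc n)" using M n by simp
      then have small: "(c - a) / real (Suc n) < d" using d by (simp add: field_simps)
      have "\<bar>(c - a) / real (Suc n) * (\<Sum>k\<le>n. \<phi> (f (a + real k * (c - a) / real (Suc n)))) - integral {a..c} (\<lambda>s. \<phi> (f s))\<bar>
          \<le> e / (c - a) * (c - a)"
      proof (rule riemann_sum_error[OF fcont_on_fdual[OF f \<phi>'] ac])
        fix x y assume xy: "x \<in> {a..c}" "y \<in> {a..c}" "\<bar>x - y\<bar> \<le> (c - a) / real (Suc n)"
        have "\<bar>\<phi> (f x) - \<phi> (f y)\<bar> = \<bar>\<phi> (f x - f y)\<bar>" by (simp add: fdual_simps[OF \<phi>'])
        also have "\<dots> \<le> p k (f x - f y)" by (rule fball_le[OF \<phi>])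
        also have "\<dots> \<le> e / (c - a)" using dd[of x y] xy small by simp
        finally show "\<bar>\<phi> (f x) - \<phi> (f y)\<bar> \<le> e / (c - a)" .
      qed
      then show "\<bar>\<phi> (R n) - integral {a..c} (\<lambda>s. \<phi> (f s))\<bar> \<le> e" using ac by (simp only: R[OF \<phi>']) simp
    qed
  qed
  have "\<exists>J. ftendsto p R J sequentially"
  proof (rule Cauchy_convergent)
    fix k and e :: real assume "e > 0"
    then have "e / 3 > 0" by simp
    from err[OF this, of k] obtain M where M: "\<And>n \<phi>. n \<ge> M \<Longrightarrow> \<phi> \<in> fball k \<Longrightarrow>
      \<bar>\<phi> (R n) - integral {a..c} (\<lambda>s. \<phi> (f s))\<bar> \<le> e / 3" by blast
    have "p k (R m - R n) < e" if "m \<ge> M" "n \<ge> M" for m n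
    proof -
      have "p k (R m - R n) \<le> e / 3 + e / 3"
      proof (rule p_le_fball)
        fix \<phi> assume \<phi>: "\<phi> \<in> fball k"
        show "\<bar>\<phi> (R m - R n)\<bar> \<le> e / 3 + e / 3"
          using M[OF that(1) \<phi>] M[OF that(2) \<phi>] fdual_simps(2)[OF fball_fdual[OF \<phi>], of "R m" "R n"] by linarith
      qed
      then show ?thesis using \<open>e > 0\<close> by linarith
    qed
    then show "\<exists>M. \<forall>m\<ge>M. \<forall>n\<ge>M. p k (R m - R n) < e" by blast
  qed
  then obtain J where J: "ftendsto p R J sequentially" ..
  \<comment> \<open>A general functional is dominated only by a multiple of some seminorm, so its
    sums are treated directly by uniform continuity of phi o f.\<close>
  have "\<phi> J = integral {a..c} (\<lambda>s. \<phi> (f s))" if \<phi>: "\<phi> \<in> fdual" for \<phi>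
  proof -
    define h where "h s = \<phi> (f s)" for s
    have h: "continuous_on {a..c} h" unfolding h_def by (rule fcont_on_fdual[OF f \<phi>])
    have "(\<lambda>n. \<phi> (R n)) \<longlonglongrightarrow> \<phi> J" by (rule fdual_tendsto[OF J \<phi>])
    moreover have "(\<lambda>n. \<phi> (R n)) \<longlonglongrightarrow> integral {a..c} h"
    proof (rule LIMSEQ_I)
      fix e :: real assume "e > 0"
      then have "e / (2 * (c - a)) > 0" using ac by simp
      moreover have "uniformly_continuous_on {a..c} h" using h by (intro compact_uniformly_continuous) auto
      ultimately obtain d where d: "d > 0" and
        dd: "\<And>s t. s \<in> {a..c} \<Longrightarrow> t \<in> {a..c} \<Longrightarrow> \<bar>s - t\<bar> < d \<Longrightarrow> \<bar>h s - h t\<bar> < e / (2 * (c - a))"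
        unfolding uniformly_continuous_on_def dist_real_def by metis
      obtain M :: nat where M: "(c - a) / d < real M" using reals_Archimedean2 by blast
      show "\<exists>no. \<forall>n\<ge>no. norm (\<phi> (R n) - integral {a..c} h) < e"
      proof (intro exI[of _ M] allI impI)
        fix n assume n: "n \<ge> M"
        have "(c - a) / d < real (Suc n)" using M n by simp
        then have small: "(c - a) / real (Suc n) < d" using d by (simp add: field_simps)
        have "\<bar>(c - a) / real (Suc n) * (\<Sum>k\<le>n. h (a + real k * (c - a) / real (Suc n))) - integral {a..c} h\<bar>
            \<le> e / (2 * (c - a)) * (c - a)"
          using dd small by (intro riemann_sum_error h ac) (meson le_less_trans less_imp_le)
        also have "e / (2 * (c - a)) * (c - a) = e / 2" using ac by (simp add: field_simps)
        also have "\<dots> < e" using \<open>e > 0\<close> by simp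
        finally show "norm (\<phi> (R n) - integral {a..c} h) < e" by (simp only: R[OF \<phi>] h_def real_norm_def)
      qed
    qed
    ultimately show ?thesis unfolding h_def by (rule LIMSEQ_unique)
  qed
  then show ?thesis using J unfolding rlim_def R_def by blast
qed

section \<open>Uniqueness of integrals and closed operators under the integral sign\<close>

lemma rlim_unique: "rlim p f a c J \<Longrightarrow> rlim p f a c J' \<Longrightarrow> J = J'"
  unfolding rlim_def by (erule ftendsto_unique) auto

lemma has_fint_unique:
  assumes "has_fint p f a b I" "has_fint p f a b I'"
  shows "I = I'"
proof (cases "a = b")
  case True then show ?thesis using assms by (simp add: has_fint_def)
next
  case False
  then have ab: "a < b" using assms by (simp add: has_fint_def)
  obtain J where J: "\<forall>c\<in>{a<..<b}. rlim p f a c (J c)" "ftendsto p J I (at_left b)"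
    using assms(1) ab unfolding has_fint_def by blast
  obtain J' where J': "\<forall>c\<in>{a<..<b}. rlim p f a c (J' c)" "ftendsto p J' I' (at_left b)"
    using assms(2) ab unfolding has_fint_def by blast
  have "\<forall>\<^sub>F c in at_left b. J c = J' c"
    using eventually_at_left_real[OF ab] by eventually_elim (rule rlim_unique[OF bspec[OF J(1)] bspec[OF J'(1)]])
  with J(2) have "ftendsto p J' I (at_left b)" by (rule ftendsto_cong_eventually)
  then show ?thesis by (rule ftendsto_unique[OF _ J'(2)]) simp
qed

lemma closed_lin_opD:
  assumes "closed_lin_op p DA A"
  shows closed_lin_op_add: "x \<in> DA \<Longrightarrow> y \<in> DA \<Longrightarrow> x + y \<in> DA \<and> A (x + y) = A x + A y"
    and closed_lin_op_scaleR: "x \<in> DA \<Longrightarrow> c *\<^sub>R x \<in> DA \<and> A (c *\<^sub>R x) = c *\<^sub>R A x"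
    and closed_lin_op_0: "0 \<in> DA \<and> A 0 = 0"
    and closed_lin_op_closed: "\<And>xs x y. (\<And>k. xs k \<in> DA) \<Longrightarrow> ftendsto p xs x sequentially
      \<Longrightarrow> ftendsto p (\<lambda>k. A (xs k)) y sequentially \<Longrightarrow> x \<in> DA \<and> A x = y"
proof -
  note A = assms[unfolded closed_lin_op_def]
  note A1 = A[THEN conjunct1] and A2 = A[THEN conjunct2, THEN conjunct1]
    and A3 = A[THEN conjunct2, THEN conjunct2, THEN conjunct1]
    and A4 = A[THEN conjunct2, THEN conjunct2, THEN conjunct2]
  show "x \<in> DA \<Longrightarrow> y \<in> DA \<Longrightarrow> x + y \<in> DA \<and> A (x + y) = A x + A y" using A2 by simp
  show sc: "x \<in> DA \<Longrightarrow> c *\<^sub>R x \<in> DA \<and> A (c *\<^sub>R x) = c *\<^sub>R A x" for x c using A3 by simp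
  show "0 \<in> DA \<and> A 0 = 0" using sc[of 0 0] A1 by simp
  fix xs x y
  assume "\<And>k. xs k \<in> DA" "ftendsto p xs x sequentially" "ftendsto p (\<lambda>k. A (xs k)) y sequentially"
  then show "x \<in> DA \<and> A x = y"
    by (intro A4[THEN spec, THEN spec, THEN spec, THEN mp] conjI allI)
qed

lemma closed_lin_op_diff:
  assumes A: "closed_lin_op p DA A" and "x \<in> DA" "y \<in> DA"
  shows "x - y \<in> DA \<and> A (x - y) = A x - A y"
  using closed_lin_op_add[OF A assms(2), of "-1 *\<^sub>R y"] closed_lin_op_scaleR[OF A assms(3), of "-1"] by simp

lemma closed_lin_op_sum:
  assumes A: "closed_lin_op p DA A" and f: "\<And>i. i \<in> I \<Longrightarrow> f i \<in> DA"
  shows "sum f I \<in> DA \<and> A (sum f I) = (\<Sum>i\<in>I. A (f i))"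
  using f
proof (induction I rule: infinite_finite_induct)
  case (insert x F)
  then show ?case using closed_lin_op_add[OF A, of "f x" "sum f F"] by simp
qed (simp_all add: closed_lin_op_0[OF A])

text \<open>Closedness is used twice: for the Riemann sums over {a..c}, and then for c tending to b.
  The second limit runs along a sequence because closedness is a sequential condition.\<close>

lemma closed_lin_op_has_fint:
  assumes A: "closed_lin_op p DA A" and f: "\<And>s. s \<in> {a..b} \<Longrightarrow> f s \<in> DA"
    and g: "\<And>s. s \<in> {a..b} \<Longrightarrow> A (f s) = g s"
    and I: "has_fint p f a b I" and J: "has_fint p g a b J"
  shows "I \<in> DA \<and> A I = J"
proof (cases "a = b")
  case True
  then have "I = 0" "J = 0" using I J by (simp_all add: has_fint_def)
  then show ?thesis using closed_lin_op_0[OF A] by simp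
next
  case False
  then have ab: "a < b" using I by (simp add: has_fint_def)
  note clos = closed_lin_op_closed[OF A]
  obtain F where F: "\<forall>c\<in>{a<..<b}. rlim p f a c (F c)" "ftendsto p F I (at_left b)"
    using I ab unfolding has_fint_def by blast
  obtain G where G: "\<forall>c\<in>{a<..<b}. rlim p g a c (G c)" "ftendsto p G J (at_left b)"
    using J ab unfolding has_fint_def by blast
  have FG: "F c \<in> DA \<and> A (F c) = G c" if c: "c \<in> {a<..<b}" for c
  proof (rule clos)
    let ?x = "\<lambda>n k. a + real k * (c - a) / real (Suc n)"
    have in_ab: "?x n k \<in> {a..b}" if "k \<le> n" for n k
    proof -
      have "real k * (c - a) \<le> real (Suc n) * (c - a)" using that c by (intro mult_right_mono) auto
      then have "real k * (c - a) / real (Suc n) \<le> (c - a)" by (simp add: pos_divide_le_eq mult.commute)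
      moreover have "0 \<le> real k * (c - a) / real (Suc n)" using c by simp
      ultimately show ?thesis using c by simp
    qed
    have *: "(\<Sum>k\<le>n. f (?x n k)) \<in> DA \<and> A (\<Sum>k\<le>n. f (?x n k)) = (\<Sum>k\<le>n. g (?x n k))" for n
    proof -
      have "(\<Sum>k\<le>n. A (f (?x n k))) = (\<Sum>k\<le>n. g (?x n k))"
        using in_ab g by (intro sum.cong) auto
      moreover have "(\<Sum>k\<le>n. f (?x n k)) \<in> DA \<and> A (\<Sum>k\<le>n. f (?x n k)) = (\<Sum>k\<le>n. A (f (?x n k)))"
        using in_ab f by (intro closed_lin_op_sum[OF A]) auto
      ultimately show ?thesis by simp
    qed
    have sc: "d *\<^sub>R x \<in> DA" "A (d *\<^sub>R x) = d *\<^sub>R A x" if "x \<in> DA" for d x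
      using closed_lin_op_scaleR[OF A that] by simp_all
    show "((c - a) / real (Suc n)) *\<^sub>R (\<Sum>k\<le>n. f (?x n k)) \<in> DA" for n
      using sc(1)[OF conjunct1[OF *]] .
    show "ftendsto p (\<lambda>n. ((c - a) / real (Suc n)) *\<^sub>R (\<Sum>k\<le>n. f (?x n k))) (F c) sequentially"
      using bspec[OF F(1) c] unfolding rlim_def .
    have "A (((c - a) / real (Suc n)) *\<^sub>R (\<Sum>k\<le>n. f (?x n k))) = ((c - a) / real (Suc n)) *\<^sub>R (\<Sum>k\<le>n. g (?x n k))" for n
      using *[of n] sc by simp
    then show "ftendsto p (\<lambda>n. A (((c - a) / real (Suc n)) *\<^sub>R (\<Sum>k\<le>n. f (?x n k)))) (G c) sequentially"
      using bspec[OF G(1) c] unfolding rlim_def by simp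
  qed
  \<comment> \<open>The offset 2 keeps the first term away from the left end point.\<close>
  define cs where "cs n = b - (b - a) / real (n + 2)" for n :: nat
  have cs: "cs n \<in> {a<..<b}" for n
  proof -
    have "(b - a) / real (n + 2) < (b - a) / 1" using ab by (intro divide_strict_left_mono) auto
    then show ?thesis using ab by (simp add: cs_def)
  qed
  have "filterlim cs (at_left b) sequentially"
    unfolding filterlim_at
  proof
    show "\<forall>\<^sub>F n in sequentially. cs n \<in> {..<b} \<and> cs n \<noteq> b"
    proof (intro always_eventually allI)
      show "cs n \<in> {..<b} \<and> cs n \<noteq> b" for n using cs[of n] by auto
    qed
    have "(\<lambda>n. (b - a) / real (n + 2)) \<longlonglongrightarrow> 0"
      by (intro LIMSEQ_ignore_initial_segment lim_const_over_n)
    from tendsto_diff[OF tendsto_const[of b] this] show "cs \<longlonglongrightarrow> b" unfolding cs_def by simp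
  qed
  note flim = this
  show ?thesis
  proof (rule clos)
    show "F (cs n) \<in> DA" for n using FG[OF cs] by simp
    show "ftendsto p (\<lambda>n. F (cs n)) I sequentially" by (rule ftendsto_compose[OF F(2) flim])
    have "ftendsto p (\<lambda>n. G (cs n)) J sequentially" by (rule ftendsto_compose[OF G(2) flim])
    then show "ftendsto p (\<lambda>n. A (F (cs n))) J sequentially" using FG[OF cs] by simp
  qed
qed

text \<open>The truncated integrals J c are compared through the primitive G of the kernel: p k (J c
  - J c') is at most M |G c - G c'|, and G is continuous up to t although the kernel may be singular
  there. Completeness then gives the improper integral.\<close>

lemma has_fint_exists:
  assumes \<beta>: "\<beta> > 0" and t: "t \<ge> 0" and f: "fcont_on {0..t} f"
  shows "\<exists>I. has_fint p (\<lambda>s. gfun \<beta> (t - s) *\<^sub>R f s) 0 t I \<and> (\<forall>\<phi>\<in>fdual. \<phi> I = conv \<beta> (\<lambda>s. \<phi> (f s)) t)"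
proof (cases "t = 0")
  case True
  have "\<phi> 0 = conv \<beta> (\<lambda>s. \<phi> (f s)) 0" if "\<phi> \<in> fdual" for \<phi>
    using fdual_simps(4)[OF that] by (simp add: conv_def)
  then show ?thesis unfolding has_fint_def True by (intro exI[of _ 0]) simp
next
  case False
  then have t: "t > 0" using t by simp
  define F where "F s = gfun \<beta> (t - s) *\<^sub>R f s" for s
  have phiF: "\<phi> (F s) = gfun \<beta> (t - s) * \<phi> (f s)" if "\<phi> \<in> fdual" for \<phi> s
    by (simp add: F_def fdual_simps[OF that])
  have contF: "fcont_on {0..c} F" if c: "c \<in> {0<..<t}" for c
  proof -
    have "continuous_on {0..c} (\<lambda>s. (t - s) powr (\<beta> - 1) / Gamma \<beta>)"
      using c \<beta> less_imp_neq[OF Gamma_real_pos[OF \<beta>]] by (intro continuous_intros) auto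
    then have "continuous_on {0..c} (\<lambda>s. gfun \<beta> (t - s))"
      by (rule continuous_on_eq) (use c in \<open>simp add: gfun_def\<close>)
    moreover have "fcont_on {0..c} f" using c by (intro fcont_on_subset[OF f]) auto
    ultimately show ?thesis unfolding F_def by (rule fcont_on_scaleR)
  qed
  have "\<exists>J. \<forall>c\<in>{0<..<t}. rlim p F 0 c (J c) \<and> (\<forall>\<phi>\<in>fdual. \<phi> (J c) = integral {0..c} (\<lambda>s. \<phi> (F s)))"
  proof (rule bchoice, rule ballI)
    fix c assume c: "c \<in> {0<..<t}"
    then show "\<exists>J. rlim p F 0 c J \<and> (\<forall>\<phi>\<in>fdual. \<phi> J = integral {0..c} (\<lambda>s. \<phi> (F s)))"
      using rlim_exists[OF contF[OF c]] by simp
  qed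
  then obtain J where J: "\<And>c. c \<in> {0<..<t} \<Longrightarrow> rlim p F 0 c (J c)"
    and phiJ: "\<And>c \<phi>. c \<in> {0<..<t} \<Longrightarrow> \<phi> \<in> fdual \<Longrightarrow> \<phi> (J c) = integral {0..c} (\<lambda>s. \<phi> (F s))" by meson
  define G where "G c = integral {0..c} (\<lambda>s. gfun \<beta> (t - s))" for c
  have gi: "(\<lambda>s. gfun \<beta> (t - s)) integrable_on {0..t}"
    using conv_has_integral[OF \<beta>, of t "\<lambda>_. 1"] t by (auto intro: has_integral_integrable)
  have contG: "continuous_on {0..t} G"
    unfolding G_def by (rule indefinite_integral_continuous_1[OF gi])
  have phi_int: "(\<lambda>s. \<phi> (F s)) integrable_on {0..t}" "integral {0..t} (\<lambda>s. \<phi> (F s)) = conv \<beta> (\<lambda>s. \<phi> (f s)) t"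
    if "\<phi> \<in> fdual" for \<phi>
  proof -
    have "((\<lambda>s. \<phi> (F s)) has_integral conv \<beta> (\<lambda>s. \<phi> (f s)) t) {0..t}"
      unfolding phiF[OF that] using t by (intro conv_has_integral[OF \<beta> _ fcont_on_fdual[OF f that]]) simp
    then show "(\<lambda>s. \<phi> (F s)) integrable_on {0..t}" "integral {0..t} (\<lambda>s. \<phi> (F s)) = conv \<beta> (\<lambda>s. \<phi> (f s)) t"
      by (auto intro: integral_unique has_integral_integrable)
  qed
  have diff: "p k (J c - J c') \<le> M * (G c - G c')"
    if M: "\<And>s. s \<in> {0..t} \<Longrightarrow> p k (f s) \<le> M" and c: "c \<in> {0<..<t}" "c' \<in> {0<..<t}" "c' \<le> c" for k M c c'
  proof (rule p_le_fball)
    fix \<phi> assume \<phi>: "\<phi> \<in> fball k"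
    note \<phi>' = fball_fdual[OF \<phi>]
    have i: "(\<lambda>s. \<phi> (F s)) integrable_on {0..c}" "(\<lambda>s. \<phi> (F s)) integrable_on {c'..c}"
      "(\<lambda>s. gfun \<beta> (t - s)) integrable_on {0..c}" "(\<lambda>s. gfun \<beta> (t - s)) integrable_on {c'..c}"
      using c by (auto intro: integrable_subinterval_real[OF phi_int(1)[OF \<phi>']] integrable_subinterval_real[OF gi])
    have "\<phi> (J c) = \<phi> (J c') + integral {c'..c} (\<lambda>s. \<phi> (F s))"
      using Henstock_Kurzweil_Integration.integral_combine[of 0 c' c "\<lambda>s. \<phi> (F s)"] i c by (simp add: phiJ \<phi>')
    then have "\<phi> (J c - J c') = integral {c'..c} (\<lambda>s. \<phi> (F s))" by (simp add: fdual_simps[OF \<phi>'])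
    also have "norm \<dots> \<le> integral {c'..c} (\<lambda>s. M * gfun \<beta> (t - s))"
    proof (rule integral_norm_bound_integral)
      show "(\<lambda>s. \<phi> (F s)) integrable_on {c'..c}" by (rule i)
      show "(\<lambda>s. M * gfun \<beta> (t - s)) integrable_on {c'..c}" using i by (intro integrable_on_mult_right)
      fix s assume s: "s \<in> {c'..c}"
      have "\<bar>\<phi> (f s)\<bar> \<le> M" using fball_le[OF \<phi>, of "f s"] M[of s] s c by simp
      then show "norm (\<phi> (F s)) \<le> M * gfun \<beta> (t - s)"
        using mult_right_mono[of "\<bar>\<phi> (f s)\<bar>" M "gfun \<beta> (t - s)"] gfun_nonneg[OF \<beta>, of "t - s"]
        by (simp add: phiF[OF \<phi>'] abs_mult mult.commute)
    qed
    also have "\<dots> = M * integral {c'..c} (\<lambda>s. gfun \<beta> (t - s))" by simp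
    also have "integral {c'..c} (\<lambda>s. gfun \<beta> (t - s)) = G c - G c'"
      using Henstock_Kurzweil_Integration.integral_combine[of 0 c' c "\<lambda>s. gfun \<beta> (t - s)"] i c by (simp add: G_def)
    finally show "\<bar>\<phi> (J c - J c')\<bar> \<le> M * (G c - G c')" by simp
  qed
  have diff_abs: "p k (J c - J c') \<le> M * \<bar>G c - G c'\<bar>"
    if M: "\<And>s. s \<in> {0..t} \<Longrightarrow> p k (f s) \<le> M" and M0: "M \<ge> 0" and c: "c \<in> {0<..<t}" "c' \<in> {0<..<t}" for k M c c'
  proof (cases "c' \<le> c")
    case True
    have "p k (J c - J c') \<le> M * (G c - G c')" by (rule diff[OF M c True])
    also have "\<dots> \<le> M * \<bar>G c - G c'\<bar>" using M0 by (intro mult_left_mono) auto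
    finally show ?thesis .
  next
    case False
    have "p k (J c' - J c) \<le> M * (G c' - G c)" using False by (intro diff[OF M c(2,1)]) auto
    also have "\<dots> \<le> M * \<bar>G c - G c'\<bar>" using M0 by (intro mult_left_mono) auto
    finally show ?thesis by (subst p_commute)
  qed
  have bdd: "\<exists>M\<ge>0. \<forall>s\<in>{0..t}. p k (f s) \<le> M" for k by (rule p_bounded[OF f])
  define cs where "cs n = t - t / real (n + 2)" for n :: nat
  have cs: "cs n \<in> {0<..<t}" for n
  proof -
    have "t / real (n + 2) < t / 1" using t by (intro divide_strict_left_mono) auto
    then show ?thesis using t by (simp add: cs_def)
  qed
  have cs0: "0 \<le> cs n \<and> cs n \<le> t" for n using cs[of n] by simp
  have "(\<lambda>n. t / real (n + 2)) \<longlonglongrightarrow> 0"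
    by (intro LIMSEQ_ignore_initial_segment lim_const_over_n)
  from tendsto_diff[OF tendsto_const[of t] this] have cs_lim: "cs \<longlonglongrightarrow> t" unfolding cs_def by simp
  have Gcs: "(\<lambda>n. G (cs n)) \<longlonglongrightarrow> G t"
    by (rule continuous_on_tendsto_compose[OF contG cs_lim]) (use cs0 t in simp_all)
  have "\<exists>I. ftendsto p (\<lambda>n. J (cs n)) I sequentially"
  proof (rule Cauchy_convergent)
    fix k and e :: real assume e: "e > 0"
    obtain M where M: "M \<ge> 0" "\<And>s. s \<in> {0..t} \<Longrightarrow> p k (f s) \<le> M" using bdd[of k] by blast
    have "Cauchy (\<lambda>n. G (cs n))" using Gcs by (rule LIMSEQ_imp_Cauchy)
    moreover have "e / (M + 1) > 0" using e M by simp
    ultimately obtain K where K: "\<And>m n. m \<ge> K \<Longrightarrow> n \<ge> K \<Longrightarrow> dist (G (cs m)) (G (cs n)) < e / (M + 1)"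
      unfolding Cauchy_def by blast
    have "p k (J (cs m) - J (cs n)) < e" if "m \<ge> K" "n \<ge> K" for m n
    proof -
      have "p k (J (cs m) - J (cs n)) \<le> M * \<bar>G (cs m) - G (cs n)\<bar>" by (rule diff_abs[OF M(2,1) cs cs])
      also have "\<dots> \<le> M * (e / (M + 1))" using K[OF that] M by (intro mult_left_mono) (auto simp: dist_real_def)
      also have "\<dots> < e" using M e by (simp add: field_simps)
      finally show ?thesis .
    qed
    then show "\<exists>K. \<forall>m\<ge>K. \<forall>n\<ge>K. p k (J (cs m) - J (cs n)) < e" by blast
  qed
  then obtain I where I: "ftendsto p (\<lambda>n. J (cs n)) I sequentially" ..
  \<comment> \<open>Letting one argument run along \<open>cs\<close> turns the Cauchy estimate into
    a bound on the distance to I for every real c, as the limit c -> t in \<open>has_fint\<close>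
    requires.\<close>
  have le: "p k (J c - I) \<le> M * \<bar>G c - G t\<bar>"
    if M: "\<And>s. s \<in> {0..t} \<Longrightarrow> p k (f s) \<le> M" "M \<ge> 0" and c: "c \<in> {0<..<t}" for k M c
  proof (rule tendsto_le[OF sequentially_bot])
    have "(\<lambda>n. p k (J (cs n) - I) + M * \<bar>G c - G (cs n)\<bar>) \<longlonglongrightarrow> 0 + M * \<bar>G c - G t\<bar>"
      by (intro tendsto_intros Gcs ftendstoD[OF I])
    then show "(\<lambda>n. p k (J (cs n) - I) + M * \<bar>G c - G (cs n)\<bar>) \<longlonglongrightarrow> M * \<bar>G c - G t\<bar>" by simp
    show "(\<lambda>n. p k (J c - I)) \<longlonglongrightarrow> p k (J c - I)" by (rule tendsto_const)
    have "p k (J c - I) \<le> p k (J (cs n) - I) + M * \<bar>G c - G (cs n)\<bar>" for n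
      using p_triangle3[of k "J c" I "J (cs n)"] diff_abs[OF M c cs[of n]] by linarith
    then show "\<forall>\<^sub>F n in sequentially. p k (J c - I) \<le> p k (J (cs n) - I) + M * \<bar>G c - G (cs n)\<bar>" by simp
  qed
  have lim: "ftendsto p J I (at_left t)"
  proof -
    have "\<exists>M. M \<ge> 0 \<and> (\<forall>s\<in>{0..t}. p k (f s) \<le> M)" for k using bdd[of k] by blast
    then obtain M where M: "\<And>k. M k \<ge> 0" "\<And>k s. s \<in> {0..t} \<Longrightarrow> p k (f s) \<le> M k" by metis
    have "(G \<longlongrightarrow> G t) (at t within {0..t})" using contG t unfolding continuous_on_def by simp
    then have "(G \<longlongrightarrow> G t) (at_left t)" using t by (simp add: at_within_Icc_at_left)
    then have "((\<lambda>c. M k * \<bar>G c - G t\<bar>) \<longlongrightarrow> M k * \<bar>G t - G t\<bar>) (at_left t)" for k by (intro tendsto_intros)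
    then have l0: "((\<lambda>c. M k * \<bar>G c - G t\<bar>) \<longlongrightarrow> 0) (at_left t)" for k by simp
    show ?thesis
    proof (rule ftendsto_sandwich[OF _ l0])
      show "\<forall>\<^sub>F c in at_left t. p k (J c - I) \<le> M k * \<bar>G c - G t\<bar>" for k
        using eventually_at_left_real[OF t] by eventually_elim (rule le[OF M(2) M(1)])
    qed
  qed
  have "has_fint p F 0 t I"
    unfolding has_fint_def
  proof (intro conjI impI)
    show "\<exists>J. (\<forall>c\<in>{0<..<t}. rlim p F 0 c (J c)) \<and> ftendsto p J I (at_left t)"
      by (rule exI[of _ J], rule conjI, rule ballI, erule J, rule lim)
  qed (use t in simp_all)
  moreover have "\<phi> I = conv \<beta> (\<lambda>s. \<phi> (f s)) t" if \<phi>: "\<phi> \<in> fdual" for \<phi>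
  proof -
    have "(\<lambda>n. \<phi> (J (cs n))) \<longlonglongrightarrow> \<phi> I" by (rule fdual_tendsto[OF I \<phi>])
    moreover have "(\<lambda>n. \<phi> (J (cs n))) \<longlonglongrightarrow> integral {0..t} (\<lambda>s. \<phi> (F s))"
    proof -
      have "continuous_on {0..t} (\<lambda>c. integral {0..c} (\<lambda>s. \<phi> (F s)))"
        by (rule indefinite_integral_continuous_1[OF phi_int(1)[OF \<phi>]])
      then have "(\<lambda>n. integral {0..cs n} (\<lambda>s. \<phi> (F s))) \<longlonglongrightarrow> integral {0..t} (\<lambda>s. \<phi> (F s))"
        by (rule continuous_on_tendsto_compose[OF _ cs_lim]) (use cs0 t in simp_all)
      then show ?thesis by (simp add: phiJ[OF cs \<phi>])
    qed
    ultimately have "\<phi> I = integral {0..t} (\<lambda>s. \<phi> (F s))" by (rule LIMSEQ_unique)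
    then show ?thesis by (simp add: phi_int(2)[OF \<phi>])
  qed
  ultimately show ?thesis unfolding F_def by blast
qed

text \<open>The fractional integral of order \<beta> of a curve in X. The choice is determined
  whenever an integral exists, because \<open>has_fint\<close> has at most one value.\<close>

definition vconv :: "real \<Rightarrow> (real \<Rightarrow> 'a) \<Rightarrow> real \<Rightarrow> 'a" where
  "vconv \<beta> f t = (SOME I. has_fint p (\<lambda>s. gfun \<beta> (t - s) *\<^sub>R f s) 0 t I)"

lemma vconv:
  assumes \<beta>: "\<beta> > 0" and t: "t \<ge> 0" and f: "fcont_on {0..t} f"
  shows vconv_has_fint: "has_fint p (\<lambda>s. gfun \<beta> (t - s) *\<^sub>R f s) 0 t (vconv \<beta> f t)"
    and fdual_vconv: "\<phi> \<in> fdual \<Longrightarrow> \<phi> (vconv \<beta> f t) = conv \<beta> (\<lambda>s. \<phi> (f s)) t"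
proof -
  obtain I where I: "has_fint p (\<lambda>s. gfun \<beta> (t - s) *\<^sub>R f s) 0 t I"
    "\<And>\<phi>. \<phi> \<in> fdual \<Longrightarrow> \<phi> I = conv \<beta> (\<lambda>s. \<phi> (f s)) t"
    using has_fint_exists[OF \<beta> t f] by blast
  show 1: "has_fint p (\<lambda>s. gfun \<beta> (t - s) *\<^sub>R f s) 0 t (vconv \<beta> f t)"
    unfolding vconv_def by (rule someI[of _ I]) (rule I)
  show "\<phi> (vconv \<beta> f t) = conv \<beta> (\<lambda>s. \<phi> (f s)) t" if "\<phi> \<in> fdual"
    using has_fint_unique[OF 1 I(1)] I(2)[OF that] by simp
qed

text \<open>Reduces identities between vector-valued fractional integrals to identities for
  \<open>conv\<close>, where additivity of orders is available.\<close>

lemma vconv_eqI: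
  assumes "\<beta> > 0" "t \<ge> 0" "fcont_on {0..t} f" "\<And>\<phi>. \<phi> \<in> fdual \<Longrightarrow> \<phi> y = conv \<beta> (\<lambda>s. \<phi> (f s)) t"
  shows "vconv \<beta> f t = y"
  by (rule fdual_eqI) (simp add: fdual_vconv[OF assms(1-3)] assms(4))

lemma closed_vconv:
  assumes A: "closed_lin_op p DA A" and \<beta>: "\<beta> > 0" and t: "t \<ge> 0"
    and f: "fcont_on {0..t} f" and Af: "fcont_on {0..t} (\<lambda>s. A (f s))"
    and DA: "\<And>s. s \<in> {0..t} \<Longrightarrow> f s \<in> DA"
  shows "vconv \<beta> f t \<in> DA \<and> A (vconv \<beta> f t) = vconv \<beta> (\<lambda>s. A (f s)) t"
proof -
  show ?thesis
    by (rule closed_lin_op_has_fint[OF A _ _ vconv_has_fint[OF \<beta> t f] vconv_has_fint[OF \<beta> t Af]])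
       (use DA closed_lin_op_scaleR[OF A] in auto)
qed

lemma p_vconv:
  assumes \<beta>: "\<beta> > 0" and t: "t \<ge> 0" and f: "fcont_on {0..t} f"
    and M: "\<And>s. s \<in> {0..t} \<Longrightarrow> p k (f s) \<le> M"
  shows "p k (vconv \<beta> f t) \<le> M * gfun (\<beta> + 1) t"
proof (rule p_le_fball)
  fix \<phi> assume \<phi>: "\<phi> \<in> fball k"
  note \<phi>' = fball_fdual[OF \<phi>]
  show "\<bar>\<phi> (vconv \<beta> f t)\<bar> \<le> M * gfun (\<beta> + 1) t"
    unfolding fdual_vconv[OF \<beta> t f \<phi>']
  proof (rule conv_bound[OF \<beta> t fcont_on_fdual[OF f \<phi>']])
    show "\<bar>\<phi> (f s)\<bar> \<le> M" if "s \<in> {0..t}" for s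
      using fball_le[OF \<phi>, of "f s"] M[OF that] by simp
  qed
qed

text \<open>\<open>conv_equicontinuous\<close> is applied to all phi o f with phi in
  \<open>fball k\<close> at once; its M bounds p k along f, and its e' is met by uniform continuity
  of f in p k. The interval {0..t + 1} leaves room to the right of t.\<close>

lemma fcont_vconv:
  assumes \<beta>: "\<beta> > 0" and f: "fcont_on {0..} f"
  shows "fcont_on {0..} (vconv \<beta> f)"
proof (rule fcont_onI)
  fix t :: real assume "t \<in> {0..}"
  then have t: "t \<ge> 0" by simp
  define T where "T = t + 1"
  have fT: "fcont_on {0..s} f" for s by (rule fcont_on_subset[OF f]) auto
  show "ftendsto p (vconv \<beta> f) (vconv \<beta> f t) (at t within {0..})"
    unfolding ftendsto_iff
  proof (intro allI tendstoI)
    fix k and e :: real assume "e > 0"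
    then have e2: "e / 2 > 0" by simp
    obtain M where M: "\<And>s. s \<in> {0..T} \<Longrightarrow> p k (f s) \<le> M" using p_bounded[OF fT[of T], of k] by blast
    from conv_equicontinuous[OF \<beta> e2, of T M] obtain d e' where d: "d > 0" and e': "e' > 0"
      and *: "\<forall>h d0. continuous_on {0..T} h \<longrightarrow> (\<forall>s\<in>{0..T}. \<bar>h s\<bar> \<le> M)
        \<longrightarrow> d0 \<le> d \<longrightarrow> (\<forall>s\<in>{0..T}. \<forall>t\<in>{0..T}. \<bar>s - t\<bar> \<le> d0 \<longrightarrow> \<bar>h s - h t\<bar> \<le> e')
        \<longrightarrow> (\<forall>s\<in>{0..T}. \<forall>t\<in>{0..T}. \<bar>s - t\<bar> \<le> d0 \<longrightarrow> \<bar>conv \<beta> h s - conv \<beta> h t\<bar> \<le> e/2)"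
      by (elim exE conjE) (rule that)
    obtain d1 where d1: "d1 > 0" "\<And>s t. s \<in> {0..T} \<Longrightarrow> t \<in> {0..T} \<Longrightarrow> \<bar>s - t\<bar> < d1 \<Longrightarrow> p k (f s - f t) < e'"
      using fcont_uniform[OF fT[of T] e', of k] by blast
    define d0 where "d0 = min d (d1 / 2)"
    have near: "p k (vconv \<beta> f s - vconv \<beta> f t) \<le> e / 2" if s: "0 \<le> s" "s \<le> T" "\<bar>s - t\<bar> \<le> d0" for s
    proof (rule p_le_fball)
      fix \<phi> assume \<phi>: "\<phi> \<in> fball k"
      note \<phi>' = fball_fdual[OF \<phi>]
      have "\<bar>conv \<beta> (\<lambda>s. \<phi> (f s)) s - conv \<beta> (\<lambda>s. \<phi> (f s)) t\<bar> \<le> e/2"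
      proof (rule *[rule_format, of "\<lambda>s. \<phi> (f s)" d0])
        show "continuous_on {0..T} (\<lambda>s. \<phi> (f s))" by (rule fcont_on_fdual[OF fT \<phi>'])
        show "\<bar>\<phi> (f s)\<bar> \<le> M" if "s \<in> {0..T}" for s
          using fball_le[OF \<phi>, of "f s"] M[OF that] by simp
        show "\<bar>\<phi> (f u) - \<phi> (f v)\<bar> \<le> e'" if "u \<in> {0..T}" "v \<in> {0..T}" "\<bar>u - v\<bar> \<le> d0" for u v
        proof -
          have "\<bar>\<phi> (f u) - \<phi> (f v)\<bar> = \<bar>\<phi> (f u - f v)\<bar>" by (simp add: fdual_simps[OF \<phi>'])
          also have "\<dots> \<le> p k (f u - f v)" by (rule fball_le[OF \<phi>])
          also have "\<dots> \<le> e'" using d1(2)[OF that(1,2)] that(3) d1(1) by (simp add: d0_def)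
          finally show ?thesis .
        qed
      qed (use s t in \<open>auto simp: d0_def T_def\<close>)
      then show "\<bar>\<phi> (vconv \<beta> f s - vconv \<beta> f t)\<bar> \<le> e / 2"
        using s t by (simp add: fdual_simps[OF \<phi>'] fdual_vconv[OF \<beta> _ fT \<phi>'])
    qed
    have "\<forall>\<^sub>F s in at t within {0..}. dist s t < min 1 d0 \<and> s \<in> {0..}"
      using d d1 by (auto simp: eventually_at d0_def intro!: exI[of _ "min 1 (min d (d1/2))"])
    then show "\<forall>\<^sub>F s in at t within {0..}. dist (p k (vconv \<beta> f s - vconv \<beta> f t)) 0 < e"
    proof eventually_elim
      case (elim s)
      then have "p k (vconv \<beta> f s - vconv \<beta> f t) \<le> e / 2"
        by (intro near) (auto simp: T_def dist_real_def)
      then show ?case using \<open>e > 0\<close> by (simp add: dist_real_def)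
    qed
  qed
qed

text \<open>A fundamental theorem of calculus for a curve F that is known to be a primitive of v
  only when tested by functionals. The error is bounded by the oscillation of v near t in p k,
  uniformly over \<open>fball k\<close>. The filter keeps t + h nonnegative.\<close>

lemma difference_quotient:
  assumes v: "fcont_on {0..} v" and t: "t \<ge> 0"
    and F: "\<And>t \<phi>. t \<ge> 0 \<Longrightarrow> \<phi> \<in> fdual \<Longrightarrow> \<phi> (F t) = \<phi> (F 0) + integral {0..t} (\<lambda>s. \<phi> (v s))"
  shows "ftendsto p (\<lambda>h. (1 / h) *\<^sub>R (F (t + h) - F t)) (v t) (at 0 within {-t..})"
  unfolding ftendsto_iff
proof (intro allI tendstoI)
  fix k and e :: real assume e: "e > 0"
  have "((\<lambda>x. p k (v x - v t)) \<longlongrightarrow> 0) (at t within {0..})"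
    using t by (intro ftendstoD[OF fcont_onD[OF v]]) simp
  then have "\<forall>\<^sub>F s in at t within {0..}. p k (v s - v t) < e / 2"
    using e by (intro order_tendstoD(2)) auto
  then obtain d where d: "d > 0" and dd0: "\<And>s. s \<ge> 0 \<Longrightarrow> s \<noteq> t \<Longrightarrow> dist s t < d \<Longrightarrow> p k (v s - v t) < e / 2"
    unfolding eventually_at by auto
  have dd: "p k (v s - v t) \<le> e / 2" if "s \<ge> 0" "\<bar>s - t\<bar> < d" for s
    using dd0[of s] that e by (cases "s = t") (auto simp: dist_real_def less_imp_le)
  have key: "\<bar>\<phi> (F b - F a) - (b - a) * \<phi> (v t)\<bar> \<le> e / 2 * (b - a)"
    if \<phi>: "\<phi> \<in> fball k" and ab: "0 \<le> a" "a \<le> b" "\<bar>a - t\<bar> < d" "\<bar>b - t\<bar> < d" for \<phi> a b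
  proof -
    note \<phi>' = fball_fdual[OF \<phi>]
    have c: "continuous_on {0..} (\<lambda>s. \<phi> (v s))" by (rule fcont_on_fdual[OF v \<phi>'])
    have i: "(\<lambda>s. \<phi> (v s)) integrable_on {0..b}" "(\<lambda>s. \<phi> (v s)) integrable_on {a..b}"
      using ab by (auto intro!: integrable_continuous_interval continuous_on_subset[OF c])
    have "\<phi> (F b - F a) = integral {a..b} (\<lambda>s. \<phi> (v s))"
      using Henstock_Kurzweil_Integration.integral_combine[OF ab(1,2) i(1)] F[OF _ \<phi>', of a] F[OF _ \<phi>', of b] ab
      by (simp add: fdual_simps[OF \<phi>'])
    then have "\<phi> (F b - F a) - (b - a) * \<phi> (v t) = integral {a..b} (\<lambda>s. \<phi> (v s) - \<phi> (v t))"
      using i ab by (subst Henstock_Kurzweil_Integration.integral_diff) auto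
    also have "norm \<dots> \<le> e / 2 * (b - a)"
    proof (rule integral_bound[OF ab(2)])
      show "continuous_on {a..b} (\<lambda>s. \<phi> (v s) - \<phi> (v t))"
        using ab by (intro continuous_intros continuous_on_subset[OF c]) auto
      fix s assume s: "s \<in> {a..b}"
      have "\<bar>\<phi> (v s) - \<phi> (v t)\<bar> = \<bar>\<phi> (v s - v t)\<bar>" by (simp add: fdual_simps[OF \<phi>'])
      also have "\<dots> \<le> p k (v s - v t)" by (rule fball_le[OF \<phi>])
      also have "\<dots> \<le> e / 2" using s ab by (intro dd) auto
      finally show "norm (\<phi> (v s) - \<phi> (v t)) \<le> e / 2" by simp
    qed
    finally show ?thesis by simp
  qed
  have main: "p k ((1 / h) *\<^sub>R (F (t + h) - F t) - v t) \<le> e / 2" if h: "h \<noteq> 0" "\<bar>h\<bar> < d" "h \<ge> - t" for h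
  proof (rule p_le_fball)
    fix \<phi> assume \<phi>: "\<phi> \<in> fball k"
    note \<phi>' = fball_fdual[OF \<phi>]
    have eq: "\<phi> ((1 / h) *\<^sub>R (F (t + h) - F t) - v t) = (\<phi> (F (t + h) - F t) - h * \<phi> (v t)) / h"
      using h by (simp add: fdual_simps[OF \<phi>'] diff_divide_distrib)
    have "\<bar>\<phi> (F (t + h) - F t) - h * \<phi> (v t)\<bar> \<le> e / 2 * \<bar>h\<bar>"
    proof (cases "h > 0")
      case True
      then show ?thesis using key[OF \<phi>, of t "t + h"] h t d by simp
    next
      case False
      then have "\<bar>\<phi> (F t - F (t + h)) - (- h) * \<phi> (v t)\<bar> \<le> e / 2 * (- h)"
        using key[OF \<phi>, of "t + h" t] h t d by simp
      moreover have "\<phi> (F t - F (t + h)) - (- h) * \<phi> (v t) = - (\<phi> (F (t + h) - F t) - h * \<phi> (v t))"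
        by (simp add: fdual_simps[OF \<phi>'])
      ultimately show ?thesis using False by simp
    qed
    then show "\<bar>\<phi> ((1 / h) *\<^sub>R (F (t + h) - F t) - v t)\<bar> \<le> e / 2"
      unfolding eq using h by (simp add: divide_simps)
  qed
  have "\<forall>\<^sub>F h in at 0 within {-t..}. h \<noteq> 0 \<and> \<bar>h\<bar> < d \<and> h \<ge> - t"
    using d by (auto simp: eventually_at dist_real_def intro!: exI[of _ d])
  then show "\<forall>\<^sub>F h in at 0 within {-t..}. dist (p k ((1 / h) *\<^sub>R (F (t + h) - F t) - v t)) 0 < e"
  proof eventually_elim
    case (elim h)
    then show ?case using main[of h] e by (simp add: dist_real_def)
  qed
qed

end

section \<open>Integrated C-semigroups and mild solutions\<close>

lemma continuous_on_conv_atLeast: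
  assumes a: "a > 0" and h: "continuous_on {0..} h"
  shows "continuous_on {0..} (conv a h)"
proof -
  have "continuous (at t within {0..}) (conv a h)" if "t \<ge> 0" for t
  proof -
    have "continuous_on {0..t + 1} (conv a h)"
      by (intro continuous_on_conv[OF a] continuous_on_subset[OF h]) auto
    then have "continuous (at t within {0..t + 1}) (conv a h)"
      using that by (simp add: continuous_on_eq_continuous_within)
    moreover have "at t within {0..} = at t within {0..t + 1}"
      by (rule at_within_nhd[of _ "{..<t + 1}"]) (use that in auto)
    ultimately show ?thesis by (simp add: continuous_within)
  qed
  then show ?thesis by (simp add: continuous_on_eq_continuous_within)
qed

text \<open>For b > 0, g_(b+1) is the integral of order b of the constant 1, so orders add. The case
  b = 0 is the constant itself.\<close>

lemma conv_gfun:
  assumes "a > 0" "b \<ge> 0" "t \<ge> 0"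
  shows "conv a (gfun (b + 1)) t = gfun (a + b + 1) t"
proof (cases "b = 0")
  case True
  have "conv a (gfun (0 + 1)) t = conv a (\<lambda>_. 1) t" by (rule conv_cong) simp
  then show ?thesis using True conv_const[OF assms(1,3)] by simp
next
  case False
  then have b: "b > 0" using assms by simp
  have "conv a (gfun (b + 1)) t = conv a (conv b (\<lambda>_. 1)) t"
    by (rule conv_cong) (simp add: conv_const[OF b])
  also have "\<dots> = conv (a + b) (\<lambda>_. 1) t" by (rule conv_conv) (use assms b in auto)
  also have "\<dots> = gfun (a + b + 1) t" using assms b by (intro conv_const) auto
  finally show ?thesis .
qed

context frechet_space
begin

lemma vconv_cong:
  assumes "\<beta> > 0" "t \<ge> 0" "fcont_on {0..t} f" "\<And>s. s \<in> {0..t} \<Longrightarrow> f s = g s"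
  shows "vconv \<beta> f t = vconv \<beta> g t"
proof (rule vconv_eqI[OF assms(1-3)])
  fix \<phi> assume \<phi>: "\<phi> \<in> fdual"
  have g: "fcont_on {0..t} g" by (rule fcont_on_cong[OF assms(3,4)])
  show "\<phi> (vconv \<beta> g t) = conv \<beta> (\<lambda>s. \<phi> (f s)) t"
    unfolding fdual_vconv[OF assms(1,2) g \<phi>] by (rule conv_cong) (simp add: assms(4))
qed

lemma vconv_0:
  assumes "\<beta> > 0" "fcont_on {0..0} f"
  shows "vconv \<beta> f 0 = 0"
  using vconv_has_fint[OF assms(1) order_refl assms(2)] by (simp add: has_fint_def)

lemma fcont_Icc: "fcont_on {0..} f \<Longrightarrow> fcont_on {0..t} f"
  by (erule fcont_on_subset) auto

lemma vconv_diff: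
  assumes "\<beta> > 0" "t \<ge> 0" "fcont_on {0..t} f" "fcont_on {0..t} g"
  shows "vconv \<beta> (\<lambda>s. f s - g s) t = vconv \<beta> f t - vconv \<beta> g t"
proof (rule vconv_eqI[OF assms(1,2) fcont_on_diff[OF assms(3,4)]])
  fix \<phi> assume \<phi>: "\<phi> \<in> fdual"
  have "conv \<beta> (\<lambda>s. \<phi> (f s - g s)) t = conv \<beta> (\<lambda>s. \<phi> (f s) - \<phi> (g s)) t" by (simp add: fdual_simps[OF \<phi>])
  also have "\<dots> = conv \<beta> (\<lambda>s. \<phi> (f s)) t - conv \<beta> (\<lambda>s. \<phi> (g s)) t"
    by (rule conv_diff[OF assms(1,2) fcont_on_fdual[OF assms(3) \<phi>] fcont_on_fdual[OF assms(4) \<phi>]])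
  finally show "\<phi> (vconv \<beta> f t - vconv \<beta> g t) = conv \<beta> (\<lambda>s. \<phi> (f s - g s)) t"
    by (simp add: fdual_simps[OF \<phi>] fdual_vconv[OF assms(1,2,3) \<phi>] fdual_vconv[OF assms(1,2,4) \<phi>])
qed

lemma vconv_scaleR:
  assumes "\<beta> > 0" "t \<ge> 0" "fcont_on {0..t} f"
  shows "vconv \<beta> (\<lambda>s. c *\<^sub>R f s) t = c *\<^sub>R vconv \<beta> f t"
proof (rule vconv_eqI[OF assms(1,2) fcont_on_scaleR[OF continuous_on_const assms(3)]])
  fix \<phi> assume \<phi>: "\<phi> \<in> fdual"
  show "\<phi> (c *\<^sub>R vconv \<beta> f t) = conv \<beta> (\<lambda>s. \<phi> (c *\<^sub>R f s)) t"
    by (simp add: fdual_simps[OF \<phi>] fdual_vconv[OF assms(1,2,3) \<phi>] conv_cmult)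
qed

end

section \<open>The integrated semigroup, its primitive and bounds on compact time intervals\<close>

locale integrated_semigroup = frechet_space p for p :: "nat \<Rightarrow> 'a::real_vector \<Rightarrow> real" +
  fixes \<alpha> :: real and C :: "'a \<Rightarrow> 'a" and DA :: "'a set" and A :: "'a \<Rightarrow> 'a" and S :: "real \<Rightarrow> 'a \<Rightarrow> 'a"
  assumes alpha: "\<alpha> \<ge> 0" and C: "fbounded_op p C" "inj C" and A: "closed_lin_op p DA A"
    and S: "int_C_semigroup p \<alpha> C DA A S"
begin

lemma S_op: "t \<ge> 0 \<Longrightarrow> fbounded_op p (S t)"
  and S_A: "t \<ge> 0 \<Longrightarrow> x \<in> DA \<Longrightarrow> S t x \<in> DA \<and> S t (A x) = A (S t x)"
  using S unfolding int_C_semigroup_def by auto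

lemma S_cont: "fcont_on {0..} (\<lambda>s. S s x)"
  using S unfolding int_C_semigroup_def fcont_on_def by auto

lemma S_int: "t \<ge> 0 \<Longrightarrow> \<exists>I. has_fint p (\<lambda>s. S s x) 0 t I \<and> I \<in> DA \<and> A I = S t x - gfun (\<alpha> + 1) t *\<^sub>R C x"
  using S unfolding int_C_semigroup_def by auto

text \<open>The (\<alpha> + 1)-times integrated semigroup; all its values lie in the domain of
  A.\<close>

definition Sig :: "real \<Rightarrow> 'a \<Rightarrow> 'a" where
  "Sig t x = vconv 1 (\<lambda>s. S s x) t"

lemma Sig_A:
  assumes "t \<ge> 0"
  shows "Sig t x \<in> DA \<and> A (Sig t x) = S t x - gfun (\<alpha> + 1) t *\<^sub>R C x"
proof -
  obtain I where I: "has_fint p (\<lambda>s. S s x) 0 t I" "I \<in> DA" "A I = S t x - gfun (\<alpha> + 1) t *\<^sub>R C x"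
    using S_int[OF assms] by blast
  have "has_fint p (\<lambda>s. S s x) 0 t (Sig t x)"
    using vconv_has_fint[of 1 t "\<lambda>s. S s x", OF _ assms fcont_Icc[OF S_cont]] by (simp add: Sig_def)
  then show ?thesis using has_fint_unique[OF _ I(1)] I by simp
qed

lemma fdual_Sig: "t \<ge> 0 \<Longrightarrow> \<phi> \<in> fdual \<Longrightarrow> \<phi> (Sig t x) = conv 1 (\<lambda>s. \<phi> (S s x)) t"
  unfolding Sig_def by (rule fdual_vconv[OF _ _ fcont_Icc[OF S_cont]]) auto

lemma Sig_cont: "fcont_on {0..} (\<lambda>t. Sig t x)"
  unfolding Sig_def by (rule fcont_vconv[OF _ S_cont]) simp

lemma Sig_0: "Sig 0 x = 0"
  unfolding Sig_def by (rule vconv_0[OF _ fcont_Icc[OF S_cont]]) simp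

lemma Sig_diff:
  assumes "t \<ge> 0"
  shows "Sig t (x - y) = Sig t x - Sig t y"
proof -
  have "Sig t (x - y) = vconv 1 (\<lambda>s. S s x - S s y) t" unfolding Sig_def
    by (rule vconv_cong[OF _ assms fcont_Icc[OF S_cont]])
      (use linear_diff[OF fbounded_op_linear[OF S_op]] in auto)
  also have "\<dots> = Sig t x - Sig t y" unfolding Sig_def
    by (rule vconv_diff[OF _ assms fcont_Icc[OF S_cont] fcont_Icc[OF S_cont]]) simp
  finally show ?thesis .
qed

lemma Sig_scaleR:
  assumes "t \<ge> 0"
  shows "Sig t (c *\<^sub>R x) = c *\<^sub>R Sig t x"
proof -
  have "Sig t (c *\<^sub>R x) = vconv 1 (\<lambda>s. c *\<^sub>R S s x) t" unfolding Sig_def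
    by (rule vconv_cong[OF _ assms fcont_Icc[OF S_cont]])
      (use linear_cmul[OF fbounded_op_linear[OF S_op]] in auto)
  also have "\<dots> = c *\<^sub>R Sig t x" unfolding Sig_def
    by (rule vconv_scaleR[OF _ assms fcont_Icc[OF S_cont]]) simp
  finally show ?thesis .
qed

text \<open>Strong continuity bounds every single orbit on {0..T}; uniform boundedness makes the
  constant independent of the vector.\<close>

lemma S_bound: "\<exists>m c. c \<ge> 0 \<and> (\<forall>t\<in>{0..T}. \<forall>x. p k (S t x) \<le> c * p m x)"
proof (rule uniform_boundedness)
  show "fbounded_op p (S t)" if "t \<in> {0..T}" for t using that by (intro S_op) simp
  show "\<exists>M. \<forall>t\<in>{0..T}. p k (S t x) \<le> M" for x using p_bounded[OF fcont_Icc[OF S_cont]] by blast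
qed

lemma vconv_S_bound:
  assumes \<beta>: "\<beta> > 0"
  shows "\<exists>m c. c \<ge> 0 \<and> (\<forall>t\<in>{0..T}. \<forall>x. p k (vconv \<beta> (\<lambda>s. S s x) t) \<le> c * p m x)"
proof -
  obtain m c where c: "c \<ge> 0" "\<And>t x. t \<in> {0..T} \<Longrightarrow> p k (S t x) \<le> c * p m x" using S_bound by blast
  have "continuous_on {0..T} (gfun (\<beta> + 1))"
    by (rule continuous_on_subset[OF continuous_on_gfun[OF \<beta>]]) auto
  then have "bounded (gfun (\<beta> + 1) ` {0..T})" by (intro compact_imp_bounded compact_continuous_image) auto
  then obtain G where G: "G > 0" "\<forall>x\<in>gfun (\<beta> + 1) ` {0..T}. norm x \<le> G" unfolding bounded_pos by blast
  have "p k (vconv \<beta> (\<lambda>s. S s x) t) \<le> (c * G) * p m x" if t: "t \<in> {0..T}" for t x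
  proof -
    have "p k (vconv \<beta> (\<lambda>s. S s x) t) \<le> (c * p m x) * gfun (\<beta> + 1) t"
      by (rule p_vconv[OF \<beta> _ fcont_Icc[OF S_cont]]) (use t in \<open>auto intro: c\<close>)
    also have "\<dots> \<le> (c * p m x) * G"
    proof (rule mult_left_mono)
      show "gfun (\<beta> + 1) t \<le> G" using bspec[OF G(2) imageI[OF t]] by simp
    qed (use c in simp)
    finally show ?thesis by (simp add: mult_ac)
  qed
  then show ?thesis using c G by (intro exI[of _ m] exI[of _ "c * G"]) auto
qed

text \<open>On the domain, A commutes with every S s, hence by closedness with the integral of S s
  x.\<close>

lemma Sig_commute:
  assumes t: "t \<ge> 0" and x: "x \<in> DA"
  shows "Sig t (A x) = S t x - gfun (\<alpha> + 1) t *\<^sub>R C x"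
proof -
  have eq: "S s (A x) = A (S s x)" if "s \<in> {0..t}" for s using S_A[OF _ x, of s] that by simp
  have c: "fcont_on {0..t} (\<lambda>s. A (S s x))" by (rule fcont_on_cong[OF fcont_Icc[OF S_cont] eq])
  have "A (Sig t x) = vconv 1 (\<lambda>s. A (S s x)) t" unfolding Sig_def
    using closed_vconv[OF A _ t fcont_Icc[OF S_cont] c] S_A[OF _ x] by simp
  also have "\<dots> = Sig t (A x)" unfolding Sig_def
    by (rule vconv_cong[OF _ t c, symmetric, THEN sym]) (use eq in simp_all)
  finally show ?thesis using Sig_A[OF t, of x] by simp
qed

text \<open>At t = 1 the factor g_(\<alpha>+1)(1) = 1/Gamma(\<alpha>+1) is nonzero, so C x is a
  combination of S 1 x and Sig 1 (A x), both in the domain of A.\<close>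

lemma C_A:
  assumes x: "x \<in> DA"
  shows "C x \<in> DA \<and> A (C x) = C (A x)"
proof -
  define g where "g = gfun (\<alpha> + 1) 1"
  have g: "g \<noteq> 0" using less_imp_neq[OF Gamma_real_pos[of "\<alpha> + 1"]] alpha by (simp add: g_def gfun_def)
  have "g *\<^sub>R C x = S 1 x - Sig 1 (A x)" using Sig_commute[OF _ x, of 1] by (simp add: g_def)
  moreover have "S 1 x - Sig 1 (A x) \<in> DA \<and> A (S 1 x - Sig 1 (A x)) = A (S 1 x) - A (Sig 1 (A x))"
    using S_A[OF _ x, of 1] Sig_A[of 1 "A x"] by (intro closed_lin_op_diff[OF A]) auto
  moreover have "A (S 1 x) - A (Sig 1 (A x)) = g *\<^sub>R C (A x)"
    using S_A[OF _ x, of 1] Sig_A[of 1 "A x"] by (simp add: g_def)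
  ultimately have 1: "g *\<^sub>R C x \<in> DA" "A (g *\<^sub>R C x) = g *\<^sub>R C (A x)" by simp_all
  have "C x = (1 / g) *\<^sub>R (g *\<^sub>R C x)" using g by simp
  moreover have "(1 / g) *\<^sub>R (g *\<^sub>R C x) \<in> DA \<and> A ((1 / g) *\<^sub>R (g *\<^sub>R C x)) = (1 / g) *\<^sub>R A (g *\<^sub>R C x)"
    by (rule closed_lin_op_scaleR[OF A 1(1)])
  ultimately show ?thesis using g 1 by simp
qed

text \<open>The integrated form of v' = A v, v(0) = z, which makes sense for z outside the domain of
  A.\<close>

definition mild :: "'a \<Rightarrow> (real \<Rightarrow> 'a) \<Rightarrow> bool" where
  "mild z v \<longleftrightarrow> fcont_on {0..} v \<and> (\<forall>t\<ge>0. vconv 1 v t \<in> DA \<and> A (vconv 1 v t) = v t - z)"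

lemma mild_cont: "mild z v \<Longrightarrow> fcont_on {0..} v"
  by (simp add: mild_def)

text \<open>Integrate the derivative of s to Sig (t - s) (V s) over {0..t}, where V is the primitive of v: it vanishes
  at both ends, and A has disappeared from the derivative.\<close>

lemma mild_identity:
  assumes v: "mild z v" and t: "t \<ge> 0" and \<phi>: "\<phi> \<in> fdual"
  shows "conv 1 (conv 1 (\<lambda>s. \<phi> (S s z))) t = conv (\<alpha> + 1) (conv 1 (\<lambda>s. \<phi> (C (v s)))) t"
proof -
  define V where "V = vconv 1 v"
  have vc: "fcont_on {0..} v" by (rule mild_cont[OF v])
  have Vc: "fcont_on {0..} V" unfolding V_def by (rule fcont_vconv[OF _ vc]) simp
  have V0: "V 0 = 0" unfolding V_def by (rule vconv_0[OF _ fcont_Icc[OF vc]]) simp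
  have VA: "V s \<in> DA" "A (V s) = v s - z" if "s \<ge> 0" for s
    using v that by (simp_all add: mild_def V_def)
  have fV: "\<psi> (V s) = conv 1 (\<lambda>s. \<psi> (v s)) s" if "s \<ge> 0" "\<psi> \<in> fdual" for s \<psi>
    unfolding V_def by (rule fdual_vconv[OF _ that(1) fcont_Icc[OF vc] that(2)]) simp
  define H where "H s = \<phi> (Sig (t - s) (V s))" for s
  define H' where "H' s = \<phi> (Sig (t - s) z) - gfun (\<alpha> + 1) (t - s) * \<phi> (C (V s))" for s
  have deriv: "(H has_real_derivative H' s) (at s within {0..t})" if s: "s \<in> {0..t}" for s
  proof -
    have s0: "s \<ge> 0" "t - s \<ge> 0" using s by auto
    have "Sig (t - s) (A (V s)) = S (t - s) (V s) - gfun (\<alpha> + 1) (t - s) *\<^sub>R C (V s)"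
      by (rule Sig_commute[OF s0(2) VA(1)[OF s0(1)]])
    \<comment> \<open>Here A is eliminated: the mild equation expresses A (V s) as v s - z.\<close>
    then have "Sig (t - s) (v s) - Sig (t - s) z = S (t - s) (V s) - gfun (\<alpha> + 1) (t - s) *\<^sub>R C (V s)"
      using Sig_diff[OF s0(2), of "v s" z] VA(2)[OF s0(1)] by simp
    then have "\<phi> (Sig (t - s) (v s) - Sig (t - s) z) = \<phi> (S (t - s) (V s) - gfun (\<alpha> + 1) (t - s) *\<^sub>R C (V s))"
      by simp
    then have H'_eq: "H' s = - \<phi> (S (t - s) (V s)) + \<phi> (Sig (t - s) (v s))"
      by (simp add: H'_def fdual_simps[OF \<phi>])
    have contS: "continuous_on {0..} (\<lambda>r. \<phi> (S r x))" for x by (rule fcont_on_fdual[OF S_cont \<phi>])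
    \<comment> \<open>The increment of H is split in two: the time argument moves first, with the
      vector V s fixed.\<close>
    have part1: "((\<lambda>y. \<phi> (Sig (t - y) (V s))) has_real_derivative - \<phi> (S (t - s) (V s))) (at s within {0..t})"
    proof -
      define f where "f r = integral {0..r} (\<lambda>q. \<phi> (S q (V s)))" for r
      have "(f has_real_derivative \<phi> (S (t - s) (V s))) (at (t - s) within {0..t})"
        unfolding f_def by (rule integral_has_real_derivative[OF continuous_on_subset[OF contS]]) (use s in auto)
      then have f': "(f has_real_derivative \<phi> (S (t - s) (V s))) (at (t - s) within (\<lambda>y. t - y) ` {0..t})"
        by (simp add: image_diff_atLeastAtMost)
      have "(f \<circ> (\<lambda>y. t - y) has_real_derivative \<phi> (S (t - s) (V s)) * (- 1)) (at s within {0..t})"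
        by (rule DERIV_image_chain[OF f']) (auto intro!: derivative_eq_intros)
      then have d: "(f \<circ> (\<lambda>y. t - y) has_real_derivative - \<phi> (S (t - s) (V s))) (at s within {0..t})" by simp
      have eq: "(f \<circ> (\<lambda>y. t - y)) y = \<phi> (Sig (t - y) (V s))" if "y \<in> {0..t}" for y
        using that fdual_Sig[of "t - y" \<phi> "V s"] \<phi> by (simp add: f_def conv_one)
      show ?thesis
        by (rule has_field_derivative_transform_within[OF d zero_less_one s]) (rule eq)
    qed
    \<comment> \<open>The vector moves while the time argument already stands at t - y. The limit
      combines the bound on \<open>Sig\<close> uniform over {0..t} with continuity of the single
      orbit of v s.\<close>
    have part2: "((\<lambda>y. \<phi> (Sig (t - y) (V y - V s)) / (y - s)) \<longlongrightarrow> \<phi> (Sig (t - s) (v s))) (at s within {0..t})"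
    proof -
      obtain k0 c0 where c0: "\<And>x. \<bar>\<phi> x\<bar> \<le> c0 * p k0 x" using \<phi> unfolding fdual_def by blast
      obtain m c where c: "c \<ge> 0" "\<And>r x. r \<in> {0..t} \<Longrightarrow> p k0 (Sig r x) \<le> c * p m x"
        using vconv_S_bound[of 1 t k0, OF zero_less_one] unfolding Sig_def by blast
      have bd: "\<bar>\<phi> (Sig r x)\<bar> \<le> \<bar>c0\<bar> * c * p m x" if "r \<in> {0..t}" for r x
      proof -
        have "\<bar>\<phi> (Sig r x)\<bar> \<le> c0 * p k0 (Sig r x)" by (rule c0)
        also have "\<dots> \<le> \<bar>c0\<bar> * p k0 (Sig r x)" by (intro mult_right_mono) auto
        also have "\<dots> \<le> \<bar>c0\<bar> * (c * p m x)" using that by (intro mult_left_mono c) auto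
        finally show ?thesis by (simp add: mult_ac)
      qed
      define q where "q y = (1 / (y - s)) *\<^sub>R (V y - V s)" for y
      have q: "ftendsto p q (v s) (at s within {0..t})"
      proof -
        have dq: "ftendsto p (\<lambda>h. (1 / h) *\<^sub>R (V (s + h) - V s)) (v s) (at 0 within {-s..})"
          by (rule difference_quotient[OF vc s0(1)]) (simp add: V0 fV conv_one fdual_simps(4))
        have "filterlim (\<lambda>y. y - s) (at 0 within {-s..}) (at s within {0..t})"
          unfolding filterlim_at
        proof
          have "((\<lambda>y. y - s) \<longlongrightarrow> s - s) (at s within {0..t})" by (intro tendsto_intros)
          then show "((\<lambda>y. y - s) \<longlongrightarrow> 0) (at s within {0..t})" by simp
          show "\<forall>\<^sub>F y in at s within {0..t}. y - s \<in> {- s..} \<and> y - s \<noteq> 0"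
            by (simp add: eventually_at_filter)
        qed
        from ftendsto_compose[OF dq this] show ?thesis by (simp add: q_def[abs_def])
      qed
      have eq: "\<phi> (Sig (t - y) (V y - V s)) / (y - s) = \<phi> (Sig (t - y) (q y))" if "y \<in> {0..t}" for y
      proof -
        have "Sig (t - y) (q y) = (1 / (y - s)) *\<^sub>R Sig (t - y) (V y - V s)"
          unfolding q_def using that by (intro Sig_scaleR) simp
        then show ?thesis by (simp add: fdual_simps[OF \<phi>])
      qed
      have l1: "((\<lambda>y. \<bar>c0\<bar> * c * p m (q y - v s)) \<longlongrightarrow> 0) (at s within {0..t})"
        using tendsto_mult_right_zero[OF ftendstoD[OF q]] by simp
      have l2: "((\<lambda>y. \<phi> (Sig (t - y) (v s))) \<longlongrightarrow> \<phi> (Sig (t - s) (v s))) (at s within {0..t})"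
      proof -
        have "continuous_on {0..t} (\<lambda>y. \<phi> (Sig (t - y) (v s)))"
          by (rule continuous_on_compose2[OF fcont_on_fdual[OF Sig_cont[of "v s"] \<phi>]]) (auto intro!: continuous_intros)
        then show ?thesis using s unfolding continuous_on_def by blast
      qed
      have "((\<lambda>y. \<phi> (Sig (t - y) (V y - V s)) / (y - s) - \<phi> (Sig (t - y) (v s))) \<longlongrightarrow> 0) (at s within {0..t})"
      proof (rule Lim_null_comparison[OF _ l1])
        have "norm (\<phi> (Sig (t - y) (V y - V s)) / (y - s) - \<phi> (Sig (t - y) (v s))) \<le> \<bar>c0\<bar> * c * p m (q y - v s)"
          if y: "y \<in> {0..t}" for y
        proof -
          have "\<phi> (Sig (t - y) (V y - V s)) / (y - s) - \<phi> (Sig (t - y) (v s)) = \<phi> (Sig (t - y) (q y - v s))"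
            unfolding eq[OF y] using Sig_diff[of "t - y" "q y" "v s"] y by (simp add: fdual_simps[OF \<phi>])
          then show ?thesis using bd[of "t - y" "q y - v s"] y by simp
        qed
        then show "\<forall>\<^sub>F y in at s within {0..t}. norm (\<phi> (Sig (t - y) (V y - V s)) / (y - s) - \<phi> (Sig (t - y) (v s)))
          \<le> \<bar>c0\<bar> * c * p m (q y - v s)"
          by (simp add: eventually_at_filter)
      qed
      from tendsto_add[OF this l2] show ?thesis by simp
    qed
    have "((\<lambda>y. (\<phi> (Sig (t - y) (V s)) - \<phi> (Sig (t - s) (V s))) / (y - s) + \<phi> (Sig (t - y) (V y - V s)) / (y - s))
        \<longlongrightarrow> H' s) (at s within {0..t})"
      unfolding H'_eq by (intro tendsto_add part2 part1[unfolded has_field_derivative_iff])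
    moreover have "(\<phi> (Sig (t - y) (V s)) - \<phi> (Sig (t - s) (V s))) / (y - s) + \<phi> (Sig (t - y) (V y - V s)) / (y - s)
        = (H y - H s) / (y - s)" if "y \<in> {0..t}" for y
    proof -
      have "H y - H s = (\<phi> (Sig (t - y) (V s)) - \<phi> (Sig (t - s) (V s))) + \<phi> (Sig (t - y) (V y - V s))"
        using Sig_diff[of "t - y" "V y" "V s"] that by (simp add: H_def fdual_simps[OF \<phi>])
      then show ?thesis by (simp add: add_divide_distrib)
    qed
    then have "\<forall>\<^sub>F y in at s within {0..t}.
        (\<phi> (Sig (t - y) (V s)) - \<phi> (Sig (t - s) (V s))) / (y - s) + \<phi> (Sig (t - y) (V y - V s)) / (y - s)
        = (H y - H s) / (y - s)"
      by (simp add: eventually_at_filter)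
    ultimately show ?thesis
      unfolding has_field_derivative_iff by (rule Lim_transform_eventually)
  qed
  have ftc: "(H' has_integral (H t - H 0)) {0..t}"
    by (rule fundamental_theorem_of_calculus[OF t])
      (use deriv in \<open>simp add: has_real_derivative_iff_has_vector_derivative\<close>)
  have H0: "H t = 0" "H 0 = 0"
  proof -
    show "H t = 0" by (simp add: H_def Sig_0 fdual_simps(4)[OF \<phi>])
    have "Sig t 0 = 0" using Sig_scaleR[OF t, of 0 0] by simp
    then show "H 0 = 0" by (simp add: H_def V0 fdual_simps(4)[OF \<phi>])
  qed
  have cSig: "continuous_on {0..t} (\<lambda>r. \<phi> (Sig r z))"
    by (rule fcont_on_fdual[OF fcont_Icc[OF Sig_cont] \<phi>])
  have i1: "((\<lambda>s. \<phi> (Sig (t - s) z)) has_integral conv 1 (\<lambda>r. \<phi> (Sig r z)) t) {0..t}"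
    using conv_reflect[OF _ t cSig, of 1] by simp
  have "continuous_on {0..t} (\<lambda>r. \<phi> (C (V r)))"
    by (rule fcont_on_fdual[OF fcont_on_op[OF C(1) fcont_Icc[OF Vc]] \<phi>])
  then have i2: "((\<lambda>s. gfun (\<alpha> + 1) (t - s) * \<phi> (C (V s))) has_integral conv (\<alpha> + 1) (\<lambda>r. \<phi> (C (V r))) t) {0..t}"
    using alpha t by (intro conv_has_integral) auto
  have "(H' has_integral (conv 1 (\<lambda>r. \<phi> (Sig r z)) t - conv (\<alpha> + 1) (\<lambda>r. \<phi> (C (V r))) t)) {0..t}"
    unfolding H'_def by (rule has_integral_diff[OF i1 i2])
  from has_integral_unique[OF this ftc] H0
  have "conv 1 (\<lambda>r. \<phi> (Sig r z)) t = conv (\<alpha> + 1) (\<lambda>r. \<phi> (C (V r))) t" by simp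
  moreover have "conv 1 (\<lambda>r. \<phi> (Sig r z)) t = conv 1 (conv 1 (\<lambda>s. \<phi> (S s z))) t"
    by (rule conv_cong) (simp add: fdual_Sig \<phi>)
  moreover have "conv (\<alpha> + 1) (\<lambda>r. \<phi> (C (V r))) t = conv (\<alpha> + 1) (conv 1 (\<lambda>s. \<phi> (C (v s)))) t"
    by (rule conv_cong) (simp add: fV[OF _ fdual_compose[OF C(1) \<phi>]])
  ultimately show ?thesis by simp
qed

section \<open>Mild solutions as derivatives of S_n and the orbit map\<close>

definition ord :: nat where
  "ord = nat \<lceil>\<alpha>\<rceil>"

lemma ord_bounds: "\<alpha> \<le> real ord" "real ord < \<alpha> + 1"
  unfolding ord_def using alpha by linarith+

text \<open>D k is the (n - k)-fold primitive of v, which settles differentiability. For the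
  relation to S_n, the identity of \<open>mild_identity\<close> is integrated to the further order n
  - \<alpha>; both sides then carry two integrations in excess, which are cancelled.\<close>

lemma mild_data_exists:
  assumes v: "mild z v"
  shows "\<exists>D. mild_data p C S \<alpha> z D \<and> D ord = v"
proof -
  define n where "n = ord"
  define D where "D k = (if k = n then v else vconv (real (n - k)) v)" for k
  have vc: "fcont_on {0..} v" by (rule mild_cont[OF v])
  have Dc: "fcont_on {0..} (D k)" if "k \<le> n" for k
  proof (cases "k = n")
    case True then show ?thesis using vc by (simp add: D_def)
  next
    case False
    then have "fcont_on {0..} (vconv (real (n - k)) v)" using that by (intro fcont_vconv vc) simp
    then show ?thesis using False by (simp add: D_def)
  qed
  have fD: "\<phi> (D k t) = conv (real (n - k)) (\<lambda>s. \<phi> (v s)) t" if "k < n" "t \<ge> 0" "\<phi> \<in> fdual" for k t \<phi>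
    using that fdual_vconv[of "real (n - k)" t v \<phi>, OF _ _ fcont_Icc[OF vc]] by (simp add: D_def)
  have D_step: "\<phi> (D k t) = \<phi> (D k 0) + integral {0..t} (\<lambda>s. \<phi> (D (Suc k) s))"
    if "k < n" "t \<ge> 0" "\<phi> \<in> fdual" for k t \<phi>
  proof -
    have "\<phi> (D k t) = conv 1 (\<lambda>s. \<phi> (D (Suc k) s)) t"
    proof (cases "Suc k = n")
      case True then show ?thesis using fD[OF that] by (simp add: D_def flip: True)
    next
      case False
      have "conv 1 (\<lambda>s. \<phi> (D (Suc k) s)) t = conv 1 (conv (real (n - Suc k)) (\<lambda>s. \<phi> (v s))) t"
        by (rule conv_cong) (use that False in \<open>simp add: fD\<close>)
      also have "\<dots> = conv (1 + real (n - Suc k)) (\<lambda>s. \<phi> (v s)) t"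
        using that False by (intro conv_conv fcont_on_fdual[OF fcont_Icc[OF vc]]) auto
      also have "1 + real (n - Suc k) = real (n - k)" using that(1) by simp
      finally show ?thesis using fD[OF that] by simp
    qed
    moreover have "\<phi> (D k 0) = 0" using fD[OF that(1) order_refl that(3)] by (simp add: conv_def)
    ultimately show ?thesis by (simp add: conv_one)
  qed
  have "fCk p n D"
    unfolding fCk_def
  proof (intro conjI allI impI)
    show "ftendsto p (D k) (D k t) (at t within {0..})" if "k \<le> n" "t \<ge> 0" for k t
      using that by (intro fcont_onD[OF Dc]) auto
    show "ftendsto p (\<lambda>h. (1 / h) *\<^sub>R (D k (t + h) - D k t)) (D (Suc k) t) (at 0 within {-t..})"
      if "k < n" "t \<ge> 0" for k t
      by (rule difference_quotient[OF Dc that(2)]) (use that D_step in auto)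
  qed
  moreover have "sbeta p S \<alpha> (real n) t z (C (D 0 t))" if t: "t \<ge> 0" for t
  proof -
    define h k where "h \<phi> s = \<phi> (S s z)" and "k \<phi> s = \<phi> (C (v s))" for \<phi> :: "'a \<Rightarrow> real" and s
    \<comment> \<open>The case n = 0 is separate because \<open>conv\<close> of order 0 is not the
      identity.\<close>
    define K where "K \<phi> = (if n = 0 then k \<phi> else conv (real n) (k \<phi>))" for \<phi> :: "'a \<Rightarrow> real"
    have hc: "continuous_on {0..} (h \<phi>)" and kc: "continuous_on {0..} (k \<phi>)" if "\<phi> \<in> fdual" for \<phi>
      unfolding h_def k_def
      by (rule fcont_on_fdual[OF S_cont that], rule fcont_on_fdual[OF fcont_on_op[OF C(1) vc] that])
    have Kc: "continuous_on {0..} (K \<phi>)" if "\<phi> \<in> fdual" for \<phi>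
      using kc[OF that] continuous_on_conv_atLeast[OF _ kc[OF that], of "real n"] by (simp add: K_def)
    have hI: "continuous_on {0..t} (h \<phi>)" and kI: "continuous_on {0..t} (k \<phi>)" and KI: "continuous_on {0..t} (K \<phi>)"
      if "\<phi> \<in> fdual" for \<phi> t
      using hc[OF that] kc[OF that] Kc[OF that] by (auto elim: continuous_on_subset)
    have fCD: "\<phi> (C (D 0 t)) = K \<phi> t" if "\<phi> \<in> fdual" "t \<ge> 0" for \<phi> t
      using fD[of 0 t, OF _ that(2) fdual_compose[OF C(1) that(1)]] by (cases "n = 0") (simp_all add: D_def K_def k_def[abs_def])
    have K_conv: "conv 1 (conv 1 (K \<phi>)) t = conv (real n + 1) (conv 1 (k \<phi>)) t" if "\<phi> \<in> fdual" "t \<ge> 0" for \<phi> t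
    proof (cases "n = 0")
      case True then show ?thesis by (simp add: K_def)
    next
      case False
      have "conv 1 (conv 1 (K \<phi>)) t = conv (1 + 1) (K \<phi>) t" by (rule conv_conv) (use that KI in auto)
      also have "\<dots> = conv (1 + 1 + real n) (k \<phi>) t"
        unfolding K_def using False that kI by (simp only: if_False, intro conv_conv) auto
      also have "\<dots> = conv (real n + 1) (conv 1 (k \<phi>)) t"
        using that kI conv_conv[of "real n + 1" 1 t "k \<phi>"] by (simp add: add_ac)
      finally show ?thesis .
    qed
    have id: "conv 1 (conv 1 (h \<phi>)) t = conv (\<alpha> + 1) (conv 1 (k \<phi>)) t" if "\<phi> \<in> fdual" "t \<ge> 0" for \<phi> t
      unfolding h_def k_def by (rule mild_identity[OF v that(2,1)])
    have inj2: "a t = b t" if "continuous_on {0..} a" "continuous_on {0..} b"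
      "\<And>t. t \<ge> 0 \<Longrightarrow> conv 1 (conv 1 a) t = conv 1 (conv 1 b) t" "t \<ge> 0" for a b t
      by (rule conv_1_inject[OF that(1,2) conv_1_inject[OF continuous_on_conv_atLeast continuous_on_conv_atLeast]])
        (use that in auto)
    show ?thesis
    proof (cases "real n = \<alpha>")
      case True
      have "S t z = C (D 0 t)"
      proof (rule fdual_eqI)
        fix \<phi> assume \<phi>: "\<phi> \<in> fdual"
        have "h \<phi> t = K \<phi> t"
          by (rule inj2[OF hc[OF \<phi>] Kc[OF \<phi>] _ t]) (simp add: id K_conv \<phi> True)
        then show "\<phi> (S t z) = \<phi> (C (D 0 t))" by (simp add: fCD[OF \<phi> t] h_def)
      qed
      then show ?thesis using True by (simp add: sbeta_def)
    next
      case False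
      define \<beta> where "\<beta> = real n - \<alpha>"
      have \<beta>: "\<beta> > 0" using False ord_bounds by (simp add: \<beta>_def n_def)
      have "vconv \<beta> (\<lambda>s. S s z) t = C (D 0 t)"
      proof (rule vconv_eqI[OF \<beta> t fcont_Icc[OF S_cont]])
        fix \<phi> assume \<phi>: "\<phi> \<in> fdual"
        have "conv \<beta> (h \<phi>) t = K \<phi> t"
        proof (rule inj2[OF continuous_on_conv_atLeast[OF \<beta> hc[OF \<phi>]] Kc[OF \<phi>] _ t])
          fix t :: real assume t: "t \<ge> 0"
          have c1: "continuous_on {0..t} (conv 1 f)" if "continuous_on {0..t} f" for f t
            by (rule continuous_on_conv[OF _ that]) simp
          have "conv 1 (conv 1 (conv \<beta> (h \<phi>))) t = conv (1 + 1) (conv \<beta> (h \<phi>)) t"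
            by (intro conv_conv t continuous_on_conv \<beta> hI \<phi>) auto
          also have "\<dots> = conv (1 + 1 + \<beta>) (h \<phi>) t" by (intro conv_conv t \<beta> hI \<phi>) simp
          also have "\<dots> = conv (\<beta> + 1) (conv 1 (h \<phi>)) t"
            using conv_conv[of "\<beta> + 1" 1 t "h \<phi>"] \<beta> t hI[OF \<phi>] by (simp add: add_ac)
          also have "\<dots> = conv \<beta> (conv 1 (conv 1 (h \<phi>))) t"
            by (rule conv_conv[symmetric]) (use \<beta> t hI[OF \<phi>] c1 in auto)
          also have "\<dots> = conv \<beta> (conv (\<alpha> + 1) (conv 1 (k \<phi>))) t"
            by (rule conv_cong) (simp add: id \<phi>)
          also have "\<dots> = conv (\<beta> + (\<alpha> + 1)) (conv 1 (k \<phi>)) t"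
            by (rule conv_conv) (use \<beta> alpha t kI[OF \<phi>] c1 in auto)
          also have "\<beta> + (\<alpha> + 1) = real n + 1" by (simp add: \<beta>_def)
          also have "conv (real n + 1) (conv 1 (k \<phi>)) t = conv 1 (conv 1 (K \<phi>)) t" using K_conv[OF \<phi> t] by simp
          finally show "conv 1 (conv 1 (conv \<beta> (h \<phi>))) t = conv 1 (conv 1 (K \<phi>)) t" .
        qed
        then show "\<phi> (C (D 0 t)) = conv \<beta> (\<lambda>s. \<phi> (S s z)) t" by (simp add: fCD[OF \<phi> t] h_def[abs_def])
      qed
      then show ?thesis using False vconv_has_fint[OF \<beta> t fcont_Icc[OF S_cont], of z] by (simp add: sbeta_def \<beta>_def)
    qed
  qed
  ultimately have "mild_data p C S \<alpha> z D" unfolding mild_data_def n_def ord_def by simp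
  moreover have "D ord = v" by (simp add: D_def n_def)
  ultimately show ?thesis by blast
qed

lemma sbeta_unique: "sbeta p S \<alpha> \<beta> t x y \<Longrightarrow> sbeta p S \<alpha> \<beta> t x y' \<Longrightarrow> y = y'"
  unfolding sbeta_def by (auto split: if_splits intro: has_fint_unique)

text \<open>D 0 is fixed by injectivity of C and uniqueness of the integral, and each further
  derivative is a limit of difference quotients of the preceding one.\<close>

lemma mild_data_unique:
  assumes D: "mild_data p C S \<alpha> z D" and D': "mild_data p C S \<alpha> z D'" and k: "k \<le> ord" and t: "t \<ge> 0"
  shows "D k t = D' k t"
  using k t
proof (induction k arbitrary: t)
  case 0
  have "C (D 0 t) = C (D' 0 t)"
    using D D' 0 unfolding mild_data_def by (auto intro: sbeta_unique)
  then show ?case using C(2) by (simp add: inj_eq)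
next
  case (Suc k)
  have 1: "ftendsto p (\<lambda>h. (1 / h) *\<^sub>R (D k (t + h) - D k t)) (D (Suc k) t) (at 0 within {-t..})"
    and 2: "ftendsto p (\<lambda>h. (1 / h) *\<^sub>R (D' k (t + h) - D' k t)) (D' (Suc k) t) (at 0 within {-t..})"
    using D D' Suc.prems unfolding mild_data_def fCk_def ord_def by auto
  have "\<forall>\<^sub>F h in at 0 within {-t..}. (1 / h) *\<^sub>R (D k (t + h) - D k t) = (1 / h) *\<^sub>R (D' k (t + h) - D' k t)"
    using Suc.IH[of t] Suc.IH[of "t + _"] Suc.prems by (auto simp: eventually_at_filter)
  from ftendsto_cong_eventually[OF 1 this]
  have "ftendsto p (\<lambda>h. (1 / h) *\<^sub>R (D' k (t + h) - D' k t)) (D (Suc k) t) (at 0 within {-t..})" .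
  moreover have "at 0 within {-t..} \<noteq> bot"
  proof -
    have "at_right 0 \<le> at 0 within {-t..}" using Suc.prems by (intro at_le) auto
    then show ?thesis using trivial_limit_at_right_real[of 0] by (metis bot.extremum_uniqueI)
  qed
  ultimately show ?case using 2 by (intro ftendsto_unique)
qed

text \<open>Uniqueness of the data lets the definite description in \<open>Gop\<close> be evaluated
  on the family built from v, whose top derivative is v.\<close>

theorem mild_Gop:
  assumes v: "mild z v"
  shows "z \<in> Z1 p C S \<alpha>" and "t \<ge> 0 \<Longrightarrow> Gop p C S \<alpha> t z = v t"
proof -
  obtain D where D: "mild_data p C S \<alpha> z D" "D ord = v" using mild_data_exists[OF v] by blast
  then show "z \<in> Z1 p C S \<alpha>" unfolding Z1_def by blast
  assume t: "t \<ge> 0"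
  show "Gop p C S \<alpha> t z = v t"
    unfolding Gop_def
  proof (rule the_equality)
    show "\<exists>D. mild_data p C S \<alpha> z D \<and> v t = D (nat \<lceil>\<alpha>\<rceil>) t"
      using D by (intro exI[of _ D]) (simp add: ord_def)
    fix y assume "\<exists>D. mild_data p C S \<alpha> z D \<and> y = D (nat \<lceil>\<alpha>\<rceil>) t"
    then obtain D' where "mild_data p C S \<alpha> z D'" "y = D' ord t" unfolding ord_def by blast
    then show "y = v t" using mild_data_unique[OF D(1) _ order_refl t] D(2) by simp
  qed
qed

lemma mild_diff:
  assumes "mild z v" "mild z' v'"
  shows "mild (z - z') (\<lambda>t. v t - v' t)"
  unfolding mild_def
proof (intro conjI allI impI)
  note c = mild_cont[OF assms(1)] mild_cont[OF assms(2)]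
  show "fcont_on {0..} (\<lambda>t. v t - v' t)" by (rule fcont_on_diff[OF c])
  fix t :: real assume t: "t \<ge> 0"
  have eq: "vconv 1 (\<lambda>t. v t - v' t) t = vconv 1 v t - vconv 1 v' t"
    by (rule vconv_diff[OF _ t fcont_Icc[OF c(1)] fcont_Icc[OF c(2)]]) simp
  have "vconv 1 v t - vconv 1 v' t \<in> DA \<and> A (vconv 1 v t - vconv 1 v' t) = A (vconv 1 v t) - A (vconv 1 v' t)"
    using assms t by (intro closed_lin_op_diff[OF A]) (auto simp: mild_def)
  then show "vconv 1 (\<lambda>t. v t - v' t) t \<in> DA" "A (vconv 1 (\<lambda>t. v t - v' t) t) = v t - v' t - (z - z')"
    using assms t unfolding eq by (auto simp: mild_def)
qed

lemma mild_scaleR: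
  assumes "mild z v"
  shows "mild (c *\<^sub>R z) (\<lambda>t. c *\<^sub>R v t)"
  unfolding mild_def
proof (intro conjI allI impI)
  note vc = mild_cont[OF assms]
  show "fcont_on {0..} (\<lambda>t. c *\<^sub>R v t)" by (rule fcont_on_scaleR[OF continuous_on_const vc])
  fix t :: real assume t: "t \<ge> 0"
  have eq: "vconv 1 (\<lambda>t. c *\<^sub>R v t) t = c *\<^sub>R vconv 1 v t"
    by (rule vconv_scaleR[OF _ t fcont_Icc[OF vc]]) simp
  have "c *\<^sub>R vconv 1 v t \<in> DA \<and> A (c *\<^sub>R vconv 1 v t) = c *\<^sub>R A (vconv 1 v t)"
    using assms t by (intro closed_lin_op_scaleR[OF A]) (auto simp: mild_def)
  then show "vconv 1 (\<lambda>t. c *\<^sub>R v t) t \<in> DA" "A (vconv 1 (\<lambda>t. c *\<^sub>R v t) t) = c *\<^sub>R v t - c *\<^sub>R z"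
    using assms t unfolding eq by (auto simp: mild_def scaleR_diff_right)
qed

text \<open>The primitive of the shifted curve is V (t + s) - V s, with V the primitive of v, so the
  equations at t + s and s are subtracted. This is where invariance of orbits under the operators
  comes from.\<close>

lemma mild_shift:
  assumes v: "mild z v" and s: "s \<ge> 0"
  shows "mild (v s) (\<lambda>t. v (t + s))"
  unfolding mild_def
proof (intro conjI allI impI)
  note vc = mild_cont[OF v]
  show sc: "fcont_on {0..} (\<lambda>t. v (t + s))" by (rule fcont_on_shift[OF vc s])
  fix t :: real assume t: "t \<ge> 0"
  have eq: "vconv 1 (\<lambda>t. v (t + s)) t = vconv 1 v (t + s) - vconv 1 v s"
  proof (rule vconv_eqI[OF _ t fcont_Icc[OF sc]])
    fix \<phi> assume \<phi>: "\<phi> \<in> fdual"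
    have ci: "(\<lambda>r. \<phi> (v r)) integrable_on {0..t + s}"
      by (rule integrable_continuous_interval[OF fcont_on_fdual[OF fcont_Icc[OF vc] \<phi>]])
    have "integral {0..t} (\<lambda>r. \<phi> (v (r + s))) = integral {s..t + s} (\<lambda>r. \<phi> (v r))"
      using integral_shift_Icc_real[of 0 t "\<lambda>r. \<phi> (v r)" s] by (simp add: o_def add.commute)
    also have "\<dots> = integral {0..t + s} (\<lambda>r. \<phi> (v r)) - integral {0..s} (\<lambda>r. \<phi> (v r))"
      using Henstock_Kurzweil_Integration.integral_combine[of 0 s "t + s", OF s _ ci] t by simp
    finally show "\<phi> (vconv 1 v (t + s) - vconv 1 v s) = conv 1 (\<lambda>r. \<phi> (v (r + s))) t"
      using t s by (simp add: conv_one fdual_simps[OF \<phi>] fdual_vconv[OF _ _ fcont_Icc[OF vc] \<phi>])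
  qed simp
  have "vconv 1 v (t + s) - vconv 1 v s \<in> DA
      \<and> A (vconv 1 v (t + s) - vconv 1 v s) = A (vconv 1 v (t + s)) - A (vconv 1 v s)"
    using v t s by (intro closed_lin_op_diff[OF A]) (auto simp: mild_def)
  then show "vconv 1 (\<lambda>t. v (t + s)) t \<in> DA" "A (vconv 1 (\<lambda>t. v (t + s)) t) = v (t + s) - v s"
    using v t s unfolding eq by (auto simp: mild_def)
qed

section \<open>Explicit mild solutions on the image under C of the domain of a power of A\<close>

definition Sn :: "real \<Rightarrow> 'a \<Rightarrow> 'a" where
  "Sn t w = (if real ord = \<alpha> then S t w else vconv (real ord - \<alpha>) (\<lambda>s. S s w) t)"

lemma Sn_cont: "fcont_on {0..} (\<lambda>t. Sn t w)"
proof (cases "real ord = \<alpha>")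
  case True then show ?thesis using S_cont by (simp add: Sn_def)
next
  case False
  then have "real ord - \<alpha> > 0" using ord_bounds by simp
  from fcont_vconv[OF this S_cont] show ?thesis using False by (simp add: Sn_def)
qed

lemma Sn_bound: "\<exists>m c. c \<ge> 0 \<and> (\<forall>t\<in>{0..T}. \<forall>x. p k (Sn t x) \<le> c * p m x)"
proof (cases "real ord = \<alpha>")
  case True then show ?thesis using S_bound by (simp add: Sn_def)
next
  case False
  then have "real ord - \<alpha> > 0" using ord_bounds by simp
  from vconv_S_bound[OF this] show ?thesis using False by (simp add: Sn_def)
qed

text \<open>Makes S_n an n-times integrated C-semigroup: the equation for \<open>Sig\<close> is
  integrated to order n - \<alpha>. A passes through by closedness, the orders of integration
  commute, and the inhomogeneity becomes g_(n+1).\<close>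

lemma Sn_A:
  assumes t: "t \<ge> 0"
  shows "vconv 1 (\<lambda>s. Sn s w) t \<in> DA \<and> A (vconv 1 (\<lambda>s. Sn s w) t) = Sn t w - gfun (real ord + 1) t *\<^sub>R C w"
proof (cases "real ord = \<alpha>")
  case True then show ?thesis using Sig_A[OF t, of w] by (simp add: Sn_def Sig_def)
next
  case False
  define \<beta> where "\<beta> = real ord - \<alpha>"
  have \<beta>: "\<beta> > 0" using False ord_bounds by (simp add: \<beta>_def)
  have Sn: "Sn s w = vconv \<beta> (\<lambda>s. S s w) s" for s using False by (simp add: Sn_def \<beta>_def)
  define Q where "Q s = S s w - gfun (\<alpha> + 1) s *\<^sub>R C w" for s
  have gc: "continuous_on {0..} (gfun (\<alpha> + 1))"
    using continuous_on_gfun[of \<alpha>] alpha by (cases "\<alpha> = 0") (simp_all add: gfun_1[abs_def])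
  have Rc: "fcont_on {0..} (\<lambda>s. gfun (\<alpha> + 1) s *\<^sub>R C w)" by (rule fcont_on_scaleR[OF gc fcont_on_const])
  have Qc: "fcont_on {0..} Q" unfolding Q_def by (rule fcont_on_diff[OF S_cont Rc])
  have ASig: "Sig s w \<in> DA" "A (Sig s w) = Q s" if "s \<in> {0..t}" for s using Sig_A[of s w] that by (simp_all add: Q_def)
  have AQ: "fcont_on {0..t} (\<lambda>s. A (Sig s w))"
    by (rule fcont_on_cong[OF fcont_Icc[OF Qc]]) (simp add: ASig)
  have 1: "vconv \<beta> (\<lambda>s. Sig s w) t \<in> DA \<and> A (vconv \<beta> (\<lambda>s. Sig s w) t) = vconv \<beta> (\<lambda>s. A (Sig s w)) t"
    by (rule closed_vconv[OF A \<beta> t fcont_Icc[OF Sig_cont] AQ ASig(1)])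
  have 2: "vconv \<beta> (\<lambda>s. A (Sig s w)) t = vconv \<beta> Q t"
    by (rule vconv_cong[OF \<beta> t AQ]) (simp add: ASig)
  have 3: "vconv \<beta> Q t = Sn t w - vconv \<beta> (\<lambda>s. gfun (\<alpha> + 1) s *\<^sub>R C w) t"
    unfolding Q_def Sn by (rule vconv_diff[OF \<beta> t fcont_Icc[OF S_cont] fcont_Icc[OF Rc]])
  have 4: "vconv \<beta> (\<lambda>s. gfun (\<alpha> + 1) s *\<^sub>R C w) t = gfun (real ord + 1) t *\<^sub>R C w"
  proof (rule vconv_eqI[OF \<beta> t fcont_Icc[OF Rc]])
    fix \<phi> assume \<phi>: "\<phi> \<in> fdual"
    have "conv \<beta> (\<lambda>s. \<phi> (gfun (\<alpha> + 1) s *\<^sub>R C w)) t = conv \<beta> (\<lambda>s. \<phi> (C w) * gfun (\<alpha> + 1) s) t"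
      by (simp add: fdual_simps[OF \<phi>] mult.commute)
    also have "\<dots> = \<phi> (C w) * gfun (\<beta> + \<alpha> + 1) t"
      using conv_gfun[OF \<beta> alpha t] by (simp add: conv_cmult)
    finally show "\<phi> (gfun (real ord + 1) t *\<^sub>R C w) = conv \<beta> (\<lambda>s. \<phi> (gfun (\<alpha> + 1) s *\<^sub>R C w)) t"
      by (simp add: fdual_simps[OF \<phi>] \<beta>_def mult.commute)
  qed
  have 5: "vconv 1 (\<lambda>s. Sn s w) t = vconv \<beta> (\<lambda>s. Sig s w) t"
  proof (rule vconv_eqI[OF _ t fcont_Icc[OF Sn_cont]])
    fix \<phi> assume \<phi>: "\<phi> \<in> fdual"
    have hI: "continuous_on {0..t} (\<lambda>s. \<phi> (S s w))" by (rule fcont_on_fdual[OF fcont_Icc[OF S_cont] \<phi>])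
    have "conv 1 (\<lambda>s. \<phi> (Sn s w)) t = conv 1 (conv \<beta> (\<lambda>s. \<phi> (S s w))) t"
      unfolding Sn by (rule conv_cong) (simp add: fdual_vconv[OF \<beta> _ fcont_Icc[OF S_cont] \<phi>])
    also have "\<dots> = conv (1 + \<beta>) (\<lambda>s. \<phi> (S s w)) t" by (rule conv_conv[OF _ \<beta> t hI]) simp
    also have "\<dots> = conv (\<beta> + 1) (\<lambda>s. \<phi> (S s w)) t" by (simp add: add.commute)
    also have "\<dots> = conv \<beta> (conv 1 (\<lambda>s. \<phi> (S s w))) t" by (rule conv_conv[OF \<beta> _ t hI, symmetric]) simp
    also have "\<dots> = conv \<beta> (\<lambda>s. \<phi> (Sig s w)) t" by (rule conv_cong) (simp add: fdual_Sig \<phi>)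
    finally show "\<phi> (vconv \<beta> (\<lambda>s. Sig s w) t) = conv 1 (\<lambda>s. \<phi> (Sn s w)) t"
      by (simp add: fdual_vconv[OF \<beta> t fcont_Icc[OF Sig_cont] \<phi>])
  qed simp
  show ?thesis using 1 unfolding 5 2 3 4 .
qed

text \<open>The n-th derivative of S_n(t) y for y in the domain of the n-th power of A.\<close>

definition usol :: "'a \<Rightarrow> real \<Rightarrow> 'a" where
  "usol y t = (\<Sum>i<ord. gfun (real i + 1) t *\<^sub>R C ((A ^^ i) y)) + Sn t ((A ^^ ord) y)"

text \<open>A telescoping sum: since A commutes with C, applying A to the integrated i-th summand
  gives the summand i + 1 of \<open>usol\<close>. Only C y is missing at the lower end, while the
  surplus at i = n cancels the inhomogeneity in \<open>Sn_A\<close>.\<close>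

theorem mild_usol:
  assumes y: "y \<in> dom_pow DA A ord"
  shows "mild (C y) (usol y)"
proof -
  define w where "w = (A ^^ ord) y"
  define e where "e i = C ((A ^^ i) y)" for i
  have gc: "continuous_on {0..} (gfun (real i + 1))" for i
    using continuous_on_gfun[of "real i"] by (cases "i = 0") (simp_all add: gfun_1[abs_def])
  have ec: "fcont_on {0..} (\<lambda>t. gfun (real i + 1) t *\<^sub>R e i)" for i
    by (rule fcont_on_scaleR[OF gc fcont_on_const])
  have uc: "fcont_on {0..} (usol y)"
    unfolding usol_def[abs_def] e_def[symmetric] w_def[symmetric]
    by (rule fcont_on_add[OF fcont_on_sum[OF ec] Sn_cont])
  have e_A: "e i \<in> DA \<and> A (e i) = e (Suc i)" if "i < ord" for i
    using C_A[of "(A ^^ i) y"] y that by (simp add: dom_pow_def e_def)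
  have "vconv 1 (usol y) t \<in> DA \<and> A (vconv 1 (usol y) t) = usol y t - C y" if t: "t \<ge> 0" for t
  proof -
    have int: "vconv 1 (usol y) t = (\<Sum>i<ord. gfun (real i + 2) t *\<^sub>R e i) + vconv 1 (\<lambda>s. Sn s w) t"
    proof (rule vconv_eqI[OF _ t fcont_Icc[OF uc]])
      fix \<phi> assume \<phi>: "\<phi> \<in> fdual"
      have gi: "((\<lambda>s. gfun (real i + 1) s * \<phi> (e i)) has_integral gfun (real i + 2) t * \<phi> (e i)) {0..t}" for i
      proof -
        have "continuous_on {0..t} (gfun (real i + 1))" by (rule continuous_on_subset[OF gc]) auto
        then have "(gfun (real i + 1) has_integral conv 1 (gfun (real i + 1)) t) {0..t}"
          using conv_has_integral[of 1 t "gfun (real i + 1)"] t by simp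
        moreover have "conv 1 (gfun (real i + 1)) t = gfun (real i + 2) t"
          using conv_gfun[of 1 "real i" t] t by (simp add: add_ac)
        ultimately show ?thesis by (intro has_integral_mult_left) simp
      qed
      have Si: "((\<lambda>s. \<phi> (Sn s w)) has_integral conv 1 (\<lambda>s. \<phi> (Sn s w)) t) {0..t}"
        using conv_has_integral[OF _ t fcont_on_fdual[OF fcont_Icc[OF Sn_cont] \<phi>], of 1 w] by simp
      have "((\<lambda>s. (\<Sum>i<ord. gfun (real i + 1) s * \<phi> (e i)) + \<phi> (Sn s w)) has_integral
          ((\<Sum>i<ord. gfun (real i + 2) t * \<phi> (e i)) + conv 1 (\<lambda>s. \<phi> (Sn s w)) t)) {0..t}"
        by (intro has_integral_add has_integral_sum gi Si finite_lessThan)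
      from integral_unique[OF this]
      show "\<phi> ((\<Sum>i<ord. gfun (real i + 2) t *\<^sub>R e i) + vconv 1 (\<lambda>s. Sn s w) t) = conv 1 (\<lambda>s. \<phi> (usol y s)) t"
        by (simp add: conv_one usol_def fdual_simps[OF \<phi>] fdual_vconv[OF _ t fcont_Icc[OF Sn_cont] \<phi>]
            flip: e_def w_def)
    qed simp
    have s1: "gfun (real i + 2) t *\<^sub>R e i \<in> DA" "A (gfun (real i + 2) t *\<^sub>R e i) = gfun (real i + 2) t *\<^sub>R e (Suc i)"
      if "i < ord" for i using closed_lin_op_scaleR[OF A, of "e i"] e_A[OF that] by simp_all
    have s2: "(\<Sum>i<ord. gfun (real i + 2) t *\<^sub>R e i) \<in> DA
      \<and> A (\<Sum>i<ord. gfun (real i + 2) t *\<^sub>R e i) = (\<Sum>i<ord. A (gfun (real i + 2) t *\<^sub>R e i))"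
      using s1 by (intro closed_lin_op_sum[OF A]) simp
    have "(\<Sum>i<ord. A (gfun (real i + 2) t *\<^sub>R e i)) = (\<Sum>i<ord. gfun (real (Suc i) + 1) t *\<^sub>R e (Suc i))"
      using s1(2) by (intro sum.cong) (simp_all add: add_ac)
    \<comment> \<open>The index shift omits the summand i = 0, whose coefficient
      \<open>gfun 1\<close> is 1, and adds the summand i = \<open>ord\<close>.\<close>
    also have "\<dots> = (\<Sum>i<Suc ord. gfun (real i + 1) t *\<^sub>R e i) - e 0"
      by (subst sum.lessThan_Suc_shift) simp
    also have "\<dots> = (\<Sum>i<ord. gfun (real i + 1) t *\<^sub>R e i) + gfun (real ord + 1) t *\<^sub>R e ord - e 0" by simp
    finally have s3: "(\<Sum>i<ord. A (gfun (real i + 2) t *\<^sub>R e i))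
      = (\<Sum>i<ord. gfun (real i + 1) t *\<^sub>R e i) + gfun (real ord + 1) t *\<^sub>R e ord - e 0" .
    have "e ord = C w" "e 0 = C y" by (simp_all add: e_def w_def)
    then show ?thesis
      using closed_lin_op_add[OF A conjunct1[OF s2] conjunct1[OF Sn_A[OF t, of w]]] s2 Sn_A[OF t, of w]
      unfolding int s3 by (simp add: usol_def flip: e_def w_def)
  qed
  then show ?thesis using uc by (simp add: mild_def)
qed

text \<open>The sum on the right is the seminorm of C y in [C(D(A^n))], which is the quantity that
  the continuous embedding controls.\<close>

lemma usol_bound:
  "\<exists>m c. c \<ge> 0 \<and> (\<forall>t\<in>{0..T}. \<forall>y. p k (usol y t) \<le> c * (\<Sum>i\<le>ord. p m ((A ^^ i) y)))"
proof -
  obtain m1 c1 where c1: "c1 \<ge> 0" "\<And>x. p k (C x) \<le> c1 * p m1 x" using fbounded_op_bound[OF C(1)] by blast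
  obtain m2 c2 where c2: "c2 \<ge> 0" "\<And>t x. t \<in> {0..T} \<Longrightarrow> p k (Sn t x) \<le> c2 * p m2 x" using Sn_bound by blast
  \<comment> \<open>Bounds t^i / i! for t \<le> T and i < n; the maximum with 1 makes the powers
    increase with the exponent.\<close>
  define G where "G = (max 1 T) ^ ord"
  define m where "m = max m1 m2"
  define c where "c = max (G * c1) c2"
  have G: "0 \<le> gfun (real i + 1) t \<and> gfun (real i + 1) t \<le> G" if "t \<in> {0..T}" "i < ord" for t i
  proof -
    have "gfun (real i + 1) t = t ^ i / fact i" using that by (intro gfun_nat) simp
    also have "\<dots> \<le> t ^ i / 1" using that by (intro divide_left_mono) (auto simp: fact_ge_1)
    also have "\<dots> \<le> (max 1 T) ^ i" using that by (auto intro!: power_mono)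
    also have "\<dots> \<le> G" unfolding G_def using that by (intro power_increasing) auto
    finally show ?thesis using gfun_nonneg[of "real i + 1" t] by simp
  qed
  have G0: "G \<ge> 0" by (simp add: G_def)
  have "p k (usol y t) \<le> c * (\<Sum>i\<le>ord. p m ((A ^^ i) y))" if t: "t \<in> {0..T}" for t y
  proof -
    have summand: "p k (gfun (real i + 1) t *\<^sub>R C ((A ^^ i) y)) \<le> c * p m ((A ^^ i) y)" if "i < ord" for i
    proof -
      have "p k (gfun (real i + 1) t *\<^sub>R C ((A ^^ i) y)) = gfun (real i + 1) t * p k (C ((A ^^ i) y))"
        using G[OF t that] by (simp add: p_scaleR)
      also have "\<dots> \<le> G * (c1 * p m1 ((A ^^ i) y))"
        using G[OF t that] c1(2) by (intro mult_mono) auto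
      also have "\<dots> \<le> G * (c1 * p m ((A ^^ i) y))"
        using G0 c1(1) by (intro mult_left_mono p_mono) (auto simp: m_def)
      also have "\<dots> \<le> c * p m ((A ^^ i) y)" unfolding mult.assoc[symmetric] by (intro mult_right_mono) (auto simp: c_def)
      finally show ?thesis .
    qed
    have "p k (Sn t ((A ^^ ord) y)) \<le> c2 * p m2 ((A ^^ ord) y)" by (rule c2(2)[OF t])
    also have "\<dots> \<le> c * p m ((A ^^ ord) y)"
      using c2(1) G0 c1(1) by (intro mult_mono p_mono) (auto simp: m_def c_def)
    finally have last: "p k (Sn t ((A ^^ ord) y)) \<le> c * p m ((A ^^ ord) y)" .
    have "p k (usol y t) \<le> (\<Sum>i<ord. p k (gfun (real i + 1) t *\<^sub>R C ((A ^^ i) y))) + p k (Sn t ((A ^^ ord) y))"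
      unfolding usol_def by (rule order_trans[OF p_triangle add_right_mono[OF p_sum]])
    also have "\<dots> \<le> (\<Sum>i<ord. c * p m ((A ^^ i) y)) + c * p m ((A ^^ ord) y)"
      using summand last by (intro add_mono sum_mono) auto
    also have "\<dots> = c * (\<Sum>i<Suc ord. p m ((A ^^ i) y))" by (simp add: sum_distrib_left distrib_left)
    also have "{..<Suc ord} = {..ord}" by auto
    finally show ?thesis .
  qed
  moreover have "c \<ge> 0" using c2(1) by (simp add: c_def)
  ultimately show ?thesis by blast
qed

end

section \<open>Upper density\<close>

lemma Limsup_ereal_eq_1:
  fixes f :: "'b \<Rightarrow> real"
  assumes F: "F \<noteq> bot" and le: "\<forall>\<^sub>F x in F. f x \<le> 1"
    and freq: "\<And>e. e > 0 \<Longrightarrow> \<exists>\<^sub>F x in F. f x > 1 - e"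
  shows "Limsup F (\<lambda>x. ereal (f x)) = 1"
proof (rule antisym)
  show "Limsup F (\<lambda>x. ereal (f x)) \<le> 1"
    by (rule Limsup_bounded) (use le in \<open>auto elim: eventually_mono\<close>)
  show "1 \<le> Limsup F (\<lambda>x. ereal (f x))"
  proof (rule ccontr)
    assume "\<not> 1 \<le> Limsup F (\<lambda>x. ereal (f x))"
    then obtain y where y: "Limsup F (\<lambda>x. ereal (f x)) < y" "y < 1" using dense[of _ "1::ereal"] by (auto simp: not_le)
    have "\<exists>\<^sub>F x in F. y < ereal (f x)"
    proof (cases y)
      case (real r)
      then have "1 - r > 0" using y by (simp add: one_ereal_def)
      from freq[OF this] show ?thesis by (rule frequently_elim1) (simp add: real)
    next
      case PInf then show ?thesis using y by simp
    next
      case MInf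
      from freq[OF zero_less_one] show ?thesis by (rule frequently_elim1) (simp add: MInf)
    qed
    moreover have "\<forall>\<^sub>F x in F. ereal (f x) < y" using y(1) by (rule Limsup_lessD)
    then have "\<forall>\<^sub>F x in F. \<not> y < ereal (f x)" by eventually_elim auto
    ultimately show False by (simp add: frequently_def)
  qed
qed

text \<open>A block contained in D fills the fraction i/(i+1) of {0..(i+1) a i}. Since a i \<ge> i,
  such end points are arbitrarily late.\<close>

lemma updens_real_eq_1:
  assumes meas: "\<And>t. D \<inter> {0..t} \<in> sets lebesgue"
    and a: "\<And>i. a i > 0" "\<And>i::nat. real i \<le> a i"
    and blocks: "\<And>K::nat. \<exists>i\<ge>K. {a i..real (Suc i) * a i} \<subseteq> D"
  shows "updens_real D = 1"
  unfolding updens_real_def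
proof (rule Limsup_ereal_eq_1)
  have le: "measure lebesgue (D \<inter> {0..t}) \<le> t" if "t \<ge> 0" for t
    using measure_mono_fmeasurable[OF _ meas[of t], of "{0..t}"] that by simp
  show "\<forall>\<^sub>F t in at_top. measure lebesgue (D \<inter> {0..t}) / t \<le> 1"
    using eventually_gt_at_top[of 0] by eventually_elim (use le in \<open>simp add: field_simps\<close>)
  fix e :: real assume e: "e > 0"
  have "\<exists>t\<ge>N. 1 - e < measure lebesgue (D \<inter> {0..t}) / t" for N
  proof -
    obtain K1 :: nat where K1: "N \<le> real K1" using real_arch_simple by blast
    obtain K2 :: nat where K2: "1 / e < real K2" using reals_Archimedean2 by blast
    obtain i where i: "i \<ge> max K1 K2" "{a i..real (Suc i) * a i} \<subseteq> D" using blocks by blast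
    define b where "b = real (Suc i) * a i"
    have ab: "a i \<le> b" "b > 0" using a(1)[of i] by (simp_all add: b_def)
    have "b \<ge> N" using K1 i(1) a(2)[of i] ab by simp
    moreover have "1 - e < measure lebesgue (D \<inter> {0..b}) / b"
    proof -
      have "D \<inter> {0..b} \<in> fmeasurable lebesgue"
        by (rule fmeasurableI2[OF lmeasurable_interval(1)[of 0 b] _ meas]) auto
      then have "measure lebesgue {a i..b} \<le> measure lebesgue (D \<inter> {0..b})"
        using i(2) a(1)[of i] by (intro measure_mono_fmeasurable) (auto simp: b_def)
      then have "b - a i \<le> measure lebesgue (D \<inter> {0..b})" using ab by simp
      then have "(b - a i) / b \<le> measure lebesgue (D \<inter> {0..b}) / b" using ab by (intro divide_right_mono) auto
      moreover have "(b - a i) / b = 1 - 1 / real (Suc i)"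
        using a(1)[of i] by (simp add: b_def diff_divide_distrib del: of_nat_Suc)
      moreover have "1 / real (Suc i) < e"
      proof -
        have "1 / e < real (Suc i)" using K2 i(1) by simp
        then show ?thesis using e by (simp add: field_simps)
      qed
      ultimately show ?thesis by linarith
    qed
    ultimately show ?thesis by blast
  qed
  then show "\<exists>\<^sub>F t in at_top. 1 - e < measure lebesgue (D \<inter> {0..t}) / t"
    unfolding frequently_def eventually_at_top_linorder by blast
qed simp

text \<open>The factors c and c' allow for sampling with several step lengths at once. They shorten
  the block by a fixed ratio only, whereas the ratio of its end points grows with i.\<close>

lemma updens_nat_eq_1:
  assumes a: "\<And>i. a i > 0" "\<And>i::nat. real i \<le> a i" and c: "c > 0" "c' > 0"
    and blocks: "\<And>K::nat. \<exists>i\<ge>K. {k. k \<ge> 1 \<and> c * a i \<le> real k \<and> real k \<le> c' * (real (Suc i) * a i)} \<subseteq> D"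
  shows "updens_nat D = 1"
  unfolding updens_nat_def
proof (rule Limsup_ereal_eq_1)
  have le: "card (D \<inter> {1..n}) \<le> n" for n
    using card_mono[of "{1..n}" "D \<inter> {1..n}"] by simp
  show "\<forall>\<^sub>F n in sequentially. real (card (D \<inter> {1..n})) / real n \<le> 1"
    using eventually_gt_at_top[of 0] by eventually_elim (use le in \<open>simp add: field_simps\<close>)
  fix e :: real assume e: "e > 0"
  have "\<exists>n\<ge>N. 1 - e < real (card (D \<inter> {1..n})) / real n" for N :: nat
  proof -
    obtain K1 :: nat where K1: "(real N + 1) / c' < real K1" using reals_Archimedean2 by blast
    \<comment> \<open>Makes (e + c) a i smaller than e x; the part e a i pays for rounding x down to
      n.\<close>
    obtain K2 :: nat where K2: "(e + c + 1) / (e * c') < real K2" using reals_Archimedean2 by blast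
    obtain i where i: "i \<ge> max 1 (max K1 K2)"
      "{k. k \<ge> 1 \<and> c * a i \<le> real k \<and> real k \<le> c' * (real (Suc i) * a i)} \<subseteq> D" using blocks by blast
    define x where "x = c' * (real (Suc i) * a i)"
    define n where "n = nat \<lfloor>x\<rfloor>"
    define L where "L = nat \<lceil>c * a i\<rceil>"
    have ai: "a i \<ge> 1" using a(2)[of i] i(1) by simp
    have x: "x \<ge> c' * real (Suc i)" using ai c by (simp add: x_def del: of_nat_Suc)
    have "real N + 1 < c' * real (Suc i)"
    proof -
      have "(real N + 1) / c' < real (Suc i)" using K1 i(1) by simp
      then show ?thesis using c by (simp add: field_simps)
    qed
    then have xN: "x > real N + 1" using x by linarith
    then have nx: "real n \<le> x" "x < real n + 1" unfolding n_def by linarith+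
    then have nN: "n \<ge> N" "n > 0" using xN by linarith+
    have Lc: "c * a i \<le> real L" "real L < c * a i + 1" "L \<ge> 1"
    proof -
      have "c * a i > 0" using c a by simp
      then show "c * a i \<le> real L" "real L < c * a i + 1" "L \<ge> 1" unfolding L_def by linarith+
    qed
    have sub: "{L..n} \<subseteq> D \<inter> {1..n}"
    proof
      fix k assume k: "k \<in> {L..n}"
      then have "real L \<le> real k" "real k \<le> real n" by auto
      then have "k \<ge> 1" "c * a i \<le> real k" "real k \<le> c' * (real (Suc i) * a i)"
        using k Lc nx unfolding x_def by linarith+
      then have "k \<in> {k. k \<ge> 1 \<and> c * a i \<le> real k \<and> real k \<le> c' * (real (Suc i) * a i)}" by blast
      then show "k \<in> D \<inter> {1..n}" using i(2) k Lc by auto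
    qed
    have "Suc n - L \<le> card (D \<inter> {1..n})" using card_mono[OF _ sub] by simp
    then have cn: "real n - c * a i \<le> real (card (D \<inter> {1..n}))" using Lc(2) by linarith
    have "c * a i < e * real n"
    proof -
      have "(e + c + 1) / (e * c') < real (Suc i)" using K2 i(1) by simp
      then have "e + c < e * c' * real (Suc i)" using e c by (simp add: field_simps)
      then have "(e + c) * a i < (e * c' * real (Suc i)) * a i" using ai by (intro mult_strict_right_mono) auto
      also have "\<dots> = e * x" by (simp add: x_def)
      finally have "e * a i + c * a i < e * x" by (simp add: distrib_right)
      moreover have "e * 1 \<le> e * a i" using e ai by (intro mult_left_mono) auto
      moreover have "e * x < e * (real n + 1)" using e nx by (intro mult_strict_left_mono) auto
      ultimately show ?thesis by (simp add: distrib_left)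
    qed
    then have "(1 - e) * real n < real (card (D \<inter> {1..n}))" using cn by (simp add: algebra_simps)
    then have "1 - e < real (card (D \<inter> {1..n})) / real n" using nN by (simp add: pos_less_divide_eq)
    then show ?thesis using nN by blast
  qed
  then show "\<exists>\<^sub>F n in sequentially. 1 - e < real (card (D \<inter> {1..n})) / real n"
    unfolding frequently_def eventually_at_top_linorder by blast
qed simp

section \<open>Null orbits and blocks of large orbits\<close>

lemma half_power_tail: "(\<Sum>l\<in>{n..<m}. (1/2::real) ^ l) \<le> 2 * (1/2) ^ n"
proof (cases "n \<le> m")
  case True
  then have "(\<Sum>l\<in>{n..<m}. (1/2::real) ^ l) = 2 * (1/2) ^ n - 2 * (1/2) ^ m"
    by (induction m rule: dec_induct) (simp_all add: sum.atLeastLessThan_Suc)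
  then show ?thesis by simp
qed simp

text \<open>What the construction of the chaotic set retains of the semigroups. Vectors are the
  parameters w, T j t w being the orbit of C w, and finiteness of \<open>Js\<close> permits one
  choice of times for all j.\<close>

locale null_orbit_family = frechet_space p for p :: "nat \<Rightarrow> 'a::real_vector \<Rightarrow> real" +
  fixes Js :: "'j set" and T :: "'j \<Rightarrow> real \<Rightarrow> 'a \<Rightarrow> 'a" and m0 :: nat and w0 :: 'a
  assumes fin: "finite Js"
    and T_diff: "\<And>j t x y. j \<in> Js \<Longrightarrow> t \<ge> 0 \<Longrightarrow> T j t (x - y) = T j t x - T j t y"
    and T_scaleR: "\<And>j t c x. j \<in> Js \<Longrightarrow> t \<ge> 0 \<Longrightarrow> T j t (c *\<^sub>R x) = c *\<^sub>R T j t x"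
    and T_bound: "\<And>j k R. j \<in> Js \<Longrightarrow> \<exists>m c. c \<ge> 0 \<and> (\<forall>t\<in>{0..R}. \<forall>x. p k (T j t x) \<le> c * p m x)"
    and null_dense: "\<And>x k e. e > 0 \<Longrightarrow> \<exists>y. (\<forall>j\<in>Js. ftendsto p (\<lambda>t. T j t y) 0 at_top) \<and> p k (x - y) < e"
    and unbounded: "\<And>j. j \<in> Js \<Longrightarrow> filterlim (\<lambda>t. p m0 (T j t w0)) at_top at_top"
begin

definition null :: "'a \<Rightarrow> bool" where
  "null x \<longleftrightarrow> (\<forall>j\<in>Js. ftendsto p (\<lambda>t. T j t x) 0 at_top)"

lemma T_add: "j \<in> Js \<Longrightarrow> t \<ge> 0 \<Longrightarrow> T j t (x + y) = T j t x + T j t y"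
  using T_diff[of j t x "(-1) *\<^sub>R y"] T_scaleR[of j t "-1" y] by simp

lemma T_zero: "j \<in> Js \<Longrightarrow> t \<ge> 0 \<Longrightarrow> T j t 0 = 0"
  using T_scaleR[of j t 0 0] by simp

lemma T_sum: "j \<in> Js \<Longrightarrow> t \<ge> 0 \<Longrightarrow> T j t (\<Sum>i\<in>I. f i) = (\<Sum>i\<in>I. T j t (f i))"
  by (induction I rule: infinite_finite_induct) (simp_all add: T_add T_zero)

lemma null_zero: "null 0"
  unfolding null_def
proof
  fix j assume j: "j \<in> Js"
  have "\<forall>\<^sub>F t in at_top. 0 = T j t 0"
    using eventually_ge_at_top[of "0::real"] by eventually_elim (simp add: T_zero[OF j])
  then show "ftendsto p (\<lambda>t. T j t 0) 0 at_top" by (rule ftendsto_cong_eventually[OF ftendsto_const])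
qed

lemma null_diff:
  assumes "null x" "null y"
  shows "null (x - y)"
  unfolding null_def
proof
  fix j assume j: "j \<in> Js"
  have "ftendsto p (\<lambda>t. T j t x - T j t y) (0 - 0) at_top"
    using assms j unfolding null_def by (intro ftendsto_diff) auto
  then have 1: "ftendsto p (\<lambda>t. T j t x - T j t y) 0 at_top" by simp
  have "\<forall>\<^sub>F t in at_top. T j t x - T j t y = T j t (x - y)"
    using eventually_ge_at_top[of "0::real"] by eventually_elim (simp add: T_diff[OF j])
  then show "ftendsto p (\<lambda>t. T j t (x - y)) 0 at_top" by (rule ftendsto_cong_eventually[OF 1])
qed

lemma null_small:
  assumes "null x" "e > 0"
  shows "\<exists>R. \<forall>t\<ge>R. \<forall>j\<in>Js. p k (T j t x) \<le> e"
proof -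
  have "\<forall>\<^sub>F t in at_top. p k (T j t x) \<le> e" if j: "j \<in> Js" for j
  proof -
    have "((\<lambda>t. p k (T j t x - 0)) \<longlongrightarrow> 0) at_top" using assms j unfolding null_def by (intro ftendstoD) auto
    then have "\<forall>\<^sub>F t in at_top. p k (T j t x - 0) < e" using assms(2) by (rule order_tendstoD(2))
    then show ?thesis by eventually_elim simp
  qed
  then have "\<forall>\<^sub>F t in at_top. \<forall>j\<in>Js. p k (T j t x) \<le> e"
    using fin by (intro eventually_ball_finite) auto
  then show ?thesis unfolding eventually_at_top_linorder .
qed

lemma T_bound_all: "\<exists>m c. c \<ge> 0 \<and> (\<forall>j\<in>Js. \<forall>t\<in>{0..R}. \<forall>x. p k (T j t x) \<le> c * p m x)"
proof -
  have "\<exists>m c. c \<ge> 0 \<and> (\<forall>j\<in>J. \<forall>t\<in>{0..R}. \<forall>x. p k (T j t x) \<le> c * p m x)" if "finite J" "J \<subseteq> Js" for J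
    using that
  proof (induction J rule: finite_induct)
    case empty then show ?case by (intro exI[of _ 0] exI[of _ "0::real"]) simp
  next
    case (insert i J)
    then obtain m c where c: "c \<ge> 0" "\<And>j t x. j \<in> J \<Longrightarrow> t \<in> {0..R} \<Longrightarrow> p k (T j t x) \<le> c * p m x" by blast
    obtain m' c' where c': "c' \<ge> 0" "\<And>t x. t \<in> {0..R} \<Longrightarrow> p k (T i t x) \<le> c' * p m' x"
      using T_bound[of i R k] insert.prems by blast
    have "p k (T j t x) \<le> max c c' * p (max m m') x" if "j \<in> insert i J" "t \<in> {0..R}" for j t x
    proof (cases "j = i")
      case True
      have "p k (T j t x) \<le> c' * p m' x" using c'(2)[OF that(2)] True by simp
      also have "\<dots> \<le> max c c' * p (max m m') x" using c c' by (intro mult_mono p_mono) auto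
      finally show ?thesis .
    next
      case False
      then have "p k (T j t x) \<le> c * p m x" using c(2) that by simp
      also have "\<dots> \<le> max c c' * p (max m m') x" using c c' by (intro mult_mono p_mono) auto
      finally show ?thesis .
    qed
    then show ?case using c by (intro exI[of _ "max m m'"] exI[of _ "max c c'"]) auto
  qed
  then show ?thesis using fin by blast
qed

text \<open>The next block vector approximates a small multiple of w0 by a null vector, closely enough to inherit the
  size of the orbit of w0 along the whole block.\<close>

lemma block_step:
  assumes L: "finite L" "\<forall>y\<in>L. null y" and b: "b \<ge> 0"
  shows "\<exists>a x. a \<ge> b \<and> a \<ge> real i \<and> a > 0 \<and> null x \<and> p i x \<le> (1/2) ^ i
    \<and> (\<forall>j\<in>Js. \<forall>t\<in>{0..b}. p i (T j t x) \<le> (1/2) ^ i)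
    \<and> (\<forall>j\<in>Js. \<forall>t\<in>{a..real (Suc i) * a}. p m0 (T j t x) \<ge> 3)
    \<and> (\<forall>y\<in>L. \<forall>j\<in>Js. \<forall>t\<ge>a. p i (T j t y) \<le> (1/2) ^ i / real (Suc i))"
proof -
  define \<epsilon> where "\<epsilon> = (1/2::real) ^ i"
  have \<epsilon>: "\<epsilon> > 0" by (simp add: \<epsilon>_def)
  obtain m1 c1 where c1: "c1 \<ge> 0" "\<And>j t x. j \<in> Js \<Longrightarrow> t \<in> {0..b} \<Longrightarrow> p i (T j t x) \<le> c1 * p m1 x"
    using T_bound_all[of b i] by blast
  define M where "M = max i m1"
  \<comment> \<open>Lets p M x \<le> \<delta> imply both p i x \<le> \<epsilon> and c1 times p m1 x
    at most \<epsilon>.\<close>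
  define \<delta> where "\<delta> = \<epsilon> / (c1 + 1)"
  have \<delta>: "\<delta> > 0" "\<delta> \<le> \<epsilon>" "c1 * \<delta> \<le> \<epsilon>"
  proof -
    show "\<delta> > 0" using \<epsilon> c1 by (simp add: \<delta>_def)
    show "\<delta> \<le> \<epsilon>" "c1 * \<delta> \<le> \<epsilon>" using \<epsilon> c1 by (simp_all add: \<delta>_def divide_simps algebra_simps)
  qed
  \<comment> \<open>Gives lam w0 at most half of \<delta> in p M; the other half is left for the
    approximation error.\<close>
  define lam where "lam = \<delta> / (2 * (p M w0 + 1))"
  have lam: "lam > 0" using \<delta> p_nonneg[of M w0] by (simp add: lam_def add_nonneg_pos)
  have lamw: "p M (lam *\<^sub>R w0) \<le> \<delta> / 2"
  proof -
    have "p M (lam *\<^sub>R w0) = lam * p M w0" using lam by (simp add: p_scaleR)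
    also have "\<dots> \<le> lam * (p M w0 + 1)" using lam by (intro mult_left_mono) auto
    also have "\<dots> = \<delta> / 2"
    proof -
      have *: "\<delta> / (2 * q) * q = \<delta> / 2" if "q > 0" for q :: real using that by simp
      show ?thesis unfolding lam_def using p_nonneg[of M w0] by (intro *) linarith
    qed
    finally show ?thesis .
  qed
  \<comment> \<open>The orbit of lam w0 reaches size 4, of which the approximation may destroy
    1.\<close>
  have "\<forall>\<^sub>F t in at_top. \<forall>j\<in>Js. p m0 (T j t w0) \<ge> 4 / lam"
    using fin unbounded by (intro eventually_ball_finite) (auto simp: filterlim_at_top)
  then obtain R1 where R1: "\<And>t j. t \<ge> R1 \<Longrightarrow> j \<in> Js \<Longrightarrow> p m0 (T j t w0) \<ge> 4 / lam"
    unfolding eventually_at_top_linorder by blast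
  have "\<exists>R. \<forall>t\<ge>R. \<forall>j\<in>Js. p i (T j t y) \<le> \<epsilon> / real (Suc i)" if "y \<in> L" for y
    using \<epsilon> by (intro null_small bspec[OF L(2) that]) simp
  then obtain R2 where R2: "\<And>y t j. y \<in> L \<Longrightarrow> t \<ge> R2 y \<Longrightarrow> j \<in> Js \<Longrightarrow> p i (T j t y) \<le> \<epsilon> / real (Suc i)" by metis
  \<comment> \<open>The order of choices matters: a depends on w0 and the earlier vectors only. It
    fixes the block, and x is then chosen so close to lam w0 that the orbits agree up to 1 until (i
    + 1) a.\<close>
  define a where "a = Max (insert b (insert (real i) (insert 1 (insert R1 (R2 ` L)))))"
  have a: "a \<ge> b" "a \<ge> real i" "a \<ge> 1" "a \<ge> R1" "\<And>y. y \<in> L \<Longrightarrow> a \<ge> R2 y"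
  proof -
    have "z \<le> a" if "z \<in> insert b (insert (real i) (insert 1 (insert R1 (R2 ` L))))" for z
      unfolding a_def by (rule Max_ge) (use L(1) that in auto)
    then show "a \<ge> b" "a \<ge> real i" "a \<ge> 1" "a \<ge> R1" "\<And>y. y \<in> L \<Longrightarrow> a \<ge> R2 y" by blast+
  qed
  obtain m2 c2 where c2: "c2 \<ge> 0" "\<And>j t x. j \<in> Js \<Longrightarrow> t \<in> {0..real (Suc i) * a} \<Longrightarrow> p m0 (T j t x) \<le> c2 * p m2 x"
    using T_bound_all[of "real (Suc i) * a" m0] by blast
  define e where "e = min (\<delta> / 2) (1 / (c2 + 1))"
  have e: "e > 0" using \<delta> c2 by (simp add: e_def)
  obtain x where x: "null x" "p (max M m2) (lam *\<^sub>R w0 - x) < e"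
    using null_dense[OF e, of "max M m2" "lam *\<^sub>R w0"] unfolding null_def by blast
  have xM: "p M x \<le> \<delta>"
  proof -
    have "p M x \<le> p M (lam *\<^sub>R w0) + p M (x - lam *\<^sub>R w0)" using p_triangle[of M "lam *\<^sub>R w0" "x - lam *\<^sub>R w0"] by simp
    moreover have "p M (x - lam *\<^sub>R w0) \<le> p (max M m2) (lam *\<^sub>R w0 - x)" by (subst p_commute) (simp add: p_mono)
    ultimately show ?thesis using lamw x(2) by (simp add: e_def)
  qed
  have 1: "p i x \<le> \<epsilon>" using p_mono[of i M x] xM \<delta> by (simp add: M_def)
  have 2: "p i (T j t x) \<le> \<epsilon>" if "j \<in> Js" "t \<in> {0..b}" for j t
  proof -
    have "p i (T j t x) \<le> c1 * p m1 x" by (rule c1(2)[OF that])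
    also have "\<dots> \<le> c1 * \<delta>" using p_mono[of m1 M x] xM c1 by (intro mult_left_mono) (auto simp: M_def)
    finally show ?thesis using \<delta> by simp
  qed
  have 3: "p m0 (T j t x) \<ge> 3" if j: "j \<in> Js" and t: "t \<in> {a..real (Suc i) * a}" for j t
  proof -
    have t0: "t \<ge> 0" using t a by simp
    have "p m0 (T j t (lam *\<^sub>R w0 - x)) \<le> c2 * p m2 (lam *\<^sub>R w0 - x)"
      using t t0 by (intro c2(2)[OF j]) simp
    also have "\<dots> \<le> c2 * (1 / (c2 + 1))"
      using p_mono[of m2 "max M m2" "lam *\<^sub>R w0 - x"] x(2) c2 by (intro mult_left_mono) (auto simp: e_def)
    also have "\<dots> \<le> 1" using c2 by (simp add: divide_simps)
    finally have d: "p m0 (lam *\<^sub>R T j t w0 - T j t x) \<le> 1" by (simp add: T_diff[OF j t0] T_scaleR[OF j t0])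
    have "4 \<le> lam * p m0 (T j t w0)" using R1[OF _ j, of t] t a lam by (simp add: field_simps)
    then have "4 \<le> p m0 (lam *\<^sub>R T j t w0)" using lam by (simp add: p_scaleR)
    then show ?thesis using d p_abs_diff[of m0 "lam *\<^sub>R T j t w0" "T j t x"] by linarith
  qed
  have 4: "p i (T j t y) \<le> \<epsilon> / real (Suc i)" if "y \<in> L" "j \<in> Js" "t \<ge> a" for y j t
    using R2[OF that(1) _ that(2), of t] a(5)[OF that(1)] that(3) by simp
  show ?thesis
    using a x(1) 1 2 3 4 unfolding \<epsilon>_def by (intro exI[of _ a] exI[of _ x] conjI ballI allI impI) auto
qed

text \<open>The state of the dependent choice carries the set L of all vectors chosen so far, as
  each must have become small when the next block begins. Only consecutive blocks are related by the
  choice; growth of L and of the block ends extends this to all pairs.\<close>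

lemma blocks_exist:
  "\<exists>a x. (\<forall>i. a i > 0 \<and> real i \<le> a i \<and> null (x i) \<and> p i (x i) \<le> (1/2) ^ i)
    \<and> (\<forall>i. \<forall>j\<in>Js. \<forall>t\<in>{a i..real (Suc i) * a i}. p m0 (T j t (x i)) \<ge> 3)
    \<and> (\<forall>i. \<forall>l<i. \<forall>j\<in>Js. \<forall>t\<ge>a i. p i (T j t (x l)) \<le> (1/2) ^ i / real (Suc i))
    \<and> (\<forall>l. \<forall>i<l. \<forall>j\<in>Js. \<forall>t\<in>{0..real (Suc i) * a i}. p l (T j t (x l)) \<le> (1/2) ^ l)"
proof -
  define P :: "nat \<Rightarrow> real \<times> 'a \<times> 'a set \<Rightarrow> bool" where
    "P n s = (case s of (a, x, L) \<Rightarrow> a > 0 \<and> real n \<le> a \<and> null x \<and> p n x \<le> (1/2) ^ n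
      \<and> (\<forall>j\<in>Js. \<forall>t\<in>{a..real (Suc n) * a}. p m0 (T j t x) \<ge> 3) \<and> finite L \<and> (\<forall>y\<in>L. null y) \<and> x \<in> L)" for n s
  define Q :: "nat \<Rightarrow> real \<times> 'a \<times> 'a set \<Rightarrow> real \<times> 'a \<times> 'a set \<Rightarrow> bool" where
    "Q n s s' = (case s of (a, x, L) \<Rightarrow> case s' of (a', x', L') \<Rightarrow> L \<subseteq> L' \<and> real (Suc n) * a \<le> a'
      \<and> (\<forall>j\<in>Js. \<forall>t\<in>{0..real (Suc n) * a}. p (Suc n) (T j t x') \<le> (1/2) ^ Suc n)
      \<and> (\<forall>y\<in>L. \<forall>j\<in>Js. \<forall>t\<ge>a'. p (Suc n) (T j t y) \<le> (1/2) ^ Suc n / real (Suc (Suc n))))" for n s s'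
  have "\<exists>f. \<forall>n. P n (f n) \<and> Q n (f n) (f (Suc n))"
  proof (rule dependent_nat_choice)
    obtain a x where "a > 0" "a \<ge> real 0" "null x" "p 0 x \<le> (1/2) ^ 0"
      "\<forall>j\<in>Js. \<forall>t\<in>{a..real (Suc 0) * a}. p m0 (T j t x) \<ge> 3"
      using block_step[of "{}" 0 0] by auto
    then have "P 0 (a, x, {x})" by (simp add: P_def)
    then show "\<exists>s. P 0 s" by blast
  next
    fix s n assume s: "P n s"
    obtain a x L where sd: "s = (a, x, L)" by (cases s)
    have L: "finite L" "\<forall>y\<in>L. null y" and a: "a > 0" using s by (auto simp: P_def sd)
    have "real (Suc n) * a \<ge> 0" using a by simp
    from block_step[OF L this, of "Suc n"] obtain a' x' where 1: "a' \<ge> real (Suc n) * a" "a' \<ge> real (Suc n)" "a' > 0"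
      "null x'" "p (Suc n) x' \<le> (1/2) ^ Suc n"
      "\<forall>j\<in>Js. \<forall>t\<in>{0..real (Suc n) * a}. p (Suc n) (T j t x') \<le> (1/2) ^ Suc n"
      "\<forall>j\<in>Js. \<forall>t\<in>{a'..real (Suc (Suc n)) * a'}. p m0 (T j t x') \<ge> 3"
      "\<forall>y\<in>L. \<forall>j\<in>Js. \<forall>t\<ge>a'. p (Suc n) (T j t y) \<le> (1/2) ^ Suc n / real (Suc (Suc n))"
      by (elim exE conjE) (rule that)
    have "P (Suc n) (a', x', insert x' L)" unfolding P_def prod.case using 1 L by blast
    moreover have "Q n s (a', x', insert x' L)" unfolding Q_def sd prod.case using 1 by blast
    ultimately show "\<exists>s'. P (Suc n) s' \<and> Q n s s'" by blast
  qed
  then obtain f where f: "\<And>n. P n (f n)" "\<And>n. Q n (f n) (f (Suc n))" by blast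
  define a where "a n = fst (f n)" for n
  define x where "x n = fst (snd (f n))" for n
  define L where "L n = snd (snd (f n))" for n
  have fd: "f n = (a n, x n, L n)" for n by (simp add: a_def x_def L_def)
  have P: "a n > 0" "real n \<le> a n" "null (x n)" "p n (x n) \<le> (1/2) ^ n"
    "\<forall>j\<in>Js. \<forall>t\<in>{a n..real (Suc n) * a n}. p m0 (T j t (x n)) \<ge> 3" "x n \<in> L n" for n
    using f(1)[of n] unfolding P_def fd prod.case by blast+
  have Q: "L n \<subseteq> L (Suc n)" "real (Suc n) * a n \<le> a (Suc n)"
    "\<forall>j\<in>Js. \<forall>t\<in>{0..real (Suc n) * a n}. p (Suc n) (T j t (x (Suc n))) \<le> (1/2) ^ Suc n"
    "\<forall>y\<in>L n. \<forall>j\<in>Js. \<forall>t\<ge>a (Suc n). p (Suc n) (T j t y) \<le> (1/2) ^ Suc n / real (Suc (Suc n))" for n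
    using f(2)[of n] unfolding Q_def fd prod.case by blast+
  have Lm: "L m \<subseteq> L n" if "m \<le> n" for m n using that Q(1) by (rule lift_Suc_mono_le[rotated])
  have bm: "real (Suc m) * a m \<le> real (Suc n) * a n" if "m \<le> n" for m n
  proof (rule lift_Suc_mono_le[OF _ that, of "\<lambda>n. real (Suc n) * a n"])
    fix n
    have "1 * a (Suc n) \<le> real (Suc (Suc n)) * a (Suc n)" using P(1)[of "Suc n"] by (intro mult_right_mono) auto
    then show "real (Suc n) * a n \<le> real (Suc (Suc n)) * a (Suc n)" using Q(2)[of n] by linarith
  qed
  have early: "p i (T j t (x l)) \<le> (1/2) ^ i / real (Suc i)" if li: "l < i" and "j \<in> Js" "t \<ge> a i" for i l j t
  proof -
    obtain n where n: "i = Suc n" "l \<le> n" using li by (cases i) auto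
    have "x l \<in> L n" using P(6) Lm[OF n(2)] by blast
    then show ?thesis using Q(4)[of n] that(2,3) n(1) by blast
  qed
  have late: "p l (T j t (x l)) \<le> (1/2) ^ l" if il: "i < l" and "j \<in> Js" "t \<in> {0..real (Suc i) * a i}" for i l j t
  proof -
    obtain n where n: "l = Suc n" "i \<le> n" using il by (cases l) auto
    have "t \<in> {0..real (Suc n) * a n}" using that(3) bm[OF n(2)] by simp
    then show ?thesis using Q(3)[of n] that(2) n(1) by blast
  qed
  show ?thesis
    by (rule exI[of _ a], rule exI[of _ x]) (use P early late in blast)
qed

end

section \<open>Series of block vectors\<close>

locale block_system = null_orbit_family p Js T m0 w0
  for p :: "nat \<Rightarrow> 'a::real_vector \<Rightarrow> real" and Js :: "'j set" and T m0 w0 +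
  fixes a :: "nat \<Rightarrow> real" and x :: "nat \<Rightarrow> 'a"
  assumes a_pos: "a i > 0" and a_ge: "real i \<le> a i" and x_small: "p i (x i) \<le> (1/2) ^ i"
    and block: "j \<in> Js \<Longrightarrow> t \<in> {a i..real (Suc i) * a i} \<Longrightarrow> p m0 (T j t (x i)) \<ge> 3"
    and early: "l < i \<Longrightarrow> j \<in> Js \<Longrightarrow> t \<ge> a i \<Longrightarrow> p i (T j t (x l)) \<le> (1/2) ^ i / real (Suc i)"
    and late: "i < l \<Longrightarrow> j \<in> Js \<Longrightarrow> t \<in> {0..real (Suc i) * a i} \<Longrightarrow> p l (T j t (x l)) \<le> (1/2) ^ l"
begin

definition psum :: "(nat \<Rightarrow> real) \<Rightarrow> nat \<Rightarrow> 'a" where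
  "psum c n = (\<Sum>i<n. c i *\<^sub>R x i)"

text \<open>For i \<ge> n \<ge> k the seminorm p k is dominated by p i, so p i (x i) \<le> 2^(-i)
  makes the tail geometric.\<close>

lemma psum_tail:
  assumes c: "\<And>i. \<bar>c i\<bar> \<le> 1" and k: "k \<le> n" and nm: "n \<le> m"
  shows "p k (psum c m - psum c n) \<le> 2 * (1/2) ^ n"
proof -
  have "psum c m - psum c n = (\<Sum>i\<in>{n..<m}. c i *\<^sub>R x i)"
    unfolding psum_def lessThan_atLeast0 using sum.atLeastLessThan_concat[of 0 n m "\<lambda>i. c i *\<^sub>R x i"] nm
    by (simp add: algebra_simps)
  then have "p k (psum c m - psum c n) \<le> (\<Sum>i\<in>{n..<m}. p k (c i *\<^sub>R x i))" by (simp add: p_sum)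
  also have "\<dots> \<le> (\<Sum>i\<in>{n..<m}. (1/2) ^ i)"
  proof (rule sum_mono)
    fix i assume "i \<in> {n..<m}"
    then have "p k (x i) \<le> p i (x i)" using k by (intro p_mono) simp
    then have "p k (x i) \<le> (1/2) ^ i" using x_small[of i] by linarith
    moreover have "p k (c i *\<^sub>R x i) \<le> p k (x i)" using c[of i] by (simp add: p_scaleR mult_left_le_one_le)
    ultimately show "p k (c i *\<^sub>R x i) \<le> (1/2) ^ i" by linarith
  qed
  also have "\<dots> \<le> 2 * (1/2) ^ n" by (rule half_power_tail)
  finally show ?thesis .
qed

lemma psum_convergent:
  assumes c: "\<And>i. \<bar>c i\<bar> \<le> 1"
  shows "\<exists>w. ftendsto p (psum c) w sequentially"
proof (rule Cauchy_convergent)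
  fix k and e :: real assume e: "e > 0"
  obtain n0 where n0: "(1/2::real) ^ n0 < e / 4" using real_arch_pow_inv[of "e/4" "1/2"] e by auto
  define n where "n = max k n0"
  have "(1/2::real) ^ n \<le> (1/2) ^ n0" unfolding n_def by (intro power_decreasing) auto
  then have small: "2 * (1/2::real) ^ n < e / 2" using n0 by linarith
  have "p k (psum c m - psum c m') < e" if "m \<ge> n" "m' \<ge> n" for m m'
  proof -
    have "p k (psum c m - psum c n) \<le> 2 * (1/2) ^ n" "p k (psum c m' - psum c n) \<le> 2 * (1/2) ^ n"
      using that by (auto intro!: psum_tail c simp: n_def)
    then show ?thesis using small p_triangle3[of k "psum c m" "psum c m'" "psum c n"]
        p_commute[of k "psum c m'" "psum c n"] by linarith
  qed
  then show "\<exists>M. \<forall>m\<ge>M. \<forall>n\<ge>M. p k (psum c m - psum c n) < e" by blast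
qed

lemma p_limit_le:
  assumes w: "ftendsto p f w sequentially" and le: "\<And>n. n \<ge> n0 \<Longrightarrow> p k (f n) \<le> B"
  shows "p k w \<le> B"
proof (rule tendsto_le[OF sequentially_bot])
  have "(\<lambda>n. p k (f n - w) + B) \<longlonglongrightarrow> 0 + B" by (intro tendsto_intros ftendstoD[OF w])
  then show "(\<lambda>n. p k (f n - w) + B) \<longlonglongrightarrow> B" by simp
  show "(\<lambda>n. p k w) \<longlonglongrightarrow> p k w" by (rule tendsto_const)
  have "p k w \<le> p k (f n - w) + B" if "n \<ge> n0" for n
    using le[OF that] p_triangle3[of k w 0 "f n"] p_commute[of k w "f n"] by simp
  then show "\<forall>\<^sub>F n in sequentially. p k w \<le> p k (f n - w) + B"
    unfolding eventually_sequentially by blast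
qed

text \<open>If the first n coefficients vanish, the whole sum is a tail. This keeps the vectors
  responsible for density near their prescribed shifts.\<close>

lemma series_tail:
  assumes c: "\<And>i. \<bar>c i\<bar> \<le> 1" and w: "ftendsto p (psum c) w sequentially"
    and k: "k \<le> n" and 0: "\<And>i. i < n \<Longrightarrow> c i = 0"
  shows "p k w \<le> 2 * (1/2) ^ n"
proof (rule p_limit_le[OF w])
  fix m assume "m \<ge> n"
  moreover have "psum c n = 0" unfolding psum_def by (intro sum.neutral) (simp add: 0)
  ultimately show "p k (psum c m) \<le> 2 * (1/2) ^ n" using psum_tail[of c k n m] c k by simp
qed

text \<open>The i earlier vectors contribute at most 2^(-i)/(i+1) each, the later ones together at
  most 2^(-i). Continuity of T j t carries the bound from partial sums to w.\<close>

lemma block_estimate: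
  assumes c: "\<And>i. \<bar>c i\<bar> \<le> 1" and w: "ftendsto p (psum c) w sequentially"
    and j: "j \<in> Js" and t: "t \<in> {a i..real (Suc i) * a i}"
  shows "p i (T j t w - c i *\<^sub>R T j t (x i)) \<le> 2 * (1/2) ^ i"
proof -
  have t0: "t \<ge> 0" using t a_pos[of i] by simp
  have tend: "ftendsto p (\<lambda>n. T j t (psum c n) - c i *\<^sub>R T j t (x i)) (T j t w - c i *\<^sub>R T j t (x i)) sequentially"
  proof (rule ftendsto_diff[OF _ ftendsto_const])
    have "\<exists>m d. \<forall>z. p k (T j t z) \<le> d * p m z" for k
      using T_bound[OF j, of t k] t0 by (metis atLeastAtMost_iff order_refl)
    then obtain m d where md: "\<And>k z. p k (T j t z) \<le> d k * p (m k) z" by metis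
    show "ftendsto p (\<lambda>n. T j t (psum c n)) (T j t w) sequentially"
    proof (rule ftendsto_sandwich)
      fix k
      have "(\<lambda>n. d k * p (m k) (psum c n - w)) \<longlonglongrightarrow> d k * 0" by (intro tendsto_intros ftendstoD[OF w])
      then show "(\<lambda>n. d k * p (m k) (psum c n - w)) \<longlonglongrightarrow> 0" by simp
      show "\<forall>\<^sub>F n in sequentially. p k (T j t (psum c n) - T j t w) \<le> d k * p (m k) (psum c n - w)"
        using md by (simp flip: T_diff[OF j t0])
    qed
  qed
  show ?thesis
  proof (rule p_limit_le[OF tend])
    fix n assume n: "n \<ge> Suc i"
    have "T j t (psum c n) = (\<Sum>l<n. c l *\<^sub>R T j t (x l))"
      unfolding psum_def T_sum[OF j t0] by (simp add: T_scaleR[OF j t0])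
    also have "\<dots> = c i *\<^sub>R T j t (x i) + (\<Sum>l\<in>{..<n} - {i}. c l *\<^sub>R T j t (x l))"
      using n by (intro sum.remove) auto
    finally have "T j t (psum c n) - c i *\<^sub>R T j t (x i) = (\<Sum>l\<in>{..<n} - {i}. c l *\<^sub>R T j t (x l))" by simp
    moreover have "{..<n} - {i} = {..<i} \<union> {Suc i..<n}" using n by auto
    ultimately have "p i (T j t (psum c n) - c i *\<^sub>R T j t (x i)) \<le> (\<Sum>l\<in>{..<i} \<union> {Suc i..<n}. p i (c l *\<^sub>R T j t (x l)))"
      by (simp add: p_sum)
    also have "\<dots> = (\<Sum>l<i. p i (c l *\<^sub>R T j t (x l))) + (\<Sum>l\<in>{Suc i..<n}. p i (c l *\<^sub>R T j t (x l)))"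
      by (intro sum.union_disjoint) auto
    also have "(\<Sum>l<i. p i (c l *\<^sub>R T j t (x l))) \<le> (\<Sum>l<i. (1/2) ^ i / real (Suc i))"
    proof (rule sum_mono)
      fix l assume "l \<in> {..<i}"
      then have "p i (T j t (x l)) \<le> (1/2) ^ i / real (Suc i)" using t by (intro early j) auto
      moreover have "p i (c l *\<^sub>R T j t (x l)) \<le> p i (T j t (x l))"
        using c[of l] by (simp add: p_scaleR mult_left_le_one_le)
      ultimately show "p i (c l *\<^sub>R T j t (x l)) \<le> (1/2) ^ i / real (Suc i)" by linarith
    qed
    also have "(\<Sum>l<i. (1/2::real) ^ i / real (Suc i)) \<le> (1/2) ^ i"
    proof -
      have "real i * (1/2) ^ i \<le> real (Suc i) * (1/2::real) ^ i" by (intro mult_right_mono) auto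
      then show ?thesis by (simp add: pos_divide_le_eq mult.commute del: of_nat_Suc)
    qed
    also have "(\<Sum>l\<in>{Suc i..<n}. p i (c l *\<^sub>R T j t (x l))) \<le> (\<Sum>l\<in>{Suc i..<n}. (1/2) ^ l)"
    proof (rule sum_mono)
      fix l assume l: "l \<in> {Suc i..<n}"
      then have "p l (T j t (x l)) \<le> (1/2) ^ l" using t t0 by (intro late[of i] j) auto
      moreover have "p i (T j t (x l)) \<le> p l (T j t (x l))" using l by (intro p_mono) auto
      moreover have "p i (c l *\<^sub>R T j t (x l)) \<le> p i (T j t (x l))"
        using c[of l] by (simp add: p_scaleR mult_left_le_one_le)
      ultimately show "p i (c l *\<^sub>R T j t (x l)) \<le> (1/2) ^ l" by linarith
    qed
    also have "(\<Sum>l\<in>{Suc i..<n}. (1/2::real) ^ l) \<le> 2 * (1/2) ^ Suc i" by (rule half_power_tail)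
    finally show "p i (T j t (psum c n) - c i *\<^sub>R T j t (x i)) \<le> 2 * (1/2) ^ i" by simp
  qed
qed

text \<open>A zero coefficient removes the only large summand on its block; infinitely many of them
  provide a block beyond every threshold.\<close>

lemma small_blocks:
  assumes c: "\<And>i. \<bar>c i\<bar> \<le> 1" and w: "ftendsto p (psum c) w sequentially" and u: "null u"
    and inf: "infinite {i. c i = 0}" and e: "e > 0"
  shows "\<exists>i\<ge>K. \<forall>j\<in>Js. \<forall>t\<in>{a i..real (Suc i) * a i}. fdist p (T j t (u + w)) 0 < e"
proof -
  obtain k d where d: "d > 0" "\<And>x y. p k (x - y) < d \<Longrightarrow> fdist p x y < e" using fdist_small_of_p[OF e] by blast
  have "d / 4 > 0" using d by simp
  from null_small[OF u this, of k] obtain R where R: "\<And>t j. t \<ge> R \<Longrightarrow> j \<in> Js \<Longrightarrow> p k (T j t u) \<le> d / 4"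
    by blast
  obtain n0 where n0: "(1/2::real) ^ n0 < d / 4" using real_arch_pow_inv[of "d/4" "1/2"] d by auto
  obtain n1 :: nat where n1: "R \<le> real n1" using real_arch_simple by blast
  \<comment> \<open>K is the required lower bound, k gives p k \<le> p i, n0 makes the block
    estimate small, and n1 puts the block beyond R because a i \<ge> i.\<close>
  obtain i where i: "c i = 0" "i \<ge> Max {K, k, n0, n1}"
    using inf unfolding infinite_nat_iff_unbounded_le by blast
  have i': "i \<ge> K" "i \<ge> k" "i \<ge> n0" "i \<ge> n1" using i(2) by auto
  have "fdist p (T j t (u + w)) 0 < e" if j: "j \<in> Js" and t: "t \<in> {a i..real (Suc i) * a i}" for j t
  proof (rule d(2))
    have t0: "t \<ge> 0" using t a_pos[of i] by simp
    have "R \<le> t" using n1 i'(4) a_ge[of i] t by simp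
    then have 1: "p k (T j t u) \<le> d / 4" by (rule R[OF _ j])
    have "p i (T j t w) \<le> 2 * (1/2) ^ i" using block_estimate[OF c w j t] i(1) by simp
    moreover have "p k (T j t w) \<le> p i (T j t w)" using i' by (intro p_mono)
    moreover have "(1/2::real) ^ i \<le> (1/2) ^ n0" using i' by (intro power_decreasing) auto
    ultimately have "p k (T j t w) < d / 2" using n0 by linarith
    then show "p k (T j t (u + w) - 0) < d"
      using 1 p_triangle[of k "T j t u" "T j t w"] d(1) by (simp add: T_add[OF j t0])
  qed
  then show ?thesis using i' by blast
qed

text \<open>Of the size 3 of the i-th summand, the rest of the series takes at most 1, as i \<ge> 1,
  and the null vector u at most 1 once its orbit has decayed.\<close>

lemma large_blocks:
  assumes c: "\<And>i. \<bar>c i\<bar> \<le> 1" and w: "ftendsto p (psum c) w sequentially" and u: "null u"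
    and inf: "infinite {i. \<bar>c i\<bar> = 1}"
  shows "\<exists>i\<ge>K. \<forall>j\<in>Js. \<forall>t\<in>{a i..real (Suc i) * a i}. p m0 (T j t (u + w)) \<ge> 1"
proof -
  obtain R where R: "\<And>t j. t \<ge> R \<Longrightarrow> j \<in> Js \<Longrightarrow> p m0 (T j t u) \<le> 1"
    using null_small[OF u, of 1 m0] by auto
  obtain n1 :: nat where n1: "R \<le> real n1" using real_arch_simple by blast
  obtain i where i: "\<bar>c i\<bar> = 1" "i \<ge> Max {K, m0, 1, n1}"
    using inf unfolding infinite_nat_iff_unbounded_le by blast
  have i': "i \<ge> K" "i \<ge> m0" "i \<ge> 1" "i \<ge> n1" using i(2) by auto
  have "p m0 (T j t (u + w)) \<ge> 1" if j: "j \<in> Js" and t: "t \<in> {a i..real (Suc i) * a i}" for j t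
  proof -
    have t0: "t \<ge> 0" using t a_pos[of i] by simp
    have "R \<le> t" using n1 i'(4) a_ge[of i] t by simp
    then have 1: "p m0 (T j t u) \<le> 1" by (rule R[OF _ j])
    have "p i (T j t w - c i *\<^sub>R T j t (x i)) \<le> 2 * (1/2) ^ i" by (rule block_estimate[OF c w j t])
    moreover have "p m0 (T j t w - c i *\<^sub>R T j t (x i)) \<le> p i (T j t w - c i *\<^sub>R T j t (x i))" using i' by (intro p_mono)
    moreover have "(1/2::real) ^ i \<le> (1/2) ^ 1" using i' by (intro power_decreasing) auto
    ultimately have 2: "p m0 (T j t w - c i *\<^sub>R T j t (x i)) \<le> 1" by simp
    have 3: "p m0 (c i *\<^sub>R T j t (x i)) \<ge> 3" using block[OF j t] i(1) by (simp add: p_scaleR)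
    have "p m0 (T j t w) \<ge> 2" using p_abs_diff[of m0 "T j t w" "c i *\<^sub>R T j t (x i)"] 2 3 by linarith
    then show ?thesis using p_abs_diff[of m0 "T j t w" "- T j t u"] 1
      by (simp add: T_add[OF j t0] add.commute)
  qed
  then show ?thesis using i' by blast
qed

end

text \<open>The pairs (r, m) have infinitely many codes. The bound n makes room for the delay with
  which the coefficients below set in.\<close>

lemma infinite_prod_decode: "infinite {i. fst (prod_decode i) = r \<and> i \<ge> n}"
proof -
  have "inj (\<lambda>m. prod_encode (r, m))" by (auto simp: inj_def)
  then have "infinite (range (\<lambda>m. prod_encode (r, m)))" by (rule range_inj_infinite)
  moreover have "range (\<lambda>m. prod_encode (r, m)) \<subseteq> {i. fst (prod_decode i) = r}" by auto
  ultimately have "infinite {i. fst (prod_decode i) = r}" using infinite_super by blast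
  then have "infinite ({i. fst (prod_decode i) = r} - {..<n})" by (rule Diff_infinite_finite[rotated]) simp
  moreover have "{i. fst (prod_decode i) = r} - {..<n} = {i. fst (prod_decode i) = r \<and> i \<ge> n}" by auto
  ultimately show ?thesis by simp
qed

text \<open>Cantor's diagonal argument, shifted by one place so that the diagonal sequence is False
  at 0.\<close>

lemma uncountable_sequences: "uncountable {f :: nat \<Rightarrow> bool. \<not> f 0}"
proof
  let ?F = "{f :: nat \<Rightarrow> bool. \<not> f 0}"
  assume c: "countable ?F"
  define h where "h = from_nat_into ?F"
  define g where "g n = (n > 0 \<and> \<not> h (n - 1) n)" for n
  have "g \<in> ?F" by (simp add: g_def)
  then obtain m where "h m = g" using from_nat_into_surj[OF c] unfolding h_def by blast
  then have "h m (Suc m) = g (Suc m)" by simp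
  then show False by (simp add: g_def)
qed

context block_system
begin

text \<open>A binary sequence f selects the blocks i with f (fst (prod_decode i)). Two different sequences then differ
  on infinitely many blocks and, since f 0 is False, agree on infinitely many. The countably many sequences with
  exactly one True are shifted so as to make the set dense.\<close>

theorem chaotic_set:
  assumes sep: "fseparable p" and ne: "Js \<noteq> {}"
  obtains W where "uncountable W" "\<And>y k e. e > 0 \<Longrightarrow> \<exists>v\<in>W. p k (y - v) < e"
    "\<And>v v' K. v \<in> W \<Longrightarrow> v' \<in> W \<Longrightarrow> v \<noteq> v' \<Longrightarrow>
      \<exists>i\<ge>K. \<forall>j\<in>Js. \<forall>t\<in>{a i..real (Suc i) * a i}. p m0 (T j t (v - v')) \<ge> 1"
    "\<And>v v' e K. v \<in> W \<Longrightarrow> v' \<in> W \<Longrightarrow> v \<noteq> v' \<Longrightarrow> e > 0 \<Longrightarrow>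
      \<exists>i\<ge>K. \<forall>j\<in>Js. \<forall>t\<in>{a i..real (Suc i) * a i}. fdist p (T j t (v - v')) 0 < e"
proof -
  obtain D where D: "countable D" "fdense p D UNIV" using sep unfolding fseparable_def by blast
  define F where "F = {f :: nat \<Rightarrow> bool. \<not> f 0}"
  \<comment> \<open>The single True stands at q + 1, since place 0 is reserved for False.\<close>
  define fq where "fq q = (\<lambda>n. n = Suc q)" for q :: nat
  have inj_fq: "inj fq"
  proof (rule injI)
    fix q q' assume "fq q = fq q'"
    then have "fq q (Suc q) = fq q' (Suc q)" by simp
    then show "q = q'" by (simp add: fq_def)
  qed
  have fqF: "fq q \<in> F" for q by (simp add: fq_def F_def)
  \<comment> \<open>q encodes an index into the enumeration of D and a precision n; the null vector
    z is within 1/(n + 1) of that point in p n.\<close>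
  have "\<exists>z. null z \<and> p (snd (prod_decode q)) (from_nat_into D (fst (prod_decode q)) - z) < 1 / real (Suc (snd (prod_decode q)))" for q
    unfolding null_def by (rule null_dense) simp
  then obtain z where z: "\<And>q. null (z q)"
    "\<And>q. p (snd (prod_decode q)) (from_nat_into D (fst (prod_decode q)) - z q) < 1 / real (Suc (snd (prod_decode q)))" by metis
  \<comment> \<open>The series of \<open>fq q\<close> is delayed until the precision encoded in q,
    so that its sum is small and V (\<open>fq q\<close>) stays near z q. All other sequences start
    at 0.\<close>
  define kk where "kk f = (if f \<in> range fq then snd (prod_decode (inv fq f)) else 0)" for f
  define dd where "dd f = (if f \<in> range fq then z (inv fq f) else 0)" for f
  have kd: "kk (fq q) = snd (prod_decode q)" "dd (fq q) = z q" for q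
    by (simp_all add: kk_def dd_def inv_f_f[OF inj_fq])
  have dd_null: "null (dd f)" for f by (simp add: dd_def z null_zero)
  define c where "c f i = (if kk f \<le> i \<and> f (fst (prod_decode i)) then 1 else 0 :: real)" for f i
  have c1: "\<bar>c f i\<bar> \<le> 1" for f i by (simp add: c_def)
  have "\<exists>w. ftendsto p (psum (c f)) w sequentially" for f by (rule psum_convergent[OF c1])
  then obtain w where w: "\<And>f. ftendsto p (psum (c f)) (w f) sequentially" by metis
  define V where "V f = dd f + w f" for f
  have large: "\<exists>i\<ge>K. \<forall>j\<in>Js. \<forall>t\<in>{a i..real (Suc i) * a i}. p m0 (T j t (V f - V g)) \<ge> 1"
    and small: "\<And>e. e > 0 \<Longrightarrow>
      \<exists>i\<ge>K. \<forall>j\<in>Js. \<forall>t\<in>{a i..real (Suc i) * a i}. fdist p (T j t (V f - V g)) 0 < e"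
    if f: "f \<in> F" and g: "g \<in> F" and fg: "f \<noteq> g" for f g K
  proof -
    define d where "d i = c f i - c g i" for i
    have d1: "\<bar>d i\<bar> \<le> 1" for i by (simp add: d_def c_def)
    have pd: "psum (c f) n - psum (c g) n = psum d n" for n
      by (simp add: psum_def d_def scaleR_diff_left sum_subtractf)
    have wd: "ftendsto p (psum d) (w f - w g) sequentially"
      using ftendsto_diff[OF w[of f] w[of g]] unfolding pd .
    have VV: "V f - V g = (dd f - dd g) + (w f - w g)" by (simp add: V_def)
    have u: "null (dd f - dd g)" by (intro null_diff dd_null)
    have "{i. fst (prod_decode i) = 0 \<and> i \<ge> 0} \<subseteq> {i. d i = 0}" using f g by (auto simp: d_def c_def F_def)
    then have inf0: "infinite {i. d i = 0}" using infinite_prod_decode infinite_super by blast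
    obtain r where r: "f r \<noteq> g r" using fg by auto
    \<comment> \<open>Beyond both delays the coefficients are decided by f r and g r alone.\<close>
    have "{i. fst (prod_decode i) = r \<and> i \<ge> max (kk f) (kk g)} \<subseteq> {i. \<bar>d i\<bar> = 1}" using r by (auto simp: d_def c_def)
    then have inf1: "infinite {i. \<bar>d i\<bar> = 1}" using infinite_prod_decode infinite_super by blast
    show "\<exists>i\<ge>K. \<forall>j\<in>Js. \<forall>t\<in>{a i..real (Suc i) * a i}. p m0 (T j t (V f - V g)) \<ge> 1"
      unfolding VV by (rule large_blocks[OF d1 wd u inf1])
    show "\<exists>i\<ge>K. \<forall>j\<in>Js. \<forall>t\<in>{a i..real (Suc i) * a i}. fdist p (T j t (V f - V g)) 0 < e" if "e > 0" for e
      unfolding VV by (rule small_blocks[OF d1 wd u inf0 that])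
  qed
  have inj: "inj_on V F"
  proof (rule inj_onI, rule ccontr)
    fix f g assume fg: "f \<in> F" "g \<in> F" "V f = V g" "f \<noteq> g"
    obtain i where i: "\<forall>j\<in>Js. \<forall>t\<in>{a i..real (Suc i) * a i}. p m0 (T j t (V f - V g)) \<ge> 1"
      using large[OF fg(1,2,4), of 0] by blast
    obtain j where j: "j \<in> Js" using ne by blast
    have "1 * a i \<le> real (Suc i) * a i" using a_pos[of i] by (intro mult_right_mono) auto
    then have "a i \<in> {a i..real (Suc i) * a i}" by simp
    then have "p m0 (T j (a i) 0) \<ge> 1" using i j fg(3) by force
    then show False using T_zero[OF j, of "a i"] a_pos[of i] by simp
  qed
  have unc: "uncountable (V ` F)"
    using uncountable_sequences countable_image_inj_eq[OF inj] unfolding F_def by simp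
  have dens: "\<exists>v\<in>V ` F. p k (y - v) < e" if e: "e > 0" for y k e
  proof -
    have "e / 3 > 0" using e by simp
    then obtain d where d: "d > 0" "\<And>x y. fdist p x y < d \<Longrightarrow> p k (x - y) < e / 3" using p_small_of_fdist by blast
    obtain s where s: "s \<in> D" "fdist p y s < d" using D(2) d(1) unfolding fdense_def by blast
    obtain m where m: "from_nat_into D m = s" using from_nat_into_surj[OF D(1) s(1)] by blast
    obtain n0 where n0: "(1/2::real) ^ n0 < e / 6" using real_arch_pow_inv[of "e/6" "1/2"] e by auto
    obtain n1 :: nat where n1: "3 / e < real n1" using reals_Archimedean2 by blast
    define n where "n = max k (max n0 n1)"
    define q where "q = prod_encode (m, n)"
    have "p n (s - z q) < 1 / real (Suc n)" using z(2)[of q] by (simp add: q_def m)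
    moreover have "1 / real (Suc n) < e / 3"
    proof -
      have "3 / e < real (Suc n)" using n1 by (simp add: n_def)
      then show ?thesis using e by (simp add: field_simps)
    qed
    moreover have "p k (s - z q) \<le> p n (s - z q)" by (intro p_mono) (simp add: n_def)
    ultimately have 1: "p k (s - z q) < e / 3" by linarith
    have "p k (w (fq q)) \<le> 2 * (1/2) ^ n"
    proof (rule series_tail[OF c1 w])
      show "k \<le> n" by (simp add: n_def)
      show "c (fq q) i = 0" if "i < n" for i using that by (simp add: c_def kd q_def)
    qed
    moreover have "(1/2::real) ^ n \<le> (1/2) ^ n0" by (intro power_decreasing) (auto simp: n_def)
    ultimately have 2: "p k (w (fq q)) < e / 3" using n0 by linarith
    have 3: "p k (y - s) < e / 3" by (rule d(2)[OF s(2)])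
    have eq: "y - V (fq q) = (y - s) + ((s - z q) - w (fq q))" by (simp add: V_def kd)
    have "p k (y - V (fq q)) \<le> p k (y - s) + (p k (s - z q) + p k (w (fq q)))"
      unfolding eq using p_triangle[of k "y - s" "(s - z q) - w (fq q)"] p_diff[of k "s - z q" "w (fq q)"] by linarith
    then have "p k (y - V (fq q)) < e" using 1 2 3 by linarith
    then show ?thesis using fqF by blast
  qed
  show ?thesis
  proof (rule that[OF unc dens])
    fix v v' K assume "v \<in> V ` F" "v' \<in> V ` F" and ne: "v \<noteq> v'"
    then obtain f g where fg: "f \<in> F" "g \<in> F" "v = V f" "v' = V g" by blast
    with ne have "f \<noteq> g" by blast
    then show "\<exists>i\<ge>K. \<forall>j\<in>Js. \<forall>t\<in>{a i..real (Suc i) * a i}. p m0 (T j t (v - v')) \<ge> 1"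
      "\<And>e. e > 0 \<Longrightarrow> \<exists>i\<ge>K. \<forall>j\<in>Js. \<forall>t\<in>{a i..real (Suc i) * a i}. fdist p (T j t (v - v')) 0 < e"
      unfolding fg(3,4) by (rule large[OF fg(1,2)], rule small[OF fg(1,2)])
  qed
qed

end

section \<open>Disjoint distributional chaos\<close>

lemma dom_pow_scaleR:
  assumes hom: "\<And>x c. x \<in> DA \<Longrightarrow> c *\<^sub>R x \<in> DA \<and> A (c *\<^sub>R x) = c *\<^sub>R A x" and y: "y \<in> dom_pow DA A n"
  shows "i \<le> n \<Longrightarrow> (A ^^ i) (c *\<^sub>R y) = c *\<^sub>R (A ^^ i) y" and "c *\<^sub>R y \<in> dom_pow DA A n"
proof -
  show pow: "(A ^^ i) (c *\<^sub>R y) = c *\<^sub>R (A ^^ i) y" if "i \<le> n" for i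
    using that
  proof (induction i)
    case (Suc i)
    then have "(A ^^ i) y \<in> DA" using y by (simp add: dom_pow_def)
    then show ?case using Suc hom by simp
  qed simp
  show "c *\<^sub>R y \<in> dom_pow DA A n"
    unfolding dom_pow_def using pow hom y by (auto simp: dom_pow_def)
qed

lemma the_inj_image: "inj f \<Longrightarrow> (THE x. f x = f y) = y"
  by (rule the_equality) (auto simp: inj_eq)

context frechet_space
begin

lemma fdist_diff: "fdist p x y = fdist p (x - y) 0"
  by (simp add: fdist_def)

text \<open>By injectivity the description in \<open>semRC\<close> is the inverse of D, so D is an
  isometry onto its range with the transported seminorms.\<close>

lemma fdist_semRC:
  assumes D: "linear D" "inj D"
  shows "fdist (semRC p D) (D x) (D y) = fdist p x y"
proof -
  have "semRC p D n (D x - D y) = p n (x - y)" for n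
    unfolding semRC_def linear_diff[OF D(1), symmetric] the_inj_image[OF D(2)] by simp
  then show ?thesis by (simp add: fdist_def)
qed

lemma continuous_on_fdist:
  assumes f: "fcont_on S f" and g: "fcont_on S g"
  shows "continuous_on S (\<lambda>t. fdist p (f t) (g t))"
  unfolding continuous_on_def
proof
  fix t assume t: "t \<in> S"
  have "((\<lambda>s. fdist p (f s) (f t) + fdist p (g s) (g t)) \<longlongrightarrow> 0 + 0) (at t within S)"
    using fcont_onD[OF f t] fcont_onD[OF g t] unfolding ftendsto_def by (intro tendsto_add)
  then have l: "((\<lambda>s. fdist p (f s) (f t) + fdist p (g s) (g t)) \<longlongrightarrow> 0) (at t within S)" by simp
  have bd: "norm (fdist p (f s) (g s) - fdist p (f t) (g t)) \<le> fdist p (f s) (f t) + fdist p (g s) (g t)" for s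
    using fdist_triangle[of "f s" "g s" "f t"] fdist_triangle[of "f t" "g s" "g t"]
      fdist_triangle[of "f t" "g t" "f s"] fdist_triangle[of "f s" "g t" "g s"]
      fdist_commute[of "f t" "f s"] fdist_commute[of "g t" "g s"] by simp
  have "((\<lambda>s. fdist p (f s) (g s) - fdist p (f t) (g t)) \<longlongrightarrow> 0) (at t within S)"
    by (rule Lim_null_comparison[OF _ l]) (rule always_eventually, rule allI, rule bd)
  then show "((\<lambda>s. fdist p (f s) (g s)) \<longlongrightarrow> fdist p (f t) (g t)) (at t within S)" by (simp add: LIM_zero_iff)
qed

end

text \<open>Supplies the measurability of the time sets in the definition of chaos: the sets {h j
  \<ge> e} are closed, and finitely many are combined.\<close>

lemma sets_lebesgue_levels:
  assumes fin: "finite J" and h: "\<And>j. j \<in> J \<Longrightarrow> continuous_on {0..} (h j)"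
  shows "{t::real. t \<ge> 0 \<and> (\<forall>j\<in>J. h j t \<ge> (e::real))} \<inter> {0..R} \<in> sets lebesgue"
    and "{t::real. t \<ge> 0 \<and> (\<forall>j\<in>J. h j t < (e::real))} \<inter> {0..R} \<in> sets lebesgue"
proof -
  have cl: "{0..} \<inter> h j -` {e..} \<in> sets lebesgue" if "j \<in> J" for j
    using borel_closed[OF continuous_closed_preimage[OF h[OF that] closed_atLeast closed_atLeast[of e]]] by simp
  have "{t. t \<ge> 0 \<and> (\<forall>j\<in>J. h j t \<ge> e)} \<inter> {0..R} = {0..R} - (\<Union>j\<in>J. {0..R} - ({0..} \<inter> h j -` {e..}))"
    by auto
  moreover have "\<dots> \<in> sets lebesgue"
    using cl by (intro sets.Diff sets.finite_UN fin) auto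
  ultimately show "{t. t \<ge> 0 \<and> (\<forall>j\<in>J. h j t \<ge> e)} \<inter> {0..R} \<in> sets lebesgue" by simp
  have "{t. t \<ge> 0 \<and> (\<forall>j\<in>J. h j t < e)} \<inter> {0..R} = {0..R} - (\<Union>j\<in>J. {0..} \<inter> h j -` {e..})"
    by auto
  moreover have "\<dots> \<in> sets lebesgue"
    using cl by (intro sets.Diff sets.finite_UN fin) auto
  ultimately show "{t. t \<ge> 0 \<and> (\<forall>j\<in>J. h j t < e)} \<inter> {0..R} \<in> sets lebesgue" by simp
qed

section \<open>Orbits starting in R(C)\<close>

context integrated_semigroup
begin

text \<open>With C (Y w) = D w, continuity of the embedding at 0 and homogeneity bound the graph
  seminorms of Y w by a single p m' w; \<open>usol_bound\<close> then makes the orbits locally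
  equicontinuous in w.\<close>

lemma embedded_solutions:
  assumes D: "fbounded_op p D" "inj D"
    and emb: "cont_embedded (semRC p D) (range D) (semCD p C DA A (nat \<lceil>\<alpha>\<rceil>)) (C ` dom_pow DA A (nat \<lceil>\<alpha>\<rceil>))"
  shows "\<exists>u. (\<forall>w. mild (D w) (u w)) \<and> (\<forall>k R. \<exists>m c. c \<ge> 0 \<and> (\<forall>t\<in>{0..R}. \<forall>w. p k (u w t) \<le> c * p m w))"
proof -
  have lin: "linear D" by (rule fbounded_op_linear[OF D(1)])
  have linC: "linear C" by (rule fbounded_op_linear[OF C(1)])
  note emb' = emb[folded ord_def, unfolded cont_embedded_def]
  have "\<exists>y. y \<in> dom_pow DA A ord \<and> C y = D w" for w
  proof -
    have "D w \<in> C ` dom_pow DA A ord" using subsetD[OF conjunct1[OF emb'] rangeI] .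
    then show ?thesis by auto
  qed
  then obtain Y where Y: "\<And>w. Y w \<in> dom_pow DA A ord" "\<And>w. C (Y w) = D w" by metis
  have Y_the: "(THE x. x \<in> dom_pow DA A ord \<and> C x = D w) = Y w" for w
  proof (rule the_equality)
    show "Y w \<in> dom_pow DA A ord \<and> C (Y w) = D w" using Y by simp
    fix x assume "x \<in> dom_pow DA A ord \<and> C x = D w"
    then have "C x = C (Y w)" using Y by simp
    then show "x = Y w" by (rule injD[OF C(2)])
  qed
  note hom = closed_lin_op_scaleR[OF A]
  have Y_scaleR: "Y (c *\<^sub>R w) = c *\<^sub>R Y w" for c w
  proof (rule injD[OF C(2)])
    show "C (Y (c *\<^sub>R w)) = C (c *\<^sub>R Y w)" by (simp add: Y linear_cmul[OF lin] linear_cmul[OF linC])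
  qed
  define r where "r m w = (\<Sum>i\<le>ord. p m ((A ^^ i) (Y w)))" for m w
  have r_nonneg: "0 \<le> r m w" for m w by (simp add: r_def sum_nonneg)
  have r_scaleR: "r m (c *\<^sub>R w) = \<bar>c\<bar> * r m w" for m c w
  proof -
    have "p m ((A ^^ i) (Y (c *\<^sub>R w))) = \<bar>c\<bar> * p m ((A ^^ i) (Y w))" if "i \<le> ord" for i
      using dom_pow_scaleR(1)[OF hom Y(1) that] by (simp add: Y_scaleR p_scaleR)
    then show ?thesis by (simp add: r_def sum_distrib_left)
  qed
  have semCD_r: "semCD p C DA A ord m (D w) = r m w" for m w
    unfolding semCD_def Y_the r_def by simp
  have r_bound: "\<exists>m' c. c \<ge> 0 \<and> (\<forall>w. r m w \<le> c * p m' w)" for m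
  proof -
    obtain e where e: "e > 0" "\<And>x y. fdist (semCD p C DA A ord) x y < e \<Longrightarrow> semCD p C DA A ord m (x - y) < 1"
    proof -
      have nn: "0 \<le> semCD p C DA A ord n z" for n z by (simp add: semCD_def sum_nonneg)
      have "\<exists>e>0. \<forall>x y. fdist (semCD p C DA A ord) x y < e \<longrightarrow> semCD p C DA A ord m (x - y) < 1"
        by (rule seminorm_small_of_fdist[OF nn zero_less_one])
      then show ?thesis using that by blast
    qed
    have D0: "D 0 \<in> range D" by simp
    from conjunct2[OF emb', THEN bspec, OF D0, rule_format, OF e(1)] obtain d where d: "d > 0"
      "\<And>y. y \<in> range D \<Longrightarrow> fdist (semRC p D) (D 0) y < d \<Longrightarrow> fdist (semCD p C DA A ord) (D 0) y < e" by blast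
    obtain m' \<delta> where m': "\<delta> > 0" "\<And>x y. p m' (x - y) < \<delta> \<Longrightarrow> fdist p x y < d" using fdist_small_of_p[OF d(1)] by blast
    have "r m w \<le> 2 / \<delta> * p m' w" for w
    proof (rule seminorm_bound_of_small[where q = "r m" and r = "p m'"])
      fix w assume "p m' w < \<delta>"
      \<comment> \<open>The point -w is taken so that D 0 - D (- w) equals D w.\<close>
      then have "fdist p 0 (- w) < d" using m'(2)[of 0 "- w"] by simp
      then have "fdist (semRC p D) (D 0) (D (- w)) < d" by (simp add: fdist_semRC[OF lin D(2)])
      then have "fdist (semCD p C DA A ord) (D 0) (D (- w)) < e" by (intro d(2)) simp_all
      then have "semCD p C DA A ord m (D 0 - D (- w)) < 1" by (rule e(2))
      moreover have "D 0 - D (- w) = D w" using linear_diff[OF lin, of 0 "- w"] by simp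
      ultimately show "r m w < 1" by (simp add: semCD_r)
    qed (use m' r_nonneg r_scaleR p_scaleR in auto)
    then show ?thesis using m'(1) by (intro exI[of _ m'] exI[of _ "2 / \<delta>"]) auto
  qed
  show ?thesis
  proof (intro exI[of _ "\<lambda>w. usol (Y w)"] conjI allI)
    show "mild (D w) (usol (Y w))" for w using mild_usol[OF Y(1)[of w]] by (simp add: Y)
    fix k R
    obtain m c where c: "c \<ge> 0" "\<And>t y. t \<in> {0..R} \<Longrightarrow> p k (usol y t) \<le> c * (\<Sum>i\<le>ord. p m ((A ^^ i) y))"
      using usol_bound[of R k] by blast
    obtain m' c' where c': "c' \<ge> 0" "\<And>w. r m w \<le> c' * p m' w" using r_bound[of m] by blast
    have "p k (usol (Y w) t) \<le> (c * c') * p m' w" if "t \<in> {0..R}" for t w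
    proof -
      have "p k (usol (Y w) t) \<le> c * r m w" using c(2)[OF that, of "Y w"] by (simp add: r_def)
      also have "\<dots> \<le> c * (c' * p m' w)" by (rule mult_left_mono[OF c'(2) c(1)])
      finally show ?thesis by simp
    qed
    then show "\<exists>m c. c \<ge> 0 \<and> (\<forall>t\<in>{0..R}. \<forall>w. p k (usol (Y w) t) \<le> c * p m w)"
      using c(1) c'(1) by (intro exI[of _ m'] exI[of _ "c * c'"]) simp
  qed
qed

lemma mild_0:
  assumes v: "mild z v"
  shows "v 0 = z"
proof -
  have "vconv 1 v 0 = 0" by (rule vconv_0[OF _ fcont_Icc[OF mild_cont[OF v]]]) simp
  then have "A 0 = v 0 - z" using v unfolding mild_def by force
  then show ?thesis using closed_lin_op_0[OF A] by simp
qed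

text \<open>After k steps the shifted curve is the mild solution starting at v (k s), which the next
  application evaluates at time s. Hence every iterate stays in \<open>Z1\<close>.\<close>

lemma Gop_pow:
  assumes v: "mild z v" and s: "s > 0"
  shows "(Gop p C S \<alpha> s ^^ k) z = v (real k * s) \<and> (Gop p C S \<alpha> s ^^ k) z \<in> Z1 p C S \<alpha>"
proof (induction k)
  case 0
  show ?case using mild_Gop(1)[OF v] mild_0[OF v] by simp
next
  case (Suc k)
  have m: "mild (v (real n * s)) (\<lambda>t. v (t + real n * s))" for n using s by (intro mild_shift[OF v]) simp
  have "(Gop p C S \<alpha> s ^^ Suc k) z = Gop p C S \<alpha> s (v (real k * s))" using Suc by simp
  also have "\<dots> = v (s + real k * s)" using s by (intro mild_Gop(2)[OF m]) simp
  also have "s + real k * s = real (Suc k) * s" by (simp add: algebra_simps)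
  finally have "(Gop p C S \<alpha> s ^^ Suc k) z = v (real (Suc k) * s)" .
  then show ?case using mild_Gop(1)[OF m[of "Suc k"]] by simp
qed

end

theorem theorem2p4:
  fixes p :: "nat \<Rightarrow> 'a::real_vector \<Rightarrow> real"
    and N :: nat
    and \<alpha> tt :: "nat \<Rightarrow> real"
    and Cj :: "nat \<Rightarrow> 'a \<Rightarrow> 'a"
    and DA :: "nat \<Rightarrow> 'a set"
    and A :: "nat \<Rightarrow> 'a \<Rightarrow> 'a"
    and S :: "nat \<Rightarrow> real \<Rightarrow> 'a \<Rightarrow> 'a"
    and C :: "'a \<Rightarrow> 'a"
  assumes X: "frechet p" "fseparable p" "\<exists>x::'a. x \<noteq> 0"
    and N2: "N \<ge> 2"
    and alpha: "\<forall>j\<in>{1..N}. \<alpha> j \<ge> 0"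
    and tpos: "\<forall>j\<in>{1..N}. tt j > 0"
    and Cj: "\<forall>j\<in>{1..N}. fbounded_op p (Cj j) \<and> inj (Cj j)"
    and Aj: "\<forall>j\<in>{1..N}. closed_lin_op p (DA j) (A j)"
    and Sj: "\<forall>j\<in>{1..N}. int_C_semigroup p (\<alpha> j) (Cj j) (DA j) (A j) (S j)"
    and C: "fbounded_op p C" "inj C"
    and emb: "\<forall>j\<in>{1..N}. cont_embedded (semRC p C) (range C)
               (semCD p (Cj j) (DA j) (A j) (nat \<lceil>\<alpha> j\<rceil>))
               (Cj j ` dom_pow (DA j) (A j) (nat \<lceil>\<alpha> j\<rceil>))"
    and i: "\<exists>X0. fdense (semRC p C) X0 (range C) \<and>
              (\<forall>x\<in>X0. \<forall>j\<in>{1..N}. ftendsto p (\<lambda>t. Gop p (Cj j) (S j) (\<alpha> j) t x) 0 at_top)"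
    and ii: "\<exists>x\<in>range C. \<exists>m. \<forall>j\<in>{1..N}.
              filterlim (\<lambda>t. p m (Gop p (Cj j) (S j) (\<alpha> j) t x)) at_top at_top"
  shows "dd_chaotic_sg p N Cj S \<alpha> (fdense p (range C) UNIV)
       \<and> dd_chaotic_ops p N (\<lambda>j. Z1 p (Cj j) (S j) (\<alpha> j))
            (\<lambda>j. Gop p (Cj j) (S j) (\<alpha> j) (tt j)) (fdense p (range C) UNIV)"
proof -
  interpret frechet_space p by unfold_locales (rule X(1))
  define J where "J = {1..N}"
  have J: "finite J" "J \<noteq> {}" using N2 by (auto simp: J_def)
  define T where "T j t w = Gop p (Cj j) (S j) (\<alpha> j) t (C w)" for j t w
  have sg: "integrated_semigroup p (\<alpha> j) (Cj j) (DA j) (A j) (S j)" if "j \<in> J" for j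
    using that alpha Cj Aj Sj by unfold_locales (auto simp: J_def)
  have "\<forall>j\<in>J. \<exists>u. (\<forall>w. integrated_semigroup.mild p (DA j) (A j) (C w) (u w))
      \<and> (\<forall>k R. \<exists>m c. c \<ge> 0 \<and> (\<forall>t\<in>{0..R}. \<forall>w. p k (u w t) \<le> c * p m w))"
    using integrated_semigroup.embedded_solutions[OF sg C] emb by (simp add: J_def)
  then obtain U where mild: "\<And>j w. j \<in> J \<Longrightarrow> integrated_semigroup.mild p (DA j) (A j) (C w) (U j w)"
    and U_bound: "\<And>j k R. j \<in> J \<Longrightarrow> \<exists>m c. c \<ge> 0 \<and> (\<forall>t\<in>{0..R}. \<forall>w. p k (U j w t) \<le> c * p m w)"
    by (drule_tac bchoice) blast
  note linC = fbounded_op_linear[OF C(1)]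
  have TU: "T j t w = U j w t" if "j \<in> J" "t \<ge> 0" for j t w
    unfolding T_def by (rule integrated_semigroup.mild_Gop(2)[OF sg[OF that(1)] mild[OF that(1)] that(2)])
  have CZ: "C w \<in> Z1 p (Cj j) (S j) (\<alpha> j)" if "j \<in> J" for j w
    by (rule integrated_semigroup.mild_Gop(1)[OF sg[OF that] mild[OF that]])
  have T_cont: "fcont_on {0..} (\<lambda>t. T j t w)" if "j \<in> J" for j w
  proof (rule fcont_on_cong)
    show "fcont_on {0..} (U j w)" by (rule integrated_semigroup.mild_cont[OF sg[OF that] mild[OF that]])
    show "U j w t = T j t w" if "t \<in> {0..}" for t using TU[OF \<open>j \<in> J\<close>] that by simp
  qed
  have T_diff: "T j t (v - w) = T j t v - T j t w" if "j \<in> J" "t \<ge> 0" for j t v w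
  proof -
    note m = integrated_semigroup.mild_diff[OF sg[OF that(1)] mild[OF that(1)] mild[OF that(1)], of v w]
    show ?thesis using integrated_semigroup.mild_Gop(2)[OF sg[OF that(1)] m that(2)]
      by (simp add: T_def[of j t "v - w"] linear_diff[OF linC] TU that)
  qed
  have T_scaleR: "T j t (c *\<^sub>R w) = c *\<^sub>R T j t w" if "j \<in> J" "t \<ge> 0" for j t c w
  proof -
    note m = integrated_semigroup.mild_scaleR[OF sg[OF that(1)] mild[OF that(1)], of c w]
    show ?thesis using integrated_semigroup.mild_Gop(2)[OF sg[OF that(1)] m that(2)]
      by (simp add: T_def[of j t "c *\<^sub>R w"] linear_cmul[OF linC] TU that)
  qed
  obtain w0 m where w0: "\<And>j. j \<in> J \<Longrightarrow> filterlim (\<lambda>t. p m (T j t w0)) at_top at_top"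
    using ii unfolding J_def T_def by blast
  obtain X0 where X0: "fdense (semRC p C) X0 (range C)"
    "\<And>x j. x \<in> X0 \<Longrightarrow> j \<in> J \<Longrightarrow> ftendsto p (\<lambda>t. Gop p (Cj j) (S j) (\<alpha> j) t x) 0 at_top"
    using i unfolding J_def by blast
  interpret null_orbit_family p J T m w0
  proof
    show "\<exists>m c. 0 \<le> c \<and> (\<forall>t\<in>{0..R}. \<forall>x. p k (T j t x) \<le> c * p m x)" if "j \<in> J" for j k R
      using U_bound[OF that, of R k] TU[OF that] by simp
    fix w k and e :: real assume "e > 0"
    then obtain d where d: "d > 0" "\<And>x y. fdist p x y < d \<Longrightarrow> p k (x - y) < e" using p_small_of_fdist by blast
    obtain x where x: "x \<in> X0" "fdist (semRC p C) (C w) x < d"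
      using X0(1) d(1) unfolding fdense_def by blast
    obtain y where y: "x = C y" using X0(1) x(1) unfolding fdense_def by blast
    have "fdist p w y < d" using x(2) by (simp add: y fdist_semRC[OF linC C(2)])
    then have "p k (w - y) < e" by (rule d(2))
    moreover have "ftendsto p (\<lambda>t. T j t y) 0 at_top" if "j \<in> J" for j
      using X0(2)[OF x(1) that] by (simp add: T_def y)
    ultimately show "\<exists>y. (\<forall>j\<in>J. ftendsto p (\<lambda>t. T j t y) 0 at_top) \<and> p k (w - y) < e" by blast
  qed (use J w0 T_diff T_scaleR in auto)
  obtain a x where "block_system p J T m w0 a x"
  proof -
    obtain a x where ax: "\<forall>i. a i > 0 \<and> real i \<le> a i \<and> null (x i) \<and> p i (x i) \<le> (1/2) ^ i"
      "\<forall>i. \<forall>j\<in>J. \<forall>t\<in>{a i..real (Suc i) * a i}. p m (T j t (x i)) \<ge> 3"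
      "\<forall>i. \<forall>l<i. \<forall>j\<in>J. \<forall>t\<ge>a i. p i (T j t (x l)) \<le> (1/2) ^ i / real (Suc i)"
      "\<forall>l. \<forall>i<l. \<forall>j\<in>J. \<forall>t\<in>{0..real (Suc i) * a i}. p l (T j t (x l)) \<le> (1/2) ^ l"
      using blocks_exist by (elim exE conjE) (rule that)
    have "block_system p J T m w0 a x" by unfold_locales (use ax in blast)+
    then show ?thesis by (rule that)
  qed
  then interpret block_system p J T m w0 a x .
  obtain W where W: "uncountable W" "\<And>y k e. e > 0 \<Longrightarrow> \<exists>v\<in>W. p k (y - v) < e"
    and large: "\<And>v v' K. v \<in> W \<Longrightarrow> v' \<in> W \<Longrightarrow> v \<noteq> v' \<Longrightarrow>
      \<exists>i\<ge>K. \<forall>j\<in>J. \<forall>t\<in>{a i..real (Suc i) * a i}. p m (T j t (v - v')) \<ge> 1"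
    and small: "\<And>v v' e K. v \<in> W \<Longrightarrow> v' \<in> W \<Longrightarrow> v \<noteq> v' \<Longrightarrow> e > 0 \<Longrightarrow>
      \<exists>i\<ge>K. \<forall>j\<in>J. \<forall>t\<in>{a i..real (Suc i) * a i}. fdist p (T j t (v - v')) 0 < e"
  proof (rule chaotic_set[OF X(2) J(2)], goal_cases)
    case (1 W)
    show ?case by (rule 1(1)[OF 1(2-5)])
  qed
  \<comment> \<open>The lower bound on the metric when the m-th seminorm of the difference is at
    least 1.\<close>
  define \<sigma> where "\<sigma> = (1/2::real) ^ Suc m * (1 / (1 + 1))"
  have \<sigma>: "\<sigma> > 0" by (simp add: \<sigma>_def)
  have pos_block: "t \<ge> 0" if "t \<in> {a i..real (Suc i) * a i}" for t i using that a_pos[of i] by simp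
  have large': "\<exists>i\<ge>K. \<forall>j\<in>J. \<forall>t\<in>{a i..real (Suc i) * a i}. fdist p (T j t v) (T j t v') \<ge> \<sigma>"
    if v: "v \<in> W" "v' \<in> W" "v \<noteq> v'" for v v' K
  proof -
    obtain i where i: "i \<ge> K" "\<And>j t. j \<in> J \<Longrightarrow> t \<in> {a i..real (Suc i) * a i} \<Longrightarrow> p m (T j t (v - v')) \<ge> 1"
      using large[OF v, of K] by blast
    have "fdist p (T j t v) (T j t v') \<ge> \<sigma>" if "j \<in> J" "t \<in> {a i..real (Suc i) * a i}" for j t
      unfolding \<sigma>_def
      using i(2)[OF that] T_diff[OF that(1) pos_block[OF that(2)]] by (intro fdist_ge_frac) auto
    then show ?thesis using i(1) by blast
  qed
  have small': "\<exists>i\<ge>K. \<forall>j\<in>J. \<forall>t\<in>{a i..real (Suc i) * a i}. fdist p (T j t v) (T j t v') < e"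
    if v: "v \<in> W" "v' \<in> W" "v \<noteq> v'" and e: "e > 0" for v v' e K
  proof -
    obtain i where i: "i \<ge> K" "\<And>j t. j \<in> J \<Longrightarrow> t \<in> {a i..real (Suc i) * a i} \<Longrightarrow> fdist p (T j t (v - v')) 0 < e"
      using small[OF v e, of K] by blast
    have "fdist p (T j t v) (T j t v') < e" if "j \<in> J" "t \<in> {a i..real (Suc i) * a i}" for j t
      using i(2)[OF that] T_diff[OF that(1) pos_block[OF that(2)]] fdist_diff[of "T j t v" "T j t v'"] by simp
    then show ?thesis using i(1) by blast
  qed
  define SS where "SS = C ` W"
  have unc: "uncountable SS"
    using W(1) countable_image_inj_eq[of C W] C(2) unfolding SS_def by (auto simp: inj_on_subset)
  have dense: "fdense p SS UNIV" if R: "fdense p (range C) UNIV"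
    unfolding fdense_def
  proof (intro conjI ballI allI impI)
    fix y and e :: real assume e: "e > 0"
    obtain w where w: "fdist p y (C w) < e / 2" using R e unfolding fdense_def by (metis UNIV_I half_gt_zero imageE)
    obtain d where d: "d > 0" "\<And>v. fdist p w v < d \<Longrightarrow> fdist p (C w) (C v) < e / 2"
      using C(1) e unfolding fbounded_op_def by (metis half_gt_zero)
    obtain k \<delta> where k: "\<delta> > 0" "\<And>x y. p k (x - y) < \<delta> \<Longrightarrow> fdist p x y < d" using fdist_small_of_p[OF d(1)] by blast
    obtain v where v: "v \<in> W" "p k (w - v) < \<delta>" using W(2)[OF k(1)] by blast
    have "fdist p (C w) (C v) < e / 2" by (rule d(2)[OF k(2)[OF v(2)]])
    then have "fdist p y (C v) < e" using w fdist_triangle[of y "C v" "C w"] by linarith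
    then show "\<exists>z\<in>SS. fdist p y z < e" using v(1) unfolding SS_def by blast
  qed simp
  have TG: "Gop p (Cj j) (S j) (\<alpha> j) t (C v) = T j t v" for j t v by (simp add: T_def)
  have cont: "continuous_on {0..} (\<lambda>t. fdist p (T j t v) (T j t v'))" if "j \<in> J" for j v v'
    by (rule continuous_on_fdist[OF T_cont[OF that] T_cont[OF that]])
  have chaos_sg: "updens_real {t. t \<ge> 0 \<and> (\<forall>j\<in>J. fdist p (T j t v) (T j t v') \<ge> \<sigma>)} = 1
      \<and> updens_real {t. t \<ge> 0 \<and> (\<forall>j\<in>J. fdist p (T j t v) (T j t v') < e)} = 1"
    if v: "v \<in> W" "v' \<in> W" "v \<noteq> v'" and e: "e > 0" for v v' e
  proof
    show "updens_real {t. t \<ge> 0 \<and> (\<forall>j\<in>J. fdist p (T j t v) (T j t v') \<ge> \<sigma>)} = 1"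
    proof (rule updens_real_eq_1[OF _ a_pos a_ge])
      show "\<exists>i\<ge>K. {a i..real (Suc i) * a i} \<subseteq> {t. t \<ge> 0 \<and> (\<forall>j\<in>J. fdist p (T j t v) (T j t v') \<ge> \<sigma>)}" for K
        using large'[OF v, of K] pos_block by blast
    qed (rule sets_lebesgue_levels(1)[OF J(1) cont])
    show "updens_real {t. t \<ge> 0 \<and> (\<forall>j\<in>J. fdist p (T j t v) (T j t v') < e)} = 1"
    proof (rule updens_real_eq_1[OF _ a_pos a_ge])
      show "\<exists>i\<ge>K. {a i..real (Suc i) * a i} \<subseteq> {t. t \<ge> 0 \<and> (\<forall>j\<in>J. fdist p (T j t v) (T j t v') < e)}" for K
        using small'[OF v e, of K] pos_block by blast
    qed (rule sets_lebesgue_levels(2)[OF J(1) cont])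
  qed
  have "dd_chaotic_sg p N Cj S \<alpha> (fdense p (range C) UNIV)"
    unfolding dd_chaotic_sg_def J_def[symmetric]
  proof (intro exI[of _ SS] exI[of _ \<sigma>] conjI ballI allI impI)
    show "SS \<subseteq> Z1 p (Cj j) (S j) (\<alpha> j)" if "j \<in> J" for j using CZ[OF that] unfolding SS_def by blast
    fix e :: real and x y assume e: "e > 0" and xy: "x \<in> SS" "y \<in> SS" "x \<noteq> y"
    obtain v v' where v: "v \<in> W" "v' \<in> W" "x = C v" "y = C v'" using xy unfolding SS_def by blast
    then have "v \<noteq> v'" using xy by blast
    from chaos_sg[OF v(1,2) this e]
    show "updens_real {t. t \<ge> 0 \<and> (\<forall>j\<in>J. \<sigma> \<le> fdist p (Gop p (Cj j) (S j) (\<alpha> j) t x) (Gop p (Cj j) (S j) (\<alpha> j) t y))} = 1"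
      and "updens_real {t. t \<ge> 0 \<and> (\<forall>j\<in>J. fdist p (Gop p (Cj j) (S j) (\<alpha> j) t x) (Gop p (Cj j) (S j) (\<alpha> j) t y) < e)} = 1"
      by (simp_all add: v(3,4) TG)
  qed (use unc dense \<sigma> in auto)
  moreover
  define B where "B j = Gop p (Cj j) (S j) (\<alpha> j) (tt j)" for j
  have tt: "tt j > 0" if "j \<in> J" for j using tpos that by (simp add: J_def)
  have B_pow: "(B j ^^ k) (C v) = T j (real k * tt j) v" and B_Z1: "(B j ^^ k) (C v) \<in> Z1 p (Cj j) (S j) (\<alpha> j)"
    if j: "j \<in> J" for j k v
  proof -
    note Gp = integrated_semigroup.Gop_pow[OF sg[OF j] mild[OF j] tt[OF j], of k v]
    have "T j (real k * tt j) v = U j v (real k * tt j)" using tt[OF j] by (intro TU[OF j]) simp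
    then show "(B j ^^ k) (C v) = T j (real k * tt j) v" using Gp unfolding B_def by simp
    show "(B j ^^ k) (C v) \<in> Z1 p (Cj j) (S j) (\<alpha> j)" using Gp unfolding B_def by (rule conjunct2)
  qed
  \<comment> \<open>The steps differ with j; if a i / lo \<le> k \<le> (i + 1) a i / hi, then k
    times each step lies in the i-th block, so one set of indices k serves all j.\<close>
  define lo hi where "lo = Min (tt ` J)" and "hi = Max (tt ` J)"
  have lohi: "lo > 0" "hi > 0" "\<And>j. j \<in> J \<Longrightarrow> lo \<le> tt j \<and> tt j \<le> hi"
  proof -
    show "lo > 0" unfolding lo_def using J tt by (subst Min_gr_iff) auto
    show b: "\<And>j. j \<in> J \<Longrightarrow> lo \<le> tt j \<and> tt j \<le> hi" unfolding lo_def hi_def using J by simp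
    obtain j where "j \<in> J" using J(2) by blast
    then show "hi > 0" using b[of j] tt[of j] by linarith
  qed
  have times: "real k * tt j \<in> {a i..real (Suc i) * a i}"
    if "j \<in> J" "1 / lo * a i \<le> real k" "real k \<le> 1 / hi * (real (Suc i) * a i)" for i j k
  proof -
    have "a i \<le> real k * lo" using that(2) lohi(1) by (simp add: field_simps)
    also have "\<dots> \<le> real k * tt j" using lohi(3)[OF that(1)] by (intro mult_left_mono) auto
    finally have 1: "a i \<le> real k * tt j" .
    have "real k * tt j \<le> real k * hi" using lohi(3)[OF that(1)] by (intro mult_left_mono) auto
    also have "\<dots> \<le> real (Suc i) * a i" using that(3) lohi(2) by (simp add: field_simps)
    finally show ?thesis using 1 by simp
  qed
  have c: "1 / lo > 0" "1 / hi > 0" using lohi by auto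
  have chaos_ops: "updens_nat {k. k \<ge> 1 \<and> (\<forall>j\<in>J. fdist p (T j (real k * tt j) v) (T j (real k * tt j) v') \<ge> \<sigma>)} = 1
      \<and> updens_nat {k. k \<ge> 1 \<and> (\<forall>j\<in>J. fdist p (T j (real k * tt j) v) (T j (real k * tt j) v') < e)} = 1"
    if v: "v \<in> W" "v' \<in> W" "v \<noteq> v'" and e: "e > 0" for v v' e
  proof
    show "updens_nat {k. k \<ge> 1 \<and> (\<forall>j\<in>J. fdist p (T j (real k * tt j) v) (T j (real k * tt j) v') \<ge> \<sigma>)} = 1"
    proof (rule updens_nat_eq_1[OF a_pos a_ge c])
      fix K
      obtain i where i: "i \<ge> K" "\<forall>j\<in>J. \<forall>t\<in>{a i..real (Suc i) * a i}. fdist p (T j t v) (T j t v') \<ge> \<sigma>"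
        using large'[OF v, of K] by blast
      then show "\<exists>i\<ge>K. {k. k \<ge> 1 \<and> 1 / lo * a i \<le> real k \<and> real k \<le> 1 / hi * (real (Suc i) * a i)}
          \<subseteq> {k. k \<ge> 1 \<and> (\<forall>j\<in>J. fdist p (T j (real k * tt j) v) (T j (real k * tt j) v') \<ge> \<sigma>)}"
        using times by blast
    qed
    show "updens_nat {k. k \<ge> 1 \<and> (\<forall>j\<in>J. fdist p (T j (real k * tt j) v) (T j (real k * tt j) v') < e)} = 1"
    proof (rule updens_nat_eq_1[OF a_pos a_ge c])
      fix K
      obtain i where i: "i \<ge> K" "\<forall>j\<in>J. \<forall>t\<in>{a i..real (Suc i) * a i}. fdist p (T j t v) (T j t v') < e"
        using small'[OF v e, of K] by blast
      then show "\<exists>i\<ge>K. {k. k \<ge> 1 \<and> 1 / lo * a i \<le> real k \<and> real k \<le> 1 / hi * (real (Suc i) * a i)}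
          \<subseteq> {k. k \<ge> 1 \<and> (\<forall>j\<in>J. fdist p (T j (real k * tt j) v) (T j (real k * tt j) v') < e)}"
        using times by blast
    qed
  qed
  have "dd_chaotic_ops p N (\<lambda>j. Z1 p (Cj j) (S j) (\<alpha> j)) B (fdense p (range C) UNIV)"
    unfolding dd_chaotic_ops_def J_def[symmetric]
  proof (intro exI[of _ SS] exI[of _ \<sigma>] conjI ballI allI impI)
    show "(B j ^^ k) x \<in> Z1 p (Cj j) (S j) (\<alpha> j)" if "j \<in> J" "x \<in> SS" for j x k
      using B_Z1[OF that(1)] that(2) unfolding SS_def by blast
    fix e :: real and x y assume e: "e > 0" and xy: "x \<in> SS" "y \<in> SS" "x \<noteq> y"
    obtain v v' where v: "v \<in> W" "v' \<in> W" "x = C v" "y = C v'" using xy unfolding SS_def by blast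
    then have "v \<noteq> v'" using xy by blast
    from chaos_ops[OF v(1,2) this e]
    show "updens_nat {k. k \<ge> 1 \<and> (\<forall>j\<in>J. \<sigma> \<le> fdist p ((B j ^^ k) x) ((B j ^^ k) y))} = 1"
      and "updens_nat {k. k \<ge> 1 \<and> (\<forall>j\<in>J. fdist p ((B j ^^ k) x) ((B j ^^ k) y) < e)} = 1"
      by (simp_all add: v(3,4) B_pow cong: ball_cong)
  qed (use unc dense \<sigma> in auto)
  ultimately show ?thesis by (simp add: B_def[abs_def])
qed

end
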